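(* Let $1\le m,k\le n-1$, $f\in L^1(V_{n,m})$ and $\mathrm{Re}\,\alpha>m-1$. If $k\le n-m$ and $u\in V_{n,k}$, then $$(F_{m,k}M^\alpha f)(u)=c_{n,k,m}(\alpha)\,(\mathcal S^{\alpha+n-k-m}_{m,k}f)(u),\qquad c_{n,k,m}(\alpha)=\frac{\Gamma_m((n-k)/2)\,\Gamma_m(\alpha/2)}{\Gamma_m(m/2)\,\Gamma_m((\alpha+n-k-m)/2)}.$$ If $2m\le n$ and $u\in V_{n,m}$, then $$(F_mM^\alpha f)(u)=(M^\alpha F_mf)(u)=c_{n,m}(\alpha)\,(Q^{\alpha+n-2m}f)(u),\qquad c_{n,m}(\alpha)=\frac{\Gamma_m((n-m)/2)\,\Gamma_m(\alpha/2)}{\Gamma_m(m/2)\,\Gamma_m((\alpha+n-2m)/2)}.$$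
   Context: $V_{n,m}=\{v\in M_{n,m}(\mathbb R): v'v=I_m\}$ is the Stiefel manifold, with $O(n)$-invariant probability measure $d_*v$ (and $L^1$ with respect to it). For a square matrix $a$, $|a|=|\det a|$. $\Gamma_m(\alpha)=\pi^{m(m-1)/4}\prod_{j=0}^{m-1}\Gamma(\alpha-j/2)$. Equalities between integrable functions are understood for almost all $u$. Funk transform ($k+m\le n$): $(F_{m,k}f)(u)=\int_{V_{n-k,m}} f\Big(g_u\begin{bmatrix}\omega\\ 0\end{bmatrix}\Big)d_*\omega$, $u\in V_{n,k}$, where $g_u\in O(n)$ is any matrix with $g_u\begin{bmatrix}0\\ I_k\end{bmatrix}=u$; $F_m=F_{m,m}$. Cosine and sine transforms: $$(M^\alpha f)(u)=\int_{V_{n,m}}f(v)|v'uu'v|^{(\alpha-m)/2}d_*v,\qquad (Q^\alpha f)(u)=\int_{V_{n,m}}f(v)|I_m-v'uu'v|^{(\alpha+m-n)/2}d_*v\qquad (u\in V_{n,m}),$$ $$(\mathcal S^\alpha_{m,k}f)(u)=\int_{V_{n,m}}f(v)|I_m-v'uu'v|^{(\alpha+k-n)/2}d_*v\qquad (u\in V_{n,k}).$$ *)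

theory Defs
  imports "HOL-Probability.Probability"
begin

text \<open>
  An n-by-m real matrix has the type \<^typ>\<open>real ^ 'm ^ 'n\<close>, where \<^prop>\<open>n = CARD('n)\<close> and
  \<^prop>\<open>m = CARD('m)\<close>.
\<close>

definition stiefel :: "(real ^ 'm ^ 'n) set" where
  "stiefel = {v. transpose v ** v = mat 1}"

text \<open>
  The unique O(n)-invariant Borel probability measure on the Stiefel manifold.  It exists whenever
  the manifold is nonempty, i.e. for \<^term>\<open>CARD('m) \<le> CARD('n)\<close>, and is unspecified otherwise.
\<close>

definition stiefel_measure :: "(real ^ 'm ^ 'n) measure" where
  "stiefel_measure = (THE M. prob_space M \<and> space M = stiefel \<and>
     sets M = sets (restrict_space borel stiefel) \<and>
     (\<forall>g :: real ^ 'n ^ 'n. orthogonal_matrix g \<longrightarrow> distr M M (\<lambda>v. g ** v) = M))"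

text \<open>
  Index types carry no order, so the splitting of the n rows of a matrix into an upper block and a
  lower block is given by a bijection \<open>e\<close> of \<^typ>\<open>'d + 'k\<close> onto \<^typ>\<open>'n\<close>: the rows
  \<open>e (Inl p)\<close> are the upper ones (there are \<open>n - k = CARD('d)\<close> of them), the rows \<open>e (Inr q)\<close> the
  lower ones.
\<close>

definition stack ::
    "('d::finite + 'k::finite \<Rightarrow> 'n::finite) \<Rightarrow> real ^ 'm ^ 'd \<Rightarrow> real ^ 'm ^ 'k \<Rightarrow> real ^ 'm ^ 'n" where
  "stack e a b = (\<chi> i. case inv e i of Inl p \<Rightarrow> a $ p | Inr q \<Rightarrow> b $ q)"

text \<open>
  The value of the transform at a point of the Stiefel manifold does not depend on the choice of
  the matrix \<open>g\<close>, since two choices differ by an orthogonal transformation of the upper block.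
\<close>

definition funk ::
    "('d::finite + 'k::finite \<Rightarrow> 'n::finite) \<Rightarrow> (real ^ 'm ^ 'n \<Rightarrow> complex) \<Rightarrow> real ^ 'k ^ 'n \<Rightarrow> complex" where
  "funk e f u =
     (let g = (SOME g :: real ^ 'n ^ 'n. orthogonal_matrix g \<and> g ** stack e 0 (mat 1) = u)
      in \<integral>\<omega>. f (g ** stack e \<omega> 0) \<partial>(stiefel_measure :: (real ^ 'm ^ 'd) measure))"

text \<open>
  The transforms below use the complex power of a nonnegative real base; the library convention
  \<open>0 powr z = 0\<close> concerns only the set on which the determinant vanishes, which is null for the cosine transform
  and, if \<open>k + m \<le> n\<close>, for the sine transforms.
\<close>

definition cosine_transform ::
    "complex \<Rightarrow> (real ^ 'm ^ 'n \<Rightarrow> complex) \<Rightarrow> real ^ 'm ^ 'n \<Rightarrow> complex" where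
  "cosine_transform \<alpha> f u =
     (\<integral>v. f v * of_real \<bar>det (transpose v ** u ** transpose u ** v)\<bar>
              powr ((\<alpha> - of_nat CARD('m)) / 2) \<partial>stiefel_measure)"

definition sine_transform ::
    "complex \<Rightarrow> (real ^ 'm ^ 'n \<Rightarrow> complex) \<Rightarrow> real ^ 'm ^ 'n \<Rightarrow> complex" where
  "sine_transform \<alpha> f u =
     (\<integral>v. f v * of_real \<bar>det (mat 1 - transpose v ** u ** transpose u ** v)\<bar>
              powr ((\<alpha> + of_nat CARD('m) - of_nat CARD('n)) / 2) \<partial>stiefel_measure)"

definition sine_transform_gen ::
    "complex \<Rightarrow> (real ^ 'm ^ 'n \<Rightarrow> complex) \<Rightarrow> real ^ 'k ^ 'n \<Rightarrow> complex" where
  "sine_transform_gen \<alpha> f u =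
     (\<integral>v. f v * of_real \<bar>det (mat 1 - transpose v ** u ** transpose u ** v)\<bar>
              powr ((\<alpha> + of_nat CARD('k) - of_nat CARD('n)) / 2) \<partial>stiefel_measure)"

definition Gamma_m :: "nat \<Rightarrow> complex \<Rightarrow> complex" where
  "Gamma_m m \<alpha> =
     of_real (pi powr (real m * (real m - 1) / 4)) * (\<Prod>j<m. Gamma (\<alpha> - of_nat j / 2))"

definition c_nkm :: "nat \<Rightarrow> nat \<Rightarrow> nat \<Rightarrow> complex \<Rightarrow> complex" where
  "c_nkm n k m \<alpha> =
     (Gamma_m m ((of_nat n - of_nat k) / 2) * Gamma_m m (\<alpha> / 2)) /
     (Gamma_m m (of_nat m / 2) * Gamma_m m ((\<alpha> + of_nat n - of_nat k - of_nat m) / 2))"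

definition c_nm :: "nat \<Rightarrow> nat \<Rightarrow> complex \<Rightarrow> complex" where
  "c_nm n m \<alpha> =
     (Gamma_m m ((of_nat n - of_nat m) / 2) * Gamma_m m (\<alpha> / 2)) /
     (Gamma_m m (of_nat m / 2) * Gamma_m m ((\<alpha> + of_nat n - 2 * of_nat m) / 2))"

text \<open>Equality of integrable functions, understood almost everywhere.\<close>

definition eq_L1 :: "'a measure \<Rightarrow> ('a \<Rightarrow> complex) \<Rightarrow> ('a \<Rightarrow> complex) \<Rightarrow> bool" where
  "eq_L1 M \<phi> \<psi> \<longleftrightarrow> integrable M \<phi> \<and> integrable M \<psi> \<and> (AE x in M. \<phi> x = \<psi> x)"

end

theory Submission
  imports Defs
begin

text \<open>
  Write \<open>p = (\<alpha> - m) / 2\<close>.  Let \<open>u\<close> be an orthonormal \<open>k\<close>-frame and let the columns of \<open>b\<close> be an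
  orthonormal basis of the orthogonal complement of the columns of \<open>u\<close>, so that \<open>b b' = I - u u'\<close>.
  The Funk transform at \<open>u\<close> averages over the frames \<open>b \<omega>\<close>, and the cosine kernel between \<open>v\<close> and
  \<open>b \<omega>\<close> is \<open>|a' \<omega> \<omega>' a|\<close> to the power \<open>p\<close> with \<open>a = b' v\<close>.  The mean of this power over \<open>\<omega>\<close> does
  not change when \<open>a\<close> is rotated from the left, and it is multiplied by the power \<open>p\<close> of \<open>|t' t|\<close> when
  \<open>a\<close> is replaced by \<open>a t\<close>.  Since every \<open>a\<close> of full rank is an orthonormal frame times a square matrix,
  the mean is a constant times the power \<open>p\<close> of \<open>|a' a|\<close>, and \<open>a' a = I - v' u u' v\<close>.  Fubini's theorem
  then turns \<open>F M f\<close> into a constant times the sine transform of \<open>f\<close>.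

  The constant is found by averaging over a Gaussian matrix \<open>a\<close> as well
  (\<open>nn_integral_cos_kernel\<close>, \<open>integral_cos_kernel\<close>): with \<open>\<omega>\<close> fixed, \<open>\<omega>' a\<close> is a square Gaussian matrix,
  so the constant is the quotient of two moments of Gaussian Gram determinants.  These moments
  (\<open>gram_moment_glue\<close>, \<open>gram_moment_complex_glue\<close>) are products of moments of chi-square variables,
  because a Gram determinant is the squared length of the residual of a column times the Gram determinant
  with that column replaced by its normalized residual.  Chi-square variables have moments of all orders of real part
  above \<open>- 1 / 2\<close>, which is the hypothesis \<open>Re \<alpha> > m - 1\<close>.

  For the second factorization, fix \<open>u\<close> and consider a uniformly distributed pair \<open>(v, w)\<close> of \<open>m\<close>-frames
  that are orthogonal to each other.  A rotation exchanges the two members of such a pair, so the law is symmetric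
  (\<open>distr_complement_pair_swap\<close>), and integrating \<open>f (w) |v' u u' v|\<^sup>p\<close> against this law in either order gives
  \<open>M F f\<close> on one side and the same sine transform on the other.

  Two measure-theoretic points remain.  The uniform law on the Stiefel manifold is obtained by
  orthonormalizing a Gaussian matrix with the Gram-Schmidt process, which commutes with rotations; it is the only
  invariant law, since any invariant law can be averaged over the orthogonal group.  And the matrix \<open>g\<close> in the
  Funk transform is chosen without any regularity in \<open>u\<close>; but the law of \<open>b \<omega>\<close> is
  also the law of the Gram-Schmidt process applied to \<open>(I - u u') X\<close> with \<open>X\<close> Gaussian
  (\<open>distr_complement_frame\<close>), an expression that is jointly measurable in \<open>u\<close> and \<open>X\<close>.
\<close>

section \<open>Orthonormal families\<close>

definition orthonormal_on :: "'i set \<Rightarrow> ('i \<Rightarrow> 'a::real_inner) \<Rightarrow> bool" where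
  "orthonormal_on I x \<longleftrightarrow> (\<forall>i\<in>I. \<forall>k\<in>I. x i \<bullet> x k = (if i = k then 1 else 0))"

lemma orthonormal_onD:
  "orthonormal_on I x \<Longrightarrow> i \<in> I \<Longrightarrow> k \<in> I \<Longrightarrow> x i \<bullet> x k = (if i = k then 1 else 0)"
  by (simp add: orthonormal_on_def)

lemma orthonormal_on_subset: "orthonormal_on I x \<Longrightarrow> J \<subseteq> I \<Longrightarrow> orthonormal_on J x"
  by (auto simp: orthonormal_on_def subset_iff)

lemma orthogonal_transformation_inner:
  "orthogonal_transformation h \<Longrightarrow> h v \<bullet> h w = v \<bullet> w"
  by (simp add: orthogonal_transformation_def)

lemma inner_orthonormal_sum:
  assumes "orthonormal_on I x" "finite I" "k \<in> I"
  shows "(\<Sum>i\<in>I. c i *\<^sub>R x i) \<bullet> x k = c k"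
proof -
  have "(\<Sum>i\<in>I. c i *\<^sub>R x i) \<bullet> x k = (\<Sum>i\<in>I. if i = k then c i else 0)"
    by (auto simp: inner_sum_left orthonormal_onD[OF assms(1)] assms(3) intro!: sum.cong)
  with assms show ?thesis by simp
qed

text \<open>
  The component of \<open>v\<close> orthogonal to the span of the \<open>z i\<close>, provided that these are orthonormal; the formula
  is used for arbitrary families as well.
\<close>
definition residual :: "'i set \<Rightarrow> ('i \<Rightarrow> 'a::real_inner) \<Rightarrow> 'a \<Rightarrow> 'a" where
  "residual I z v = v - (\<Sum>i\<in>I. (v \<bullet> z i) *\<^sub>R z i)"

lemma residual_orthogonal:
  assumes "orthonormal_on I z" "finite I" "k \<in> I"
  shows "residual I z v \<bullet> z k = 0"
  by (simp add: residual_def inner_diff_left inner_orthonormal_sum[OF assms])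

lemma orthonormal_on_insert_residual:
  assumes "orthonormal_on I z" "finite I" "j \<notin> I" "residual I z v \<noteq> 0"
  shows "orthonormal_on (insert j I) (z(j := sgn (residual I z v)))"
proof -
  let ?q = "sgn (residual I z v)"
  have "?q \<bullet> ?q = 1"
    using assms(4) by (simp add: dot_square_norm norm_sgn)
  moreover have "?q \<bullet> z k = 0" if "k \<in> I" for k
    using residual_orthogonal[OF assms(1,2) that] by (simp add: sgn_div_norm)
  ultimately show ?thesis
    using assms(1,3) by (auto simp: orthonormal_on_def inner_commute)
qed

text \<open>
  Also valid when the residual vanishes, since then \<open>sgn\<close> of it is \<open>0\<close> as well.
\<close>
lemma eq_residual_plus:
  "v = norm (residual I z v) *\<^sub>R sgn (residual I z v) + (\<Sum>i\<in>I. (v \<bullet> z i) *\<^sub>R z i)"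
  by (cases "residual I z v = 0") (simp_all add: residual_def sgn_div_norm)

lemma residual_isometry:
  assumes "linear h" "\<And>v w. h v \<bullet> h w = v \<bullet> w"
  shows "residual I (\<lambda>i. h (z i)) (h v) = h (residual I z v)"
  by (simp add: residual_def assms(2) linear_diff[OF assms(1)] linear_sum[OF assms(1)]
        linear_scale[OF assms(1)])

definition householder_reflection :: "'a::real_inner \<Rightarrow> 'a \<Rightarrow> 'a" where
  "householder_reflection d v = v - (2 * (v \<bullet> d) / (d \<bullet> d)) *\<^sub>R d"

lemma orthogonal_transformation_householder: "orthogonal_transformation (householder_reflection d)"
  unfolding orthogonal_transformation_def
proof (intro conjI allI)
  show "linear (householder_reflection d)"
    by (rule linearI)
       (simp_all add: householder_reflection_def inner_add_left add_divide_distrib scaleR_add_left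
          scaleR_diff_right distrib_left)
  fix v w
  show "householder_reflection d v \<bullet> householder_reflection d w = v \<bullet> w"
  proof (cases "d = 0")
    case False
    then have c: "d \<bullet> d \<noteq> 0" by simp
    define t where "t = 2 * (v \<bullet> d) / (d \<bullet> d)"
    define u where "u = 2 * (w \<bullet> d) / (d \<bullet> d)"
    have "householder_reflection d v \<bullet> householder_reflection d w
        = v \<bullet> w - u * (v \<bullet> d) - t * (w \<bullet> d) + t * (u * (d \<bullet> d))"
      unfolding householder_reflection_def t_def[symmetric] u_def[symmetric]
      by (simp add: inner_diff_left inner_diff_right algebra_simps inner_commute[of d w])
    also have "u * (d \<bullet> d) = 2 * (w \<bullet> d)" using c by (simp add: u_def)
    also have "u * (v \<bullet> d) = t * (w \<bullet> d)" by (simp add: u_def t_def)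
    finally show ?thesis by simp
  qed (simp add: householder_reflection_def)
qed

lemma householder_reflection_swap:
  assumes "v \<bullet> v = w \<bullet> w"
  shows "householder_reflection (v - w) v = w"
proof (cases "v = w")
  case False
  have "2 * (v \<bullet> (v - w)) = (v - w) \<bullet> (v - w)"
    using assms by (simp add: inner_diff_left inner_diff_right inner_commute)
  moreover have "(v - w) \<bullet> (v - w) \<noteq> 0" using False by simp
  ultimately show ?thesis unfolding householder_reflection_def by simp
qed (simp add: householder_reflection_def)

text \<open>
  The vectors are brought into place one at a time: a reflection that moves the image of \<open>x j\<close> to \<open>y j\<close>
  has its axis along their difference, which is orthogonal to every \<open>y i\<close> that is already in place.
\<close>
lemma orthogonal_transformation_orthonormal_on:
  fixes x y :: "'i \<Rightarrow> 'a::real_inner"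
  assumes "finite I" "orthonormal_on I x" "orthonormal_on I y"
  shows "\<exists>h. orthogonal_transformation h \<and> (\<forall>i\<in>I. h (x i) = y i)"
  using assms
proof (induction I)
  case empty
  then show ?case using orthogonal_transformation_id by blast
next
  case (insert j I)
  then have "orthonormal_on I x" "orthonormal_on I y"
    by (auto intro: orthonormal_on_subset)
  with insert.IH obtain h where h: "orthogonal_transformation h" "\<forall>i\<in>I. h (x i) = y i"
    by auto
  let ?d = "h (x j) - y j"
  have "h (x j) \<bullet> h (x j) = y j \<bullet> y j"
    using insert.prems by (simp add: orthonormal_on_def orthogonal_transformation_inner[OF h(1)])
  then have j: "householder_reflection ?d (h (x j)) = y j" by (rule householder_reflection_swap)
  have "householder_reflection ?d (h (x i)) = y i" if "i \<in> I" for i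
  proof -
    have "y i \<bullet> h (x j) = x i \<bullet> x j"
      using h that by (metis orthogonal_transformation_inner)
    then have "y i \<bullet> ?d = 0"
      using insert.prems insert.hyps that by (auto simp: orthonormal_on_def inner_diff_right)
    then show ?thesis using h(2) that by (simp add: householder_reflection_def)
  qed
  with j show ?case
    by (intro exI[of _ "householder_reflection ?d \<circ> h"])
       (simp add: orthogonal_transformation_compose[OF orthogonal_transformation_householder h(1)]
          del: o_apply, simp)
qed

section \<open>Gram determinants\<close>

definition gram :: "('i \<Rightarrow> 'a::real_inner) \<Rightarrow> real^'i^'i" where
  "gram x = (\<chi> i k. x i \<bullet> x k)"

lemma det_replaced_column:
  fixes c :: "real^'i"
  shows "det (\<chi> i k. if k = j then c $ i else (mat 1 :: real^'i^'i) $ i $ k) = c $ j"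
  using cramer_lemma[where A="mat 1 :: real^'i^'i" and x=c and k=j] by (simp cong: if_cong)

text \<open>
  The new Gram matrix is \<open>E' G E\<close>, where \<open>E\<close> is the identity matrix with its column \<open>j\<close> replaced by the
  coefficients, and \<open>det E = c j\<close>.
\<close>
lemma det_gram_update:
  fixes x :: "'i::finite \<Rightarrow> 'a::real_inner"
  shows "det (gram (x(j := \<Sum>i\<in>UNIV. c i *\<^sub>R x i))) = (c j)\<^sup>2 * det (gram x)"
proof -
  define E :: "real^'i^'i" where "E = (\<chi> i k. if k = j then (\<chi> i. c i) $ i else mat 1 $ i $ k)"
  have detE: "det E = c j" unfolding E_def det_replaced_column by simp
  define y where "y = x(j := \<Sum>i\<in>UNIV. c i *\<^sub>R x i)"
  have upd: "y k = (\<Sum>i\<in>UNIV. E $ i $ k *\<^sub>R x i)" for k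
    by (auto simp: y_def E_def mat_def if_distrib[where f="\<lambda>t. t *\<^sub>R _"] cong: if_cong)
  have "y i \<bullet> y k = (\<Sum>a\<in>UNIV. E $ a $ i * (\<Sum>b\<in>UNIV. (x a \<bullet> x b) * E $ b $ k))" for i k
    unfolding upd by (subst inner_sum_left) (simp add: inner_sum_right sum_distrib_left mult_ac)
  then have "gram y = transpose E ** (gram x ** E)"
    by (simp add: gram_def vec_eq_iff matrix_matrix_mult_def transpose_def)
  then show ?thesis
    by (simp add: det_mul detE power2_eq_square y_def)
qed

text \<open>
  Subtracting multiples of other columns from column \<open>j\<close> does not change the Gram determinant, and scaling
  column \<open>j\<close> scales it quadratically.  The case of a vanishing residual is included.
\<close>
lemma det_gram_residual:
  fixes x :: "'i::finite \<Rightarrow> 'a::real_inner"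
  assumes "j \<notin> I"
  shows "det (gram x) = (norm (residual I x (x j)))\<^sup>2 * det (gram (x(j := sgn (residual I x (x j)))))"
proof -
  define r where "r = residual I x (x j)"
  let ?y = "x(j := sgn r)"
  define c where "c i = (if i = j then norm r else if i \<in> I then x j \<bullet> x i else 0)" for i
  have "(\<Sum>i\<in>UNIV. c i *\<^sub>R ?y i) = norm r *\<^sub>R sgn r + (\<Sum>i\<in>UNIV-{j}. c i *\<^sub>R ?y i)"
    by (subst sum.remove[of _ j]) (auto simp: c_def)
  also have "(\<Sum>i\<in>UNIV-{j}. c i *\<^sub>R ?y i) = (\<Sum>i\<in>I. (x j \<bullet> x i) *\<^sub>R x i)"
    using assms by (intro sum.mono_neutral_cong_right) (auto simp: c_def)
  also have "norm r *\<^sub>R sgn r + \<dots> = x j"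
    unfolding r_def by (rule eq_residual_plus[symmetric])
  finally have "x = ?y(j := \<Sum>i\<in>UNIV. c i *\<^sub>R ?y i)" by auto
  then have "det (gram x) = (c j)\<^sup>2 * det (gram ?y)"
    using det_gram_update[of ?y j c] by simp
  then show ?thesis by (simp add: c_def r_def)
qed

lemma gram_orthonormal: "orthonormal_on UNIV x \<Longrightarrow> gram x = mat 1"
  by (simp add: gram_def orthonormal_on_def mat_def vec_eq_iff)

lemma gram_isometry: "(\<And>v w. h v \<bullet> h w = v \<bullet> w) \<Longrightarrow> gram (\<lambda>i. h (x i)) = gram x"
  by (simp add: gram_def)

section \<open>The standard Gaussian measure\<close>

lemma lborel_nn_integral_translate:
  fixes f :: "'a::euclidean_space \<Rightarrow> ennreal"
  assumes [measurable]: "f \<in> borel_measurable borel"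
  shows "(\<integral>\<^sup>+x. f (x + c) \<partial>lborel) = (\<integral>\<^sup>+x. f x \<partial>lborel)"
proof -
  have "(\<integral>\<^sup>+x. f x \<partial>lborel) = (\<integral>\<^sup>+x. f x \<partial>distr lborel borel ((+) c))"
    by (simp add: lborel_distr_plus)
  also have "\<dots> = (\<integral>\<^sup>+x. f (x + c) \<partial>lborel)"
    by (subst nn_integral_distr) (simp_all add: add.commute)
  finally show ?thesis by simp
qed

text \<open>
  Lebesgue measure and its image under \<open>h\<close> are both translation invariant, hence proportional; the usual Fubini argument
  for this is carried out against the unit ball, which \<open>h\<close> preserves, so that the factor is \<open>1\<close>.
\<close>
lemma lborel_distr_orthogonal_transformation:
  fixes h :: "'a::euclidean_space \<Rightarrow> 'a"
  assumes h: "orthogonal_transformation h"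
  shows "distr lborel borel h = lborel"
proof (rule measure_eqI)
  have lin: "linear h" using h by (rule orthogonal_transformation_linear)
  have hm [measurable]: "h \<in> borel_measurable borel"
    using lin by (intro borel_measurable_continuous_onI linear_continuous_on) (rule linear_linear[THEN iffD2])
  fix A assume "A \<in> sets (distr lborel borel h)"
  then have A [measurable]: "A \<in> sets borel" by simp
  define B where "B = (cball 0 1 :: 'a set)"
  have B [measurable]: "B \<in> sets borel" by (simp add: B_def)
  have nB: "- h x \<in> B \<longleftrightarrow> x \<in> B" for x
    by (simp add: B_def orthogonal_transformation_norm[OF h])
  have "emeasure lborel (h -` A) * emeasure lborel B
      = (\<integral>\<^sup>+x. \<integral>\<^sup>+y. indicator A (h x) * indicator B y \<partial>lborel \<partial>lborel)"
  proof -
    have "emeasure lborel (h -` A) = (\<integral>\<^sup>+x. indicator A (h x) \<partial>lborel)"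
      using measurable_sets[OF hm A] by (simp flip: nn_integral_indicator add: indicator_vimage)
    then show ?thesis by (simp add: nn_integral_cmult nn_integral_multc)
  qed
  also have "\<dots> = (\<integral>\<^sup>+x. \<integral>\<^sup>+y. indicator A (h x) * indicator B (y + (- h x)) \<partial>lborel \<partial>lborel)"
  proof (rule nn_integral_cong)
    fix x :: 'a
    show "(\<integral>\<^sup>+y. indicator A (h x) * indicator B y \<partial>lborel)
        = (\<integral>\<^sup>+y. indicator A (h x) * indicator B (y + (- h x)) \<partial>lborel)"
      by (rule lborel_nn_integral_translate[of "\<lambda>y. indicator A (h x) * indicator B y" "- h x", symmetric])
         measurable
  qed
  also have "\<dots> = (\<integral>\<^sup>+y. \<integral>\<^sup>+x. indicator A (h x) * indicator B (y + (- h x)) \<partial>lborel \<partial>lborel)"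
    by (rule lborel_pair.Fubini') simp
  also have "\<dots> = (\<integral>\<^sup>+y. \<integral>\<^sup>+x. indicator A (h x + y) * indicator B (- h x) \<partial>lborel \<partial>lborel)"
  proof (rule nn_integral_cong)
    fix y :: 'a
    obtain c where c: "h c = y" using orthogonal_transformation_surj[OF h] by (metis surjD)
    have "(\<integral>\<^sup>+x. indicator A (h x) * indicator B (y + (- h x)) \<partial>lborel)
        = (\<integral>\<^sup>+x. indicator A (h (x + c)) * indicator B (y + (- h (x + c))) \<partial>lborel)"
      by (rule lborel_nn_integral_translate[symmetric]) simp
    also have "\<dots> = (\<integral>\<^sup>+x. indicator A (h x + y) * indicator B (- h x) \<partial>lborel)"
      by (simp add: linear_add[OF lin] c)
    finally show "(\<integral>\<^sup>+x. indicator A (h x) * indicator B (y + (- h x)) \<partial>lborel)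
        = (\<integral>\<^sup>+x. indicator A (h x + y) * indicator B (- h x) \<partial>lborel)" .
  qed
  also have "\<dots> = (\<integral>\<^sup>+x. \<integral>\<^sup>+y. indicator A (h x + y) * indicator B (- h x) \<partial>lborel \<partial>lborel)"
    by (rule lborel_pair.Fubini') simp
  also have "\<dots> = (\<integral>\<^sup>+x. emeasure lborel A * indicator B (- h x) \<partial>lborel)"
  proof (rule nn_integral_cong)
    fix x :: 'a
    show "(\<integral>\<^sup>+y. indicator A (h x + y) * indicator B (- h x) \<partial>lborel) = emeasure lborel A * indicator B (- h x)"
      using lborel_nn_integral_translate[of "indicator A" "h x"]
      by (simp add: nn_integral_multc add.commute)
  qed
  also have "\<dots> = emeasure lborel A * emeasure lborel B"
    by (simp add: nn_integral_cmult indicator_def nB flip: nn_integral_indicator)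
  finally have "emeasure lborel (h -` A) * emeasure lborel B = emeasure lborel A * emeasure lborel B" .
  moreover have "emeasure lborel B \<noteq> 0" "emeasure lborel B \<noteq> \<infinity>"
    using unit_ball_vol_pos[of "real DIM('a)"]
    by (simp_all add: B_def emeasure_cball less_imp_neq[symmetric] del: unit_ball_vol_pos)
  ultimately show "emeasure (distr lborel borel h) A = emeasure lborel A"
    by (auto simp: emeasure_distr mult.commute[of _ "emeasure lborel B"] ennreal_mult_cancel_left)
qed simp

abbreviation std_normal :: "real measure" where
  "std_normal \<equiv> density lborel std_normal_density"

lemma prob_space_std_normal: "prob_space std_normal"
  by (rule prob_space_normal_density) simp

text \<open>
  The construction from independent coordinates gives the laws of coordinates directly; rotation invariance
  is read off from the density in \<open>gauss_eq_density\<close>.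
\<close>
definition gauss :: "'a::euclidean_space measure" where
  "gauss = distr (Pi\<^sub>M Basis (\<lambda>_. std_normal)) borel (\<lambda>f. \<Sum>b\<in>Basis. f b *\<^sub>R b)"

lemma sets_gauss [simp, measurable_cong]: "sets gauss = sets borel"
  and space_gauss [simp]: "space gauss = UNIV"
  by (simp_all add: gauss_def)

lemma prob_space_gauss: "prob_space gauss"
  unfolding gauss_def
  by (intro prob_space.prob_space_distr prob_space_PiM prob_space_std_normal) measurable

lemma PiM_density:
  assumes "finite I" and M: "sigma_finite_measure M" and D: "sigma_finite_measure (density M \<phi>)"
    and [measurable]: "\<phi> \<in> borel_measurable M"
  shows "Pi\<^sub>M I (\<lambda>_. density M \<phi>) = density (Pi\<^sub>M I (\<lambda>_. M)) (\<lambda>f. \<Prod>i\<in>I. \<phi> (f i))"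
proof -
  interpret M: product_sigma_finite "\<lambda>_. M" using M by (simp add: product_sigma_finite_def)
  interpret D: product_sigma_finite "\<lambda>_. density M \<phi>" using D by (simp add: product_sigma_finite_def)
  show ?thesis
  proof (rule D.PiM_eqI[OF assms(1), symmetric])
    show "sets (density (Pi\<^sub>M I (\<lambda>_. M)) (\<lambda>f. \<Prod>i\<in>I. \<phi> (f i))) = sets (Pi\<^sub>M I (\<lambda>_. density M \<phi>))"
      by (simp cong: sets_PiM_cong)
    fix A assume A: "\<And>i. i \<in> I \<Longrightarrow> A i \<in> sets (density M \<phi>)"
    then have [measurable]: "Pi\<^sub>E I A \<in> sets (Pi\<^sub>M I (\<lambda>_. M))"
      using assms(1) by (intro sets_PiM_I_finite) auto
    have "emeasure (density (Pi\<^sub>M I (\<lambda>_. M)) (\<lambda>f. \<Prod>i\<in>I. \<phi> (f i))) (Pi\<^sub>E I A)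
       = (\<integral>\<^sup>+f. (\<Prod>i\<in>I. \<phi> (f i)) * indicator (Pi\<^sub>E I A) f \<partial>Pi\<^sub>M I (\<lambda>_. M))"
      by (subst emeasure_density) auto
    also have "\<dots> = (\<integral>\<^sup>+f. (\<Prod>i\<in>I. \<phi> (f i) * indicator (A i) (f i)) \<partial>Pi\<^sub>M I (\<lambda>_. M))"
    proof (rule nn_integral_cong)
      fix f assume "f \<in> space (Pi\<^sub>M I (\<lambda>_. M))"
      then have "(indicator (Pi\<^sub>E I A) f :: ennreal) = (\<Prod>i\<in>I. indicator (A i) (f i))"
        using assms(1) by (auto simp: indicator_def space_PiM PiE_def Pi_def)
      then show "(\<Prod>i\<in>I. \<phi> (f i)) * indicator (Pi\<^sub>E I A) f = (\<Prod>i\<in>I. \<phi> (f i) * indicator (A i) (f i))"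
        by (simp add: prod.distrib)
    qed
    also have "\<dots> = (\<Prod>i\<in>I. \<integral>\<^sup>+x. \<phi> x * indicator (A i) x \<partial>M)"
      using assms(1) A by (intro M.product_nn_integral_prod) auto
    also have "\<dots> = (\<Prod>i\<in>I. emeasure (density M \<phi>) (A i))"
      using A by (intro prod.cong) (auto simp: emeasure_density)
    finally show "emeasure (density (Pi\<^sub>M I (\<lambda>_. M)) (\<lambda>f. \<Prod>i\<in>I. \<phi> (f i))) (Pi\<^sub>E I A)
      = (\<Prod>i\<in>I. emeasure (density M \<phi>) (A i))" .
  qed
qed

lemma prod_std_normal_density:
  assumes "finite I"
  shows "(\<Prod>i\<in>I. std_normal_density (f i)) = (1 / sqrt (2 * pi)) ^ card I * exp (- (\<Sum>i\<in>I. (f i)\<^sup>2) / 2)"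
proof -
  have "std_normal_density t = (1 / sqrt (2 * pi)) * exp (- t\<^sup>2 / 2)" for t
    by (simp add: normal_density_def)
  then show ?thesis
    by (simp only: prod.distrib prod_constant exp_sum[OF assms, symmetric] sum_negf
        flip: sum_divide_distrib)
qed

lemma gauss_eq_density:
  "(gauss :: 'a::euclidean_space measure)
     = density lborel (\<lambda>x. ennreal ((1 / sqrt (2 * pi)) ^ DIM('a) * exp (- (norm x)\<^sup>2 / 2)))"
proof -
  let ?g = "\<lambda>x::'a. \<Prod>b\<in>Basis. ennreal (std_normal_density (x \<bullet> b))"
  have "(gauss :: 'a measure) = distr (density (Pi\<^sub>M Basis (\<lambda>_. lborel)) (\<lambda>f. \<Prod>b\<in>Basis. ennreal (std_normal_density (f b))))
      borel (\<lambda>f. \<Sum>b\<in>Basis. f b *\<^sub>R b)"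
    unfolding gauss_def
    using prob_space_std_normal
    by (subst PiM_density) (auto intro: sigma_finite_lborel prob_space_imp_sigma_finite)
  also have "\<dots> = distr (density (Pi\<^sub>M Basis (\<lambda>_. lborel)) (?g \<circ> (\<lambda>f. \<Sum>b\<in>Basis. f b *\<^sub>R b)))
      borel (\<lambda>f. \<Sum>b\<in>Basis. f b *\<^sub>R b)"
  proof -
    have "(\<lambda>f. \<Prod>b\<in>Basis. ennreal (std_normal_density (f b))) = ?g \<circ> (\<lambda>f. \<Sum>b\<in>Basis. f b *\<^sub>R b)"
      unfolding o_def by (intro ext prod.cong refl) (simp only: inner_sum_left_Basis)
    then show ?thesis by simp
  qed
  also have "\<dots> = density lborel ?g"
    unfolding o_def by (subst density_distr[symmetric]) (simp_all flip: lborel_eq)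
  also have "?g = (\<lambda>x. ennreal ((1 / sqrt (2 * pi)) ^ DIM('a) * exp (- (norm x)\<^sup>2 / 2)))"
  proof
    fix x :: 'a
    have "(norm x)\<^sup>2 = (\<Sum>b\<in>Basis. (x \<bullet> b)\<^sup>2)"
      unfolding power2_norm_eq_inner by (subst euclidean_inner) (simp only: power2_eq_square)
    then show "?g x = ennreal ((1 / sqrt (2 * pi)) ^ DIM('a) * exp (- (norm x)\<^sup>2 / 2))"
      by (simp only: prod_ennreal prod_std_normal_density normal_density_nonneg finite_Basis)
  qed
  finally show ?thesis .
qed

lemma gauss_orthogonal_transformation:
  fixes h :: "'a::euclidean_space \<Rightarrow> 'a"
  assumes h: "orthogonal_transformation h"
  shows "distr gauss gauss h = gauss"
proof -
  have hm [measurable]: "h \<in> borel_measurable borel"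
    using h by (intro borel_measurable_continuous_onI linear_continuous_on)
      (simp add: linear_linear orthogonal_transformation_linear)
  let ?g = "\<lambda>x::'a. ennreal ((1 / sqrt (2 * pi)) ^ DIM('a) * exp (- (norm x)\<^sup>2 / 2))"
  have "distr gauss gauss h = distr (density lborel (?g \<circ> h)) borel h"
    by (intro distr_cong) (simp_all add: gauss_eq_density o_def orthogonal_transformation_norm[OF h])
  also have "\<dots> = density (distr lborel borel h) ?g"
    unfolding o_def by (intro density_distr[symmetric]) auto
  also have "\<dots> = gauss"
    by (simp add: lborel_distr_orthogonal_transformation[OF h] gauss_eq_density)
  finally show ?thesis .
qed

lemma distr_PiM_std_normal_reindex:
  assumes "inj_on \<sigma> I" "\<sigma> \<in> I \<rightarrow> K"
  shows "distr (Pi\<^sub>M K (\<lambda>_. std_normal)) (Pi\<^sub>M I (\<lambda>_. std_normal)) (\<lambda>f. \<lambda>i\<in>I. f (\<sigma> i))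
       = Pi\<^sub>M I (\<lambda>_. std_normal)"
  using distr_PiM_reindex[of K "\<lambda>_. std_normal" \<sigma> I] assms prob_space_std_normal by simp

lemma card_orthonormal_on_le_DIM:
  fixes e :: "'i \<Rightarrow> 'a::euclidean_space"
  assumes "orthonormal_on I e" "finite I"
  shows "card I \<le> DIM('a)"
proof -
  have inj: "inj_on e I"
    using assms(1) by (intro inj_onI) (metis orthonormal_onD zero_neq_one)
  have "pairwise orthogonal (e ` I)" 
    using assms(1) by (force simp: pairwise_def orthogonal_def orthonormal_on_def)
  moreover have "0 \<notin> e ` I"
  proof
    assume "0 \<in> e ` I"
    then obtain i where "i \<in> I" "e i = 0" by auto
    then show False using orthonormal_onD[OF assms(1), of i i] by simp
  qed
  ultimately have "independent (e ` I)" by (rule pairwise_orthogonal_independent)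
  then have "card (e ` I) \<le> DIM('a)" using independent_bound by blast
  with inj show ?thesis by (simp add: card_image)
qed

lemma orthonormal_to_Basis:
  fixes e :: "'i \<Rightarrow> 'a::euclidean_space"
  assumes e: "orthonormal_on I e" and "finite I"
  obtains h \<sigma> where "orthogonal_transformation h" "inj_on \<sigma> I" "\<sigma> ` I \<subseteq> (Basis :: 'a set)"
    "\<And>i. i \<in> I \<Longrightarrow> h (e i) = \<sigma> i"
proof -
  obtain \<sigma> where \<sigma>: "\<sigma> ` I \<subseteq> (Basis :: 'a set)" "inj_on \<sigma> I"
    using card_orthonormal_on_le_DIM[OF assms] card_le_inj[of I "Basis :: 'a set"] assms(2) by auto
  then have "orthonormal_on I \<sigma>"
    by (auto simp: orthonormal_on_def inner_Basis image_subset_iff inj_on_def)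
  from orthogonal_transformation_orthonormal_on[OF assms(2) e this] \<sigma> that show ?thesis by blast
qed

text \<open>
  A rotation takes the family \<open>e\<close> to members of the standard basis, for which the claim holds by
  construction.
\<close>
lemma gauss_orthonormal_coordinates:
  fixes e :: "'i \<Rightarrow> 'a::euclidean_space"
  assumes e: "orthonormal_on I e" and "finite I"
  shows "distr gauss (Pi\<^sub>M I (\<lambda>_. std_normal)) (\<lambda>x. \<lambda>i\<in>I. x \<bullet> e i) = Pi\<^sub>M I (\<lambda>_. std_normal)"
proof -
  obtain h \<sigma> where h: "orthogonal_transformation h" and inj: "inj_on \<sigma> I"
    and \<sigma>: "\<sigma> ` I \<subseteq> (Basis :: 'a set)" and he: "\<And>i. i \<in> I \<Longrightarrow> h (e i) = \<sigma> i"
    using orthonormal_to_Basis[OF assms] by blast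
  have [measurable]: "h \<in> borel_measurable borel"
    using h by (intro borel_measurable_continuous_onI linear_continuous_on)
      (simp add: linear_linear orthogonal_transformation_linear)
  have "distr gauss (Pi\<^sub>M I (\<lambda>_. std_normal)) (\<lambda>x. \<lambda>i\<in>I. x \<bullet> e i)
      = distr gauss (Pi\<^sub>M I (\<lambda>_. std_normal)) (\<lambda>x. \<lambda>i\<in>I. h x \<bullet> \<sigma> i)"
    by (intro distr_cong refl restrict_ext)
       (metis he orthogonal_transformation_inner[OF h])
  also have "\<dots> = distr (distr gauss gauss h) (Pi\<^sub>M I (\<lambda>_. std_normal)) (\<lambda>x. \<lambda>i\<in>I. x \<bullet> \<sigma> i)"
    by (subst distr_distr) (auto simp: o_def)
  also have "\<dots> = distr (gauss :: 'a measure) (Pi\<^sub>M I (\<lambda>_. std_normal)) (\<lambda>x. \<lambda>i\<in>I. x \<bullet> \<sigma> i)"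
    by (simp add: gauss_orthogonal_transformation[OF h])
  also have "\<dots> = distr (Pi\<^sub>M (Basis :: 'a set) (\<lambda>_. std_normal)) (Pi\<^sub>M I (\<lambda>_. std_normal))
      (\<lambda>f. \<lambda>i\<in>I. (\<Sum>b\<in>Basis. f b *\<^sub>R b) \<bullet> \<sigma> i)"
    unfolding gauss_def by (subst distr_distr) (auto simp: o_def)
  also have "\<dots> = distr (Pi\<^sub>M (Basis :: 'a set) (\<lambda>_. std_normal)) (Pi\<^sub>M I (\<lambda>_. std_normal))
      (\<lambda>f. \<lambda>i\<in>I. f (\<sigma> i))"
    using \<sigma> by (intro distr_cong refl restrict_ext) (auto simp only: inner_sum_left_Basis image_subset_iff)
  also have "\<dots> = Pi\<^sub>M I (\<lambda>_. std_normal)"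
    using \<sigma> by (intro distr_PiM_std_normal_reindex inj) auto
  finally show ?thesis .
qed

text \<open>
  Here \<open>E\<close> embeds a smaller space isometrically and \<open>L\<close> is its adjoint, so the coordinates of \<open>L x\<close> are the
  coordinates of \<open>x\<close> along the orthonormal family of images under \<open>E\<close>.
\<close>
lemma gauss_coisometry:
  fixes L :: "'b::euclidean_space \<Rightarrow> 'a::euclidean_space"
  assumes E: "\<And>v w. E v \<bullet> E w = v \<bullet> w" and adj: "\<And>x v. L x \<bullet> v = x \<bullet> E v"
  shows "distr gauss gauss L = gauss"
proof -
  have "orthonormal_on Basis E"
    by (simp add: orthonormal_on_def E inner_Basis)
  note coord = gauss_orthonormal_coordinates[OF this finite_Basis]
  have L: "L x = (\<Sum>b\<in>Basis. (\<lambda>b\<in>Basis. x \<bullet> E b) b *\<^sub>R b)" for x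
    by (simp add: adj[symmetric] euclidean_representation cong: sum.cong)
  have "distr gauss gauss L = distr (distr gauss (Pi\<^sub>M Basis (\<lambda>_. std_normal)) (\<lambda>x. \<lambda>b\<in>Basis. x \<bullet> E b))
      borel (\<lambda>f. \<Sum>b\<in>Basis. f b *\<^sub>R b)"
    by (subst distr_distr) (auto simp: o_def L intro!: distr_cong)
  also have "\<dots> = gauss" by (simp only: coord gauss_def[symmetric])
  finally show ?thesis .
qed

section \<open>The law of a squared residual\<close>

text \<open>
  The Gamma distribution with shape \<open>a\<close> and scale \<open>1\<close>.
\<close>
definition gamma_law :: "real \<Rightarrow> real measure" where
  "gamma_law a = density lborel (\<lambda>y. ennreal (indicator {0<..} y * y powr (a - 1) / exp y / Gamma a))"

lemma sets_gamma_law [simp, measurable_cong]: "sets (gamma_law a) = sets borel"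
  and space_gamma_law [simp]: "space (gamma_law a) = UNIV"
  by (simp_all add: gamma_law_def)

lemma nn_integral_gamma_law_powr:
  assumes "0 < a" "0 < a + p"
  shows "(\<integral>\<^sup>+y. ennreal (\<bar>y\<bar> powr p) \<partial>gamma_law a) = ennreal (Gamma (a + p) / Gamma a)"
proof -
  have G: "Gamma a > 0" using assms by (simp add: Gamma_real_pos)
  have "(\<integral>\<^sup>+y. ennreal (\<bar>y\<bar> powr p) \<partial>gamma_law a)
      = (\<integral>\<^sup>+y. ennreal (indicator {0<..} y * y powr (a - 1) / exp y / Gamma a) * ennreal (\<bar>y\<bar> powr p) \<partial>lborel)"
    unfolding gamma_law_def by (subst nn_integral_density) auto
  also have "\<dots> = (\<integral>\<^sup>+y. ennreal (indicator {0..} y * y powr (a + p - 1) / exp y) * ennreal (1 / Gamma a) \<partial>lborel)"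
  proof (rule nn_integral_cong)
    fix y :: real
    have "y powr (a - 1) * y powr p = y powr (a + p - 1)" if "y > 0"
      using that by (simp flip: powr_add add: algebra_simps)
    then show "ennreal (indicator {0<..} y * y powr (a - 1) / exp y / Gamma a) * ennreal (\<bar>y\<bar> powr p)
        = ennreal (indicator {0..} y * y powr (a + p - 1) / exp y) * ennreal (1 / Gamma a)"
      using G by (cases "y > 0"; cases "y = 0") (auto simp: indicator_def simp flip: ennreal_mult'' ennreal_mult intro!: arg_cong[where f=ennreal])
  qed
  also have "\<dots> = ennreal (Gamma (a + p)) * ennreal (1 / Gamma a)"
    using Gamma_conv_nn_integral_real[of "a + p"] assms by (simp add: nn_integral_multc)
  also have "\<dots> = ennreal (Gamma (a + p) / Gamma a)"
    using G by (simp flip: ennreal_mult'')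
  finally show ?thesis .
qed

text \<open>
  This form of a complex power of a nonnegative real makes it measurable in the base.
\<close>
lemma of_real_abs_powr:
  "complex_of_real \<bar>y\<bar> powr p = (if y = 0 then 0 else exp (p * of_real (ln \<bar>y\<bar>)))"
  by (simp add: powr_def Ln_of_real)

lemma norm_of_real_abs_powr: "norm (complex_of_real \<bar>y\<bar> powr p) = \<bar>y\<bar> powr Re p"
  by (simp add: norm_powr_real_powr)

lemma measurable_of_real_abs_powr [measurable]:
  assumes [measurable]: "g \<in> borel_measurable M"
  shows "(\<lambda>x. complex_of_real \<bar>g x\<bar> powr p) \<in> borel_measurable M"
  unfolding of_real_abs_powr by measurable

lemma integral_gamma_law_powr:
  fixes p :: complex
  assumes "0 < a" "0 < a + Re p"
  shows "(\<integral>y. of_real \<bar>y\<bar> powr p \<partial>gamma_law a) = Gamma (of_real a + p) / Gamma (of_real a)"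
proof -
  have G: "Gamma a > 0" using assms by (simp add: Gamma_real_pos)
  let ?f = "\<lambda>t. complex_of_real t powr ((of_real a + p) - 1) / of_real (exp t)"
  have "(\<integral>y. of_real \<bar>y\<bar> powr p \<partial>gamma_law a)
      = (\<integral>y. (indicator {0<..} y * y powr (a - 1) / exp y / Gamma a) *\<^sub>R (of_real \<bar>y\<bar> powr p :: complex) \<partial>lborel)"
    unfolding gamma_law_def using G by (intro integral_density) (auto simp: indicator_def)
  also have "\<dots> = (\<integral>y. (indicator {0<..} y *\<^sub>R ?f y) / of_real (Gamma a) \<partial>lborel)"
  proof (rule Bochner_Integration.integral_cong[OF refl])
    fix y :: real
    have "complex_of_real (y powr (a - 1)) * of_real y powr p = of_real y powr (of_real a + p - 1)" if "y > 0"
      using that by (simp add: powr_of_real[symmetric] algebra_simps flip: powr_add)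
    then show "(indicator {0<..} y * y powr (a - 1) / exp y / Gamma a) *\<^sub>R (of_real \<bar>y\<bar> powr p :: complex)
        = (indicator {0<..} y *\<^sub>R ?f y) / of_real (Gamma a)"
      by (cases "y > 0") (auto simp: indicator_def scaleR_conv_of_real)
  qed
  also have "\<dots> = (LINT y:{0<..}|lborel. ?f y) / of_real (Gamma a)"
    by (simp add: set_lebesgue_integral_def)
  also have "(LINT y:{0<..}|lborel. ?f y) = Gamma (of_real a + p)"
  proof -
    have "?f absolutely_integrable_on {0<..}"
      using assms by (intro absolutely_integrable_Gamma_integral') simp
    then have "set_integrable lborel {0<..} ?f"
      unfolding set_integrable_def
    proof (subst (asm) integrable_completion)
      have "(\<lambda>t. indicator {0<..} t *\<^sub>R (complex_of_real \<bar>t\<bar> powr ((of_real a + p) - 1) / of_real (exp t)))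
        \<in> borel_measurable lborel" by measurable
      then show "(\<lambda>t. indicator {0<..} t *\<^sub>R ?f t) \<in> borel_measurable lborel"
        by (rule measurable_cong[THEN iffD1, rotated]) (auto simp: indicator_def)
    qed
    then have "(LINT y:{0<..}|lborel. ?f y) = integral {0<..} ?f"
      by (rule set_borel_integral_eq_integral)
    also have "\<dots> = Gamma (of_real a + p)"
      using assms by (intro integral_unique Gamma_integral_complex') simp
    finally show ?thesis .
  qed
  finally show ?thesis by (simp add: Gamma_complex_of_real)
qed

lemma emeasure_lborel_half_sum_squares:
  assumes "finite A" "A \<noteq> {}"
  shows "emeasure (distr (Pi\<^sub>M A (\<lambda>_. lborel)) borel (\<lambda>f. (\<Sum>i\<in>A. (f i)\<^sup>2) / 2)) {..y}
     = ennreal (unit_ball_vol (card A) * (if y > 0 then (2 * y) powr (card A / 2) else 0))"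
proof -
  interpret product_sigma_finite "\<lambda>_. lborel" by standard
  let ?P = "Pi\<^sub>M A (\<lambda>_. lborel :: real measure)"
  let ?T = "\<lambda>f. (\<Sum>i\<in>A. (f i)\<^sup>2) / 2 :: real"
  have "emeasure (distr ?P borel ?T) {..y} = emeasure ?P ({f. ?T f \<le> y} \<inter> space ?P)"
    by (subst emeasure_distr) (auto intro!: arg_cong[where f="emeasure _"])
  also have "\<dots> = ennreal (unit_ball_vol (card A) * (if y > 0 then (2 * y) powr (card A / 2) else 0))"
  proof (cases "y > 0")
    case True
    have "{f. ?T f \<le> y} = {f. sqrt (\<Sum>i\<in>A. (f i)\<^sup>2) \<le> sqrt (2 * y)}"
      by auto
    moreover have "sqrt (2 * y) ^ card A = (2 * y) powr (card A / 2)"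
      using True by (simp add: powr_half_sqrt[symmetric] powr_realpow[symmetric] powr_powr)
    ultimately show ?thesis
      using emeasure_cball_aux[OF assms(1), of "sqrt (2 * y)"] True by simp
  next
    case False
    have "{f. ?T f \<le> y} \<inter> space ?P \<subseteq> Pi\<^sub>E A (\<lambda>_. {0})"
    proof
      fix f assume f: "f \<in> {f. ?T f \<le> y} \<inter> space ?P"
      with False have "(\<Sum>i\<in>A. (f i)\<^sup>2) \<le> 0" by auto
      then have "(\<Sum>i\<in>A. (f i)\<^sup>2) = 0" by (intro antisym sum_nonneg) auto
      then have "\<forall>i\<in>A. f i = 0" using assms(1) by (simp add: sum_nonneg_eq_0_iff)
      with f show "f \<in> Pi\<^sub>E A (\<lambda>_. {0})" by (intro PiE_I) (auto simp: space_PiM)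
    qed
    moreover have "emeasure ?P (Pi\<^sub>E A (\<lambda>_. {0})) = 0"
      using assms by (subst emeasure_PiM) auto
    moreover have "Pi\<^sub>E A (\<lambda>_. {0}) \<in> sets ?P"
      using assms(1) by (intro sets_PiM_I_finite) auto
    ultimately have "emeasure ?P ({f. ?T f \<le> y} \<inter> space ?P) = 0"
      by (auto intro: emeasure_eq_0)
    with False show ?thesis by simp
  qed
  finally show ?thesis .
qed

text \<open>
  The measure of a ball of squared radius \<open>2 y\<close> is known, and the density is its derivative in \<open>y\<close>.
\<close>
lemma distr_lborel_half_sum_squares:
  assumes "finite A" "A \<noteq> {}"
  defines "a \<equiv> card A / 2"
  shows "distr (Pi\<^sub>M A (\<lambda>_. lborel)) borel (\<lambda>f. (\<Sum>i\<in>A. (f i)\<^sup>2) / 2)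
     = density lborel (\<lambda>y. ennreal (indicator {0<..} y * ((2 * pi) powr a * y powr (a - 1) / Gamma a)))"
    (is "?M = ?N")
proof (rule measure_eqI_generator_eq[where E="range atMost" and \<Omega>=UNIV and A="\<lambda>i. {..real i}"])
  have a: "a > 0" using assms by (simp add: card_gt_0_iff)
  then have G: "Gamma a > 0" by (simp add: Gamma_real_pos)
  show "Int_stable (range atMost :: real set set)"
    by (auto simp: Int_stable_def)
  show "sets ?M = sigma_sets UNIV (range atMost)" "sets ?N = sigma_sets UNIV (range atMost)"
    by (simp_all add: borel_eq_atMost)
  show "(\<Union>i. {..real i}) = UNIV"
    using real_arch_simple by auto
  show "emeasure ?M {..real i} \<noteq> \<infinity>" for i
    using emeasure_lborel_half_sum_squares[OF assms(1,2), of "real i"] by simp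
  fix X :: "real set" assume "X \<in> range atMost"
  then obtain y where X: "X = {..y}" by auto
  have M: "emeasure ?M X = ennreal (unit_ball_vol (card A) * (if y > 0 then (2 * y) powr a else 0))"
    unfolding X a_def by (rule emeasure_lborel_half_sum_squares[OF assms(1,2)])
  have "emeasure ?N X = (\<integral>\<^sup>+t. ennreal (indicator {0<..} t * ((2 * pi) powr a * t powr (a - 1) / Gamma a)) * indicator {..y} t \<partial>lborel)"
    by (subst emeasure_density) (auto simp: X)
  also have "\<dots> = (\<integral>\<^sup>+t. ennreal ((2 * pi) powr a / Gamma a) * ennreal (indicator {0..y} t * t powr (a - 1)) \<partial>lborel)"
    using G by (intro nn_integral_cong) (auto simp: indicator_def simp flip: ennreal_mult)
  also have "\<dots> = ennreal ((2 * pi) powr a / Gamma a) * ennreal (if y > 0 then y powr a / a else 0)"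
  proof (cases "y > 0")
    case True
    have "((\<lambda>t. t powr (a - 1)) has_integral (y powr (a - 1 + 1) / (a - 1 + 1))) {0..y}"
      using a True by (intro has_integral_powr_from_0) auto
    from nn_integral_has_integral_lebesgue[OF _ this] True show ?thesis
      by (subst nn_integral_cmult) simp_all
  next
    case False
    then have "indicator {0..y} t * t powr (a - 1) = 0" for t
      by (auto simp: indicator_def)
    with False show ?thesis by (simp only: ennreal_0 mult_zero_right nn_integral_const if_False mult_zero_left)
  qed
  also have "\<dots> = emeasure ?M X"
  proof -
    have "unit_ball_vol (card A) = pi powr a / (a * Gamma a)"
    proof -
      have "a \<notin> \<int>\<^sub>\<le>\<^sub>0" using a by (auto elim: nonpos_Ints_cases)
      then show ?thesis using Gamma_plus1[of a] by (simp add: unit_ball_vol_def a_def[symmetric])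
    qed
    then show ?thesis
      using G a unfolding M
      by (auto simp: powr_mult simp flip: ennreal_mult intro!: arg_cong[where f=ennreal])
  qed
  finally show "emeasure ?M X = emeasure ?N X" ..
qed auto

text \<open>
  The Gaussian density depends on the sum of squares only, so it can be pulled through the image measure of
  \<open>distr_lborel_half_sum_squares\<close>.
\<close>
lemma distr_std_normal_half_sum_squares:
  assumes "finite A" "A \<noteq> {}"
  shows "distr (Pi\<^sub>M A (\<lambda>_. std_normal)) borel (\<lambda>f. (\<Sum>i\<in>A. (f i)\<^sup>2) / 2) = gamma_law (card A / 2)"
proof -
  let ?P = "Pi\<^sub>M A (\<lambda>_. lborel :: real measure)"
  let ?T = "\<lambda>f. (\<Sum>i\<in>A. (f i)\<^sup>2) / 2 :: real"
  define a where "a = card A / 2"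
  have a: "a > 0" using assms by (simp add: a_def card_gt_0_iff)
  then have G: "Gamma a > 0" by (simp add: Gamma_real_pos)
  let ?g = "\<lambda>y::real. ennreal ((1 / sqrt (2 * pi)) ^ card A * exp (- y))"
  have "Pi\<^sub>M A (\<lambda>_. std_normal) = density ?P (\<lambda>f. ?g (?T f))"
    using prob_space_std_normal assms(1)
    by (subst PiM_density)
       (auto intro: sigma_finite_lborel prob_space_imp_sigma_finite simp: prod_ennreal prod_std_normal_density)
  then have "distr (Pi\<^sub>M A (\<lambda>_. std_normal)) borel ?T = density (distr ?P borel ?T) ?g"
    by (subst density_distr) simp_all
  also have "\<dots> = density lborel (\<lambda>y. ennreal (indicator {0<..} y * ((2 * pi) powr a * y powr (a - 1) / Gamma a)) * ?g y)"
    unfolding distr_lborel_half_sum_squares[OF assms] a_def[symmetric]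
    by (subst density_density_eq) auto
  also have "\<dots> = gamma_law a"
    unfolding gamma_law_def
  proof (rule density_cong)
    have "(1 / sqrt (2 * pi)) ^ card A = (2 * pi) powr (- a)"
      by (simp add: powr_half_sqrt[symmetric] powr_realpow[symmetric] powr_powr powr_divide powr_minus_divide a_def)
    then have c: "(2 * pi) powr a * (1 / sqrt (2 * pi)) ^ card A = 1"
      by (simp add: powr_minus)
    show "AE y in lborel. ennreal (indicator {0<..} y * ((2 * pi) powr a * y powr (a - 1) / Gamma a)) * ?g y
        = ennreal (indicator {0<..} y * y powr (a - 1) / exp y / Gamma a)"
    proof (rule AE_I2)
      fix y :: real
      have "indicator {0<..} y * ((2 * pi) powr a * y powr (a - 1) / Gamma a) * ((1 / sqrt (2 * pi)) ^ card A * exp (- y))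
        = ((2 * pi) powr a * (1 / sqrt (2 * pi)) ^ card A) * (indicator {0<..} y * y powr (a - 1) / exp y / Gamma a)"
        by (simp add: exp_minus field_simps)
      then show "ennreal (indicator {0<..} y * ((2 * pi) powr a * y powr (a - 1) / Gamma a)) * ?g y
        = ennreal (indicator {0<..} y * y powr (a - 1) / exp y / Gamma a)"
        by (simp add: c flip: ennreal_mult'')
    qed
  qed auto
  finally show ?thesis by (simp add: a_def)
qed

text \<open>
  After a rotation the family \<open>e\<close> consists of standard basis vectors, and the residual keeps exactly the
  remaining coordinates.
\<close>
lemma distr_gauss_half_residual:
  fixes e :: "'i \<Rightarrow> 'a::euclidean_space"
  assumes e: "orthonormal_on I e" and I: "finite I" "card I < DIM('a)"
  shows "distr gauss borel (\<lambda>x. (norm (residual I e x))\<^sup>2 / 2) = gamma_law (real (DIM('a) - card I) / 2)"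
proof -
  obtain h \<sigma> where h: "orthogonal_transformation h" and inj: "inj_on \<sigma> I"
    and \<sigma>: "\<sigma> ` I \<subseteq> (Basis :: 'a set)" and he: "\<And>i. i \<in> I \<Longrightarrow> h (e i) = \<sigma> i"
    using orthonormal_to_Basis[OF e I(1)] by blast
  have [measurable]: "h \<in> borel_measurable borel"
    using h by (intro borel_measurable_continuous_onI linear_continuous_on)
      (simp add: linear_linear orthogonal_transformation_linear)
  define A where "A = Basis - \<sigma> ` I"
  have cA: "card A = DIM('a) - card I"
    using \<sigma> inj by (simp add: A_def card_Diff_subset card_image I(1))
  have A: "finite A" by (simp add: A_def)
  moreover have "A \<noteq> {}" using cA I by force
  ultimately have A: "finite A" "A \<noteq> {}" by auto
  have res: "(norm (residual I e x))\<^sup>2 = (\<Sum>b\<in>A. (h x \<bullet> b)\<^sup>2)" for x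
  proof -
    have "h (residual I e x) = h x - (\<Sum>i\<in>I. (h x \<bullet> \<sigma> i) *\<^sub>R \<sigma> i)"
      using residual_isometry[of h I e x] h he
      by (simp add: residual_def orthogonal_transformation_def cong: sum.cong)
    also have "(\<Sum>i\<in>I. (h x \<bullet> \<sigma> i) *\<^sub>R \<sigma> i) = (\<Sum>b\<in>\<sigma> ` I. (h x \<bullet> b) *\<^sub>R b)"
      by (simp add: sum.reindex[OF inj])
    finally have *: "h (residual I e x) = h x - (\<Sum>b\<in>\<sigma> ` I. (h x \<bullet> b) *\<^sub>R b)" .
    have "h x = (\<Sum>b\<in>A. (h x \<bullet> b) *\<^sub>R b) + (\<Sum>b\<in>\<sigma> ` I. (h x \<bullet> b) *\<^sub>R b)"
      unfolding A_def using sum.subset_diff[OF \<sigma> finite_Basis, of "\<lambda>b. (h x \<bullet> b) *\<^sub>R b"]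
      by (simp add: euclidean_representation)
    with * have *: "h (residual I e x) = (\<Sum>b\<in>A. (h x \<bullet> b) *\<^sub>R b)"
      by (metis add_diff_cancel_right')
    have oA: "orthonormal_on A (\<lambda>b. b)"
      by (auto simp: orthonormal_on_def A_def inner_Basis)
    have "(norm (residual I e x))\<^sup>2 = h (residual I e x) \<bullet> h (residual I e x)"
      by (simp add: orthogonal_transformation_inner[OF h] power2_norm_eq_inner)
    also have "\<dots> = (\<Sum>b\<in>A. (h x \<bullet> b) * ((\<Sum>b\<in>A. (h x \<bullet> b) *\<^sub>R b) \<bullet> b))"
      unfolding * by (subst inner_sum_right) (simp add: inner_commute)
    also have "\<dots> = (\<Sum>b\<in>A. (h x \<bullet> b)\<^sup>2)"
      using inner_orthonormal_sum[OF oA A(1)] by (simp add: power2_eq_square)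
    finally show ?thesis .
  qed
  have "distr gauss borel (\<lambda>x. (norm (residual I e x))\<^sup>2 / 2)
      = distr (distr gauss gauss h) borel (\<lambda>x. (\<Sum>b\<in>A. (x \<bullet> b)\<^sup>2) / 2)"
    by (subst distr_distr) (auto simp: res o_def)
  also have "\<dots> = distr (gauss :: 'a measure) borel (\<lambda>x. (\<Sum>b\<in>A. (x \<bullet> b)\<^sup>2) / 2)"
    by (simp add: gauss_orthogonal_transformation[OF h])
  also have "\<dots> = distr (distr (gauss :: 'a measure) (Pi\<^sub>M A (\<lambda>_. std_normal)) (\<lambda>x. \<lambda>b\<in>A. x \<bullet> b))
      borel (\<lambda>f. (\<Sum>b\<in>A. (f b)\<^sup>2) / 2)"
    by (subst distr_distr) (auto simp: o_def intro!: distr_cong)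
  also have "\<dots> = gamma_law (card A / 2)"
    using gauss_orthonormal_coordinates[of A "\<lambda>b. b :: 'a"] A distr_std_normal_half_sum_squares[OF A]
    by (simp add: orthonormal_on_def A_def inner_Basis)
  finally show ?thesis by (simp add: cA)
qed

section \<open>Moments of Gaussian Gram determinants\<close>

lemma borel_measurable_det:
  assumes "\<And>i k. (\<lambda>x. A x $ i $ k) \<in> borel_measurable M"
  shows "(\<lambda>x. det (A x :: real^'i^'i)) \<in> borel_measurable M"
  unfolding det_def using assms by measurable

lemma borel_measurable_det_gram [measurable (raw)]:
  fixes w :: "'x \<Rightarrow> 'i::finite \<Rightarrow> 'a::euclidean_space"
  assumes [measurable]: "\<And>i. (\<lambda>x. w x i) \<in> borel_measurable M"
  shows "(\<lambda>x. det (gram (w x))) \<in> borel_measurable M"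
  by (rule borel_measurable_det) (simp add: gram_def)

text \<open>
  The moment of order \<open>p\<close> of a chi-square variable with \<open>n\<close> degrees of freedom.
\<close>
definition chi_moment :: "nat \<Rightarrow> real \<Rightarrow> real" where
  "chi_moment n p = 2 powr p * Gamma (real n / 2 + p) / Gamma (real n / 2)"

definition chi_moment_complex :: "nat \<Rightarrow> complex \<Rightarrow> complex" where
  "chi_moment_complex n p = 2 powr p * Gamma (of_nat n / 2 + p) / Gamma (of_nat n / 2)"

lemma borel_measurable_residual [measurable]:
  fixes e :: "'i \<Rightarrow> 'a::euclidean_space"
  shows "(\<lambda>x. residual I e x) \<in> borel_measurable borel"
  unfolding residual_def by measurable

lemma residual_moment:
  fixes e :: "'i \<Rightarrow> 'a::euclidean_space"
  assumes e: "orthonormal_on I e" and I: "finite I" "card I < DIM('a)" and p: "p > - 1 / 2"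
  shows "(\<integral>\<^sup>+x. ennreal ((norm (residual I e x))\<^sup>2 powr p) \<partial>gauss) = ennreal (chi_moment (DIM('a) - card I) p)"
proof -
  let ?a = "real (DIM('a) - card I) / 2"
  have a: "?a \<ge> 1 / 2" using I by simp
  have "(\<integral>\<^sup>+x. ennreal ((norm (residual I e x))\<^sup>2 powr p) \<partial>gauss)
      = (\<integral>\<^sup>+x. ennreal (2 powr p) * ennreal (\<bar>(norm (residual I e x))\<^sup>2 / 2\<bar> powr p) \<partial>gauss)"
    by (intro nn_integral_cong) (simp add: powr_divide flip: ennreal_mult)
  also have "\<dots> = ennreal (2 powr p) * (\<integral>\<^sup>+y. ennreal (\<bar>y\<bar> powr p) \<partial>gamma_law ?a)"
    unfolding distr_gauss_half_residual[OF e I, symmetric]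
    by (simp add: nn_integral_distr nn_integral_cmult)
  also have "\<dots> = ennreal (2 powr p) * ennreal (Gamma (?a + p) / Gamma ?a)"
    using a p by (subst nn_integral_gamma_law_powr) (linarith | rule refl)+
  also have "\<dots> = ennreal (chi_moment (DIM('a) - card I) p)"
    by (simp add: chi_moment_def flip: ennreal_mult')
  finally show ?thesis .
qed

lemma of_real_abs_powr_mult:
  "complex_of_real \<bar>x * y\<bar> powr p = of_real \<bar>x\<bar> powr p * of_real \<bar>y\<bar> powr p"
  unfolding of_real_abs_powr by (simp add: abs_mult ln_mult distrib_left exp_add)

lemma residual_moment_complex:
  fixes e :: "'i \<Rightarrow> 'a::euclidean_space"
  assumes e: "orthonormal_on I e" and I: "finite I" "card I < DIM('a)" and p: "Re p > - 1 / 2"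
  shows "(\<integral>x. of_real \<bar>(norm (residual I e x))\<^sup>2\<bar> powr p \<partial>gauss) = chi_moment_complex (DIM('a) - card I) p"
proof -
  let ?a = "real (DIM('a) - card I) / 2"
  have a: "?a \<ge> 1 / 2" using I by simp
  have "(\<integral>x. of_real \<bar>(norm (residual I e x))\<^sup>2\<bar> powr p \<partial>gauss)
      = (\<integral>x. 2 powr p * of_real \<bar>(norm (residual I e x))\<^sup>2 / 2\<bar> powr p \<partial>gauss)"
  proof (intro Bochner_Integration.integral_cong refl)
    fix x
    show "complex_of_real \<bar>(norm (residual I e x))\<^sup>2\<bar> powr p
      = 2 powr p * of_real \<bar>(norm (residual I e x))\<^sup>2 / 2\<bar> powr p"
      using of_real_abs_powr_mult[of 2 "(norm (residual I e x))\<^sup>2 / 2" p] by simp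
  qed
  also have "\<dots> = 2 powr p * (\<integral>y. of_real \<bar>y\<bar> powr p \<partial>gamma_law ?a)"
    unfolding distr_gauss_half_residual[OF e I, symmetric]
    by (subst integral_distr) auto
  also have "\<dots> = 2 powr p * (Gamma (of_real ?a + p) / Gamma (of_real ?a))"
    using a p by (subst integral_gamma_law_powr) (linarith | rule refl)+
  also have "\<dots> = chi_moment_complex (DIM('a) - card I) p"
    by (simp add: chi_moment_complex_def)
  finally show ?thesis .
qed

lemma chi_moment_pos: "n \<ge> 1 \<Longrightarrow> p > - 1 / 2 \<Longrightarrow> chi_moment n p > 0"
  by (auto simp: chi_moment_def intro!: divide_pos_pos mult_pos_pos Gamma_real_pos)

lemma chi_moment_0:
  assumes "n \<ge> 1"
  shows "chi_moment n 0 = 1"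
proof -
  have "Gamma (real n / 2) > 0" using assms by (intro Gamma_real_pos) simp
  then show ?thesis by (simp add: chi_moment_def)
qed

text \<open>
  The columns outside \<open>J\<close> are frozen to \<open>z\<close>; those in \<open>J\<close> vary.  Freezing columns replaces an induction on
  the number of columns, which is a type.
\<close>
definition glue :: "'i set \<Rightarrow> ('i \<Rightarrow> 'a) \<Rightarrow> ('i \<Rightarrow> 'a) \<Rightarrow> 'i \<Rightarrow> 'a" where
  "glue J z x = (\<lambda>i. if i \<in> J then x i else z i)"

lemma glue_empty [simp]: "glue {} z x = z"
  by (simp add: glue_def)

lemma glue_UNIV [simp]: "glue UNIV z x = x"
  by (simp add: glue_def)

lemma glue_insert: "j \<notin> J \<Longrightarrow> glue (insert j J) z (x(j := y)) = glue J (z(j := y)) x"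
  by (auto simp: glue_def)

lemma glue_update: "j \<notin> J \<Longrightarrow> (glue J z x)(j := y) = glue J (z(j := y)) x"
  by (auto simp: glue_def)

lemma measurable_glue [measurable]:
  "(\<lambda>x. glue J z x i) \<in> borel_measurable (Pi\<^sub>M J (\<lambda>_. gauss :: 'a::euclidean_space measure))"
proof (cases "i \<in> J")
  case True
  then have "(\<lambda>x. x i) \<in> measurable (Pi\<^sub>M J (\<lambda>_. gauss :: 'a measure)) gauss"
    by (rule measurable_component_singleton)
  then show ?thesis using True by (simp add: glue_def)
qed (simp add: glue_def)

lemma product_gauss: "product_sigma_finite (\<lambda>_::'i. gauss :: 'a::euclidean_space measure)"
  by (simp add: product_sigma_finite_def prob_space_imp_sigma_finite prob_space_gauss)

text \<open>
  Only frozen columns are used to reduce column \<open>j\<close>, so the varying ones keep their independent Gaussian laws.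
\<close>
lemma det_gram_glue:
  fixes z x :: "'i::finite \<Rightarrow> 'a::euclidean_space"
  assumes "j \<notin> J"
  defines "r \<equiv> residual (- insert j J) z"
  shows "det (gram (glue J (z(j := y)) x)) = (norm (r y))\<^sup>2 * det (gram (glue J (z(j := sgn (r y))) x))"
proof -
  let ?w = "glue J (z(j := y)) x"
  have w: "?w j = y" using assms by (simp add: glue_def)
  have "residual (- insert j J) ?w y = r y"
    unfolding r_def residual_def by (intro arg_cong2[where f="(-)"] refl sum.cong) (auto simp: glue_def)
  then have "det (gram ?w) = (norm (r y))\<^sup>2 * det (gram (?w(j := sgn (r y))))"
    using det_gram_residual[of j "- insert j J" ?w] w by simp
  then show ?thesis using assms by (simp add: glue_update)
qed

lemma card_Compl_insert:
  fixes j :: "'i::finite"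
  assumes "j \<notin> J" "CARD('i) \<le> n"
  shows "card (- insert j J) < n" "n - card (- insert j J) = n - CARD('i) + 1 + card J"
proof -
  have "card (insert j J) \<le> CARD('i)" by (intro card_mono) auto
  then show "card (- insert j J) < n" "n - card (- insert j J) = n - CARD('i) + 1 + card J"
    using assms by (auto simp: Compl_eq_Diff_UNIV card_Diff_subset)
qed

text \<open>
  Column \<open>j\<close> is integrated last.  For a fixed value \<open>y\<close> of it, the squared length of its residual splits off,
  and the normalized residual is one more frozen orthonormal column, so the remaining integral is a constant by
  the induction hypothesis.
\<close>
lemma gram_moment_glue:
  fixes z :: "'i::finite \<Rightarrow> 'a::euclidean_space"
  assumes N: "CARD('i) \<le> DIM('a)" and p: "p > - 1 / 2"
  shows "orthonormal_on (- J) z \<Longrightarrow>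
    (\<integral>\<^sup>+x. ennreal (\<bar>det (gram (glue J z x))\<bar> powr p) \<partial>Pi\<^sub>M J (\<lambda>_. gauss))
      = ennreal (\<Prod>l<card J. chi_moment (DIM('a) - CARD('i) + 1 + l) p)"
  using finite[of J]
proof (induction J arbitrary: z rule: finite_induct)
  case 1: (empty z)
  interpret product_sigma_finite "\<lambda>_::'i. gauss :: 'a measure" by (rule product_gauss)
  show ?case using 1 by (simp add: gram_orthonormal nn_integral_empty emeasure_PiM_empty space_PiM)
next
  case 2: (insert j J z)
  interpret product_sigma_finite "\<lambda>_::'i. gauss :: 'a measure" by (rule product_gauss)
  let ?I = "- insert j J"
  let ?r = "residual ?I z"
  let ?C = "\<Prod>l<card J. chi_moment (DIM('a) - CARD('i) + 1 + l) p"
  have "chi_moment (DIM('a) - CARD('i) + 1 + l) p > 0" for l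
    using p by (intro chi_moment_pos) auto
  then have C0: "?C \<ge> 0" by (intro prod_nonneg ballI less_imp_le)
  have "(\<integral>\<^sup>+x. ennreal (\<bar>det (gram (glue (insert j J) z x))\<bar> powr p) \<partial>Pi\<^sub>M (insert j J) (\<lambda>_. gauss))
    = (\<integral>\<^sup>+y. \<integral>\<^sup>+x. ennreal (\<bar>det (gram (glue J (z(j := y)) x))\<bar> powr p) \<partial>Pi\<^sub>M J (\<lambda>_. gauss) \<partial>gauss)"
    by (subst product_nn_integral_insert_rev) (simp_all add: 2 glue_insert)
  also have "\<dots> = (\<integral>\<^sup>+y. ennreal ((norm (?r y))\<^sup>2 powr p) * ennreal ?C \<partial>gauss)"
  proof (rule nn_integral_cong)
    fix y :: 'a
    show "(\<integral>\<^sup>+x. ennreal (\<bar>det (gram (glue J (z(j := y)) x))\<bar> powr p) \<partial>Pi\<^sub>M J (\<lambda>_. gauss))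
        = ennreal ((norm (?r y))\<^sup>2 powr p) * ennreal ?C"
    proof (cases "?r y = 0")
      case True
      then show ?thesis by (simp add: det_gram_glue[OF 2(2), of z y])
    next
      case False
      have "insert j ?I = - J" using 2(2) by auto
      then have "orthonormal_on (- J) (z(j := sgn (?r y)))"
        using orthonormal_on_insert_residual[OF 2(4) _ _ False, of j] by (simp del: fun_upd_apply)
      from 2(3)[OF this] show ?thesis
        by (simp add: det_gram_glue[OF 2(2), of z y] abs_mult powr_mult ennreal_mult' nn_integral_cmult
            del: fun_upd_apply)
    qed
  qed
  also have "\<dots> = ennreal (chi_moment (DIM('a) - CARD('i) + 1 + card J) p) * ennreal ?C"
    using residual_moment[OF 2(4) _ _ p] card_Compl_insert[OF 2(2) N]
    by (simp add: nn_integral_multc)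
  also have "\<dots> = ennreal (\<Prod>l<card (insert j J). chi_moment (DIM('a) - CARD('i) + 1 + l) p)"
    using 2(1,2) C0 by (simp add: mult.commute flip: ennreal_mult'')
  finally show ?case .
qed

lemma distr_PiM_gauss_insert:
  shows "distr (gauss \<Otimes>\<^sub>M Pi\<^sub>M J (\<lambda>_. gauss)) (Pi\<^sub>M (insert j J) (\<lambda>_. gauss :: 'a::euclidean_space measure))
     (\<lambda>(y, x). x(j := y)) = Pi\<^sub>M (insert j J) (\<lambda>_. gauss)"
  by (rule distr_pair_PiM_eq_PiM) (rule prob_space_gauss)+

lemma integrable_gram_powr:
  fixes z :: "'i::finite \<Rightarrow> 'a::euclidean_space"
  assumes N: "CARD('i) \<le> DIM('a)" and p: "Re p > - 1 / 2" and z: "orthonormal_on (- J) z"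
  shows "integrable (Pi\<^sub>M J (\<lambda>_. gauss)) (\<lambda>x. complex_of_real \<bar>det (gram (glue J z x))\<bar> powr p)"
proof (rule integrableI_bounded)
  show "(\<integral>\<^sup>+x. ennreal (norm (complex_of_real \<bar>det (gram (glue J z x))\<bar> powr p)) \<partial>Pi\<^sub>M J (\<lambda>_. gauss)) < \<infinity>"
    unfolding norm_of_real_abs_powr using gram_moment_glue[OF N p z] by simp
qed measurable

text \<open>
  The same recursion as for real exponents; \<open>integrable_gram_powr\<close> justifies the exchange of integrals.
\<close>
lemma gram_moment_complex_glue:
  fixes z :: "'i::finite \<Rightarrow> 'a::euclidean_space"
  assumes N: "CARD('i) \<le> DIM('a)" and p: "Re p > - 1 / 2"
  shows "orthonormal_on (- J) z \<Longrightarrow>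
    (\<integral>x. complex_of_real \<bar>det (gram (glue J z x))\<bar> powr p \<partial>Pi\<^sub>M J (\<lambda>_. gauss))
      = (\<Prod>l<card J. chi_moment_complex (DIM('a) - CARD('i) + 1 + l) p)"
  using finite[of J]
proof (induction J arbitrary: z rule: finite_induct)
  case 1: (empty z)
  interpret prob_space "Pi\<^sub>M {} (\<lambda>_::'i. gauss :: 'a measure)"
    by (intro prob_space_PiM prob_space_gauss)
  show ?case using 1 prob_space by (simp add: gram_orthonormal)
next
  case 2: (insert j J z)
  interpret P: prob_space "Pi\<^sub>M J (\<lambda>_::'i. gauss :: 'a measure)"
    by (intro prob_space_PiM prob_space_gauss)
  interpret G: prob_space "gauss :: 'a measure" by (rule prob_space_gauss)
  interpret pair_sigma_finite "gauss :: 'a measure" "Pi\<^sub>M J (\<lambda>_::'i. gauss :: 'a measure)" ..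
  let ?I = "- insert j J"
  let ?r = "residual ?I z"
  let ?C = "\<Prod>l<card J. chi_moment_complex (DIM('a) - CARD('i) + 1 + l) p"
  let ?F = "\<lambda>y x. complex_of_real \<bar>det (gram (glue J (z(j := y)) x))\<bar> powr p"
  have upd [measurable]: "(\<lambda>(y, x). x(j := y)) \<in> measurable (gauss \<Otimes>\<^sub>M Pi\<^sub>M J (\<lambda>_. gauss))
      (Pi\<^sub>M (insert j J) (\<lambda>_. gauss :: 'a measure))"
    by measurable
  have int: "integrable (gauss \<Otimes>\<^sub>M Pi\<^sub>M J (\<lambda>_. gauss)) (\<lambda>(y, x). ?F y x)"
    using integrable_distr[OF upd, unfolded distr_PiM_gauss_insert, OF integrable_gram_powr[OF N p 2(4)]]
    by (simp add: glue_insert[OF 2(2)] split_def)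
  have "(\<integral>x. complex_of_real \<bar>det (gram (glue (insert j J) z x))\<bar> powr p \<partial>Pi\<^sub>M (insert j J) (\<lambda>_. gauss))
    = (\<integral>yx. (case yx of (y, x) \<Rightarrow> ?F y x) \<partial>(gauss \<Otimes>\<^sub>M Pi\<^sub>M J (\<lambda>_. gauss)))"
    using integral_distr[OF upd, unfolded distr_PiM_gauss_insert,
        of "\<lambda>x. complex_of_real \<bar>det (gram (glue (insert j J) z x))\<bar> powr p"]
    by (simp add: glue_insert[OF 2(2)] split_def)
  also have "\<dots> = (\<integral>y. \<integral>x. ?F y x \<partial>Pi\<^sub>M J (\<lambda>_. gauss) \<partial>gauss)"
    using integral_fst'[OF int] by simp
  also have "\<dots> = (\<integral>y. complex_of_real \<bar>(norm (?r y))\<^sup>2\<bar> powr p * ?C \<partial>gauss)"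
  proof (rule Bochner_Integration.integral_cong[OF refl])
    fix y :: 'a
    show "(\<integral>x. ?F y x \<partial>Pi\<^sub>M J (\<lambda>_. gauss)) = complex_of_real \<bar>(norm (?r y))\<^sup>2\<bar> powr p * ?C"
    proof (cases "?r y = 0")
      case True
      then show ?thesis by (simp add: det_gram_glue[OF 2(2), of z y])
    next
      case False
      have "insert j ?I = - J" using 2(2) by auto
      then have "orthonormal_on (- J) (z(j := sgn (?r y)))"
        using orthonormal_on_insert_residual[OF 2(4) _ _ False, of j] by (simp del: fun_upd_apply)
      from 2(3)[OF this] show ?thesis
        by (simp add: det_gram_glue[OF 2(2), of z y] of_real_abs_powr_mult del: abs_power2 abs_norm_cancel fun_upd_apply)
    qed
  qed
  also have "\<dots> = chi_moment_complex (DIM('a) - CARD('i) + 1 + card J) p * ?C"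
    using residual_moment_complex[OF 2(4) _ _ p] card_Compl_insert[OF 2(2) N] by simp
  also have "\<dots> = (\<Prod>l<card (insert j J). chi_moment_complex (DIM('a) - CARD('i) + 1 + l) p)"
    using 2(1,2) by (simp add: mult.commute)
  finally show ?case .
qed

text \<open>
  The moment of order \<open>0\<close> is the probability of a nonzero determinant, because \<open>0 powr 0 = 0\<close>.
\<close>
lemma AE_gram_nonzero:
  fixes z :: "'i::finite \<Rightarrow> 'a::euclidean_space"
  assumes N: "CARD('i) \<le> DIM('a)" and z: "orthonormal_on (- J) z"
  shows "AE x in Pi\<^sub>M J (\<lambda>_. gauss). det (gram (glue J z x)) \<noteq> 0"
proof -
  interpret P: prob_space "Pi\<^sub>M J (\<lambda>_::'i. gauss :: 'a measure)"
    by (intro prob_space_PiM prob_space_gauss)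
  have "(\<integral>\<^sup>+x. ennreal (\<bar>det (gram (glue J z x))\<bar> powr 0) \<partial>Pi\<^sub>M J (\<lambda>_. gauss)) = 1"
    using gram_moment_glue[OF N _ z, of 0] by (simp add: chi_moment_0)
  also have "(\<integral>\<^sup>+x. ennreal (\<bar>det (gram (glue J z x))\<bar> powr 0) \<partial>Pi\<^sub>M J (\<lambda>_. gauss))
      = (\<integral>\<^sup>+x. indicator {x \<in> space (Pi\<^sub>M J (\<lambda>_. gauss)). det (gram (glue J z x)) \<noteq> 0} x \<partial>Pi\<^sub>M J (\<lambda>_. gauss))"
    by (intro nn_integral_cong) (auto simp: indicator_def)
  finally have "P.prob {x \<in> space (Pi\<^sub>M J (\<lambda>_. gauss)). det (gram (glue J z x)) \<noteq> 0} = 1"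
    by (simp add: P.emeasure_eq_measure)
  then show ?thesis
    by (subst (asm) P.prob_Collect_eq_1) simp_all
qed

section \<open>Gram-Schmidt orthonormalization\<close>

text \<open>
  An enumeration of the index type, which carries no order of its own, fixes the order in which vectors are processed.
\<close>
definition idx :: "'i::finite \<Rightarrow> nat" where
  "idx = to_nat_on UNIV"

lemma idx_eq_iff: "idx i = idx j \<longleftrightarrow> i = j"
  by (simp add: idx_def countable_finite)

lemma residual_cong [fundef_cong]:
  "I = J \<Longrightarrow> v = w \<Longrightarrow> (\<And>i. i \<in> J \<Longrightarrow> z i = y i) \<Longrightarrow> residual I z v = residual J y w"
  by (simp add: residual_def)

function gram_schmidt :: "('i::finite \<Rightarrow> 'a::euclidean_space) \<Rightarrow> 'i \<Rightarrow> 'a" where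
  "gram_schmidt x j = sgn (residual {i. idx i < idx j} (gram_schmidt x) (x j))"
  by pat_completeness auto
termination by (relation "Wellfounded.measure (\<lambda>(x, j). idx j)") auto

declare gram_schmidt.simps [simp del]

lemma idx_induct: "(\<And>j. (\<And>i. idx i < idx j \<Longrightarrow> P i) \<Longrightarrow> P j) \<Longrightarrow> P (j :: 'i::finite)"
  using measure_induct_rule[of idx P j] by blast

text \<open>
  The two spaces may differ.  Rotations and embeddings of a subspace are both instances.
\<close>
lemma gram_schmidt_isometry:
  fixes h :: "'a::euclidean_space \<Rightarrow> 'b::euclidean_space"
  assumes "linear h" "\<And>v w. h v \<bullet> h w = v \<bullet> w"
  shows "gram_schmidt (\<lambda>i. h (x i)) j = h (gram_schmidt x j)"
proof (induction j rule: idx_induct)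
  case (1 j)
  have n: "norm (h v) = norm v" for v by (simp add: norm_eq_sqrt_inner assms(2))
  have "gram_schmidt (\<lambda>i. h (x i)) j = sgn (residual {i. idx i < idx j} (\<lambda>i. h (gram_schmidt x i)) (h (x j)))"
    by (subst gram_schmidt.simps) (auto intro!: arg_cong[where f=sgn] residual_cong 1)
  also have "\<dots> = h (gram_schmidt x j)"
    by (subst gram_schmidt.simps) (simp add: residual_isometry[OF assms] sgn_div_norm n linear_scale[OF assms(1)])
  finally show ?case .
qed

lemma borel_measurable_gram_schmidt [measurable (raw)]:
  fixes x :: "'w \<Rightarrow> 'i::finite \<Rightarrow> 'a::euclidean_space"
  assumes [measurable]: "\<And>i. (\<lambda>w. x w i) \<in> borel_measurable M"
  shows "(\<lambda>w. gram_schmidt (x w) j) \<in> borel_measurable M"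
proof (induction j rule: idx_induct)
  case (1 j)
  then have [measurable]: "(\<lambda>w. \<Sum>i\<in>{i. idx i < idx j}. (x w j \<bullet> gram_schmidt (x w) i) *\<^sub>R gram_schmidt (x w) i) \<in> borel_measurable M"
    by (intro borel_measurable_sum) auto
  show ?case
    by (subst gram_schmidt.simps) (simp add: residual_def sgn_div_norm)
qed

lemma gram_schmidt_expansion:
  "x j = norm (residual {i. idx i < idx j} (gram_schmidt x) (x j)) *\<^sub>R gram_schmidt x j
     + (\<Sum>i\<in>{i. idx i < idx j}. (x j \<bullet> gram_schmidt x i) *\<^sub>R gram_schmidt x i)"
  using eq_residual_plus[of "x j" "{i. idx i < idx j}" "gram_schmidt x"] by (simp flip: gram_schmidt.simps)

text \<open>
  By \<open>det_gram_residual\<close>, the Gram determinant of the partly processed family before a step is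
  \<open>(norm r)\<^sup>2\<close> times the one after it.  So it stays nonzero, and no residual \<open>r\<close> vanishes.
\<close>
lemma orthonormal_on_gram_schmidt:
  fixes x :: "'i::finite \<Rightarrow> 'a::euclidean_space"
  assumes x: "det (gram x) \<noteq> 0"
  shows "orthonormal_on UNIV (gram_schmidt x)"
proof -
  \<comment> \<open>the family after the first \<open>n\<close> steps of the process\<close>
  define w where "w n i = (if idx i < n then gram_schmidt x i else x i)" for n i
  have step: "det (gram (w n)) \<noteq> 0 \<and> orthonormal_on {i. idx i < n} (gram_schmidt x)" for n
  proof (induction n)
    case 0
    then show ?case using x by (simp add: w_def orthonormal_on_def)
  next
    case (Suc n)
    show ?case
    proof (cases "\<exists>j::'i. idx j = n")
      case False
      then have "idx i < Suc n \<longleftrightarrow> idx i < n" for i :: 'i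
        by (metis less_Suc_eq)
      then show ?thesis using Suc by (simp add: w_def)
    next
      case True
      then obtain j :: 'i where j: "idx j = n" by blast
      let ?I = "{i::'i. idx i < n}"
      let ?r = "residual ?I (gram_schmidt x) (x j)"
      have less: "idx i < Suc n \<longleftrightarrow> i = j \<or> idx i < n" for i
        using j idx_eq_iff[of i j] by auto
      have gsj: "gram_schmidt x j = sgn ?r" by (subst gram_schmidt.simps) (simp add: j)
      have "residual ?I (w n) (w n j) = ?r"
        by (rule residual_cong) (auto simp: w_def j)
      moreover have "(w n)(j := sgn ?r) = w (Suc n)"
        by (auto simp: w_def less gsj)
      ultimately have det: "det (gram (w n)) = (norm ?r)\<^sup>2 * det (gram (w (Suc n)))"
        using det_gram_residual[of j ?I "w n"] j by simp
      then have "?r \<noteq> 0" using Suc by auto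
      then have "orthonormal_on (insert j ?I) ((gram_schmidt x)(j := sgn ?r))"
        using Suc j by (intro orthonormal_on_insert_residual) auto
      moreover have "(gram_schmidt x)(j := sgn ?r) = gram_schmidt x" by (auto simp: gsj)
      moreover have "insert j ?I = {i. idx i < Suc n}" by (auto simp: less)
      ultimately show ?thesis using det Suc by auto
    qed
  qed
  have "{i::'i. idx i < Suc (Max (range (idx :: 'i \<Rightarrow> nat)))} = UNIV"
    by (auto simp: less_Suc_eq_le)
  then show ?thesis using step by metis
qed

section \<open>The invariant measure on the Stiefel manifold\<close>

lemma borel_measurable_vecI:
  fixes f :: "'x \<Rightarrow> 'a::euclidean_space ^ 'n"
  assumes "\<And>i. (\<lambda>x. f x $ i) \<in> borel_measurable M"
  shows "f \<in> borel_measurable M"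
proof (subst borel_measurable_euclidean_space, intro ballI)
  fix b :: "'a^'n" assume "b \<in> Basis"
  then obtain i u where "b = axis i u" by (auto simp: Basis_vec_def)
  then show "(\<lambda>x. f x \<bullet> b) \<in> borel_measurable M"
    using assms[of i] by (simp add: inner_axis)
qed

lemma borel_measurable_vec_nth [measurable (raw)]:
  fixes f :: "'x \<Rightarrow> 'a::euclidean_space ^ 'n"
  assumes "f \<in> borel_measurable M"
  shows "(\<lambda>x. f x $ i) \<in> borel_measurable M"
  using assms by (rule borel_measurable_continuous_on[rotated]) (intro continuous_intros)

lemma borel_measurable_matrixI:
  fixes A :: "'x \<Rightarrow> real^'m^'n"
  assumes "\<And>i k. (\<lambda>x. A x $ i $ k) \<in> borel_measurable M"
  shows "A \<in> borel_measurable M"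
  by (intro borel_measurable_vecI assms)

lemma borel_measurable_matrix_mult [measurable (raw)]:
  fixes A :: "'x \<Rightarrow> real^'m^'n" and B :: "'x \<Rightarrow> real^'k^'m"
  assumes [measurable]: "A \<in> borel_measurable M" "B \<in> borel_measurable M"
  shows "(\<lambda>x. A x ** B x) \<in> borel_measurable M"
  by (rule borel_measurable_matrixI) (simp add: matrix_matrix_mult_def)

lemma borel_measurable_transpose [measurable (raw)]:
  fixes A :: "'x \<Rightarrow> real^'m^'n"
  assumes [measurable]: "A \<in> borel_measurable M"
  shows "(\<lambda>x. transpose (A x)) \<in> borel_measurable M"
  by (rule borel_measurable_matrixI) (simp add: transpose_def)

lemma borel_measurable_det_matrix [measurable (raw)]:
  fixes A :: "'x \<Rightarrow> real^'m^'m"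
  assumes [measurable]: "A \<in> borel_measurable M"
  shows "(\<lambda>x. det (A x)) \<in> borel_measurable M"
  by (rule borel_measurable_det) measurable

definition of_columns :: "('m \<Rightarrow> real^'n) \<Rightarrow> real^'m^'n" where
  "of_columns x = (\<chi> i j. x j $ i)"

lemma column_of_columns [simp]: "column j (of_columns x) = x j"
  by (simp add: of_columns_def column_def vec_eq_iff)

lemma of_columns_column [simp]: "of_columns (\<lambda>j. column j v) = v"
  by (simp add: of_columns_def column_def vec_eq_iff)

lemma transpose_of_columns_mult: "transpose (of_columns x) ** of_columns x = gram x"
  by (simp add: vec_eq_iff transpose_def matrix_matrix_mult_def of_columns_def gram_def inner_vec_def)

lemma gram_column: "gram (\<lambda>j. column j v) = transpose v ** v"
  using transpose_of_columns_mult[of "\<lambda>j. column j v"] by simp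

lemma matrix_mult_of_columns: "g ** of_columns x = of_columns (\<lambda>j. g *v x j)"
  by (simp add: vec_eq_iff matrix_matrix_mult_def matrix_vector_mult_def of_columns_def)

lemma of_columns_stiefel: "of_columns x \<in> stiefel \<longleftrightarrow> orthonormal_on UNIV x"
  by (auto simp: stiefel_def transpose_of_columns_mult gram_def orthonormal_on_def mat_def vec_eq_iff)

lemma stiefel_column: "v \<in> stiefel \<longleftrightarrow> orthonormal_on UNIV (\<lambda>j. column j v)"
  using of_columns_stiefel[of "\<lambda>j. column j v"] by simp

lemma orthogonal_matrix_inner:
  "orthogonal_matrix (g :: real^'n^'n) \<Longrightarrow> (g *v x) \<bullet> (g *v y) = x \<bullet> y"
  using orthogonal_transformation_matrix[of "(*v) g"]
  by (simp add: orthogonal_transformation_inner matrix_of_matrix_vector_mul)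

lemma orthogonal_matrix_stiefel: "orthogonal_matrix (g :: real^'n^'n) \<longleftrightarrow> g \<in> stiefel"
  by (simp add: stiefel_def orthogonal_matrix)

lemma stiefel_mult_stiefel: "g \<in> stiefel \<Longrightarrow> v \<in> stiefel \<Longrightarrow> g ** v \<in> stiefel"
  by (simp add: stiefel_def matrix_transpose_mul)
     (metis matrix_mul_assoc matrix_mul_lid)

lemma stiefel_mult: "orthogonal_matrix g \<Longrightarrow> v \<in> stiefel \<Longrightarrow> g ** v \<in> stiefel"
  by (simp add: orthogonal_matrix_stiefel stiefel_mult_stiefel)

lemma stiefel_transitive:
  fixes v w :: "real^'m^'n"
  assumes "v \<in> stiefel" "w \<in> stiefel"
  shows "\<exists>g. orthogonal_matrix g \<and> g ** v = w"
proof -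
  obtain h where h: "orthogonal_transformation h" "\<forall>j\<in>UNIV. h (column j v) = column j w"
    using orthogonal_transformation_orthonormal_on[of UNIV "\<lambda>j. column j v" "\<lambda>j. column j w"] assms
    by (auto simp: stiefel_column)
  have hm: "h x = matrix h *v x" for x
    using h(1) by (simp add: matrix_works orthogonal_transformation_def linear_linear)
  have "matrix h ** v = of_columns (\<lambda>j. matrix h *v column j v)"
    by (metis matrix_mult_of_columns of_columns_column)
  also have "\<dots> = w" using h(2) by (simp flip: hm)
  finally show ?thesis
    using h(1) by (auto simp: orthogonal_transformation_matrix)
qed

lemma stiefel_nonempty:
  assumes "CARD('m) \<le> CARD('n)"
  shows "(stiefel :: (real^'m^'n) set) \<noteq> {}"
proof -
  obtain \<sigma> :: "'m \<Rightarrow> 'n" where \<sigma>: "inj \<sigma>"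
    using card_le_inj[of "UNIV :: 'm set" "UNIV :: 'n set"] assms by auto
  have "orthonormal_on UNIV (\<lambda>j. axis (\<sigma> j) (1::real))"
    using \<sigma> by (auto simp: orthonormal_on_def inner_axis_axis inj_eq)
  then show ?thesis using of_columns_stiefel by blast
qed

abbreviation stiefel_space :: "(real^'m^'n) measure" where
  "stiefel_space \<equiv> restrict_space borel stiefel"

lemma measurable_stiefel_spaceI:
  "f \<in> borel_measurable M \<Longrightarrow> (\<And>x. x \<in> space M \<Longrightarrow> f x \<in> stiefel) \<Longrightarrow> f \<in> measurable M stiefel_space"
  by (rule measurable_restrict_space2) auto

lemma distr_PiM_gauss_map:
  fixes L :: "'b::euclidean_space \<Rightarrow> 'a::euclidean_space"
  assumes L: "distr gauss gauss L = gauss" and [measurable]: "L \<in> borel_measurable borel"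
  shows "distr (Pi\<^sub>M (UNIV :: 'i::finite set) (\<lambda>_. gauss)) (Pi\<^sub>M UNIV (\<lambda>_. gauss)) (\<lambda>x i. L (x i))
       = Pi\<^sub>M UNIV (\<lambda>_. gauss)"
proof -
  have "compose UNIV L = (\<lambda>(x :: 'i \<Rightarrow> 'b) i. L (x i))" by (intro ext) (simp add: compose_def)
  then show ?thesis
    using distr_PiM_finite_prob_space'[of "UNIV :: 'i set" "\<lambda>_. gauss" "\<lambda>_. gauss" L] L
    by (simp add: prob_space_gauss)
qed

lemma borel_measurable_linear:
  fixes L :: "'b::euclidean_space \<Rightarrow> 'a::euclidean_space"
  shows "linear L \<Longrightarrow> L \<in> borel_measurable borel"
  by (intro borel_measurable_continuous_onI linear_continuous_on) (simp add: linear_linear)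

text \<open>
  For dependent families the value is an arbitrary frame, so that the result always lies on the Stiefel manifold.
\<close>
definition orthonormalize :: "('m \<Rightarrow> real^'n) \<Rightarrow> real^'m^'n" where
  "orthonormalize x = (if det (gram x) \<noteq> 0 then of_columns (gram_schmidt x) else (SOME v. v \<in> stiefel))"

lemma orthonormalize_stiefel:
  "CARD('m::finite) \<le> CARD('n) \<Longrightarrow> orthonormalize (x :: 'm::finite \<Rightarrow> real^'n) \<in> stiefel"
  using stiefel_nonempty some_in_eq by (auto simp: orthonormalize_def of_columns_stiefel orthonormal_on_gram_schmidt)

lemma borel_measurable_orthonormalize [measurable (raw)]:
  fixes x :: "'w \<Rightarrow> 'm::finite \<Rightarrow> real^'n"
  assumes [measurable]: "\<And>i. (\<lambda>w. x w i) \<in> borel_measurable M"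
  shows "(\<lambda>w. orthonormalize (x w)) \<in> borel_measurable M"
proof -
  have [measurable]: "(\<lambda>w. of_columns (gram_schmidt (x w))) \<in> borel_measurable M"
    by (rule borel_measurable_matrixI) (simp add: of_columns_def)
  show ?thesis unfolding orthonormalize_def by measurable
qed

lemma orthonormalize_isometry:
  fixes x :: "'m::finite \<Rightarrow> real^'n" and h :: "real^'n \<Rightarrow> real^'k"
  assumes "linear h" "\<And>v w. h v \<bullet> h w = v \<bullet> w" "det (gram x) \<noteq> 0"
  shows "orthonormalize (\<lambda>j. h (x j)) = of_columns (\<lambda>j. h (column j (orthonormalize x)))"
proof -
  have "gram_schmidt (\<lambda>j. h (x j)) = (\<lambda>j. h (gram_schmidt x j))" by (intro ext gram_schmidt_isometry assms)
  then show ?thesis using assms by (simp add: orthonormalize_def gram_isometry)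
qed

definition stiefel_law :: "(real^'m^'n) measure" where
  "stiefel_law = distr (Pi\<^sub>M UNIV (\<lambda>_. gauss)) stiefel_space orthonormalize"

lemma measurable_orthonormalize [measurable]:
  assumes "CARD('m) \<le> CARD('n)"
  shows "orthonormalize \<in> measurable (Pi\<^sub>M UNIV (\<lambda>_. gauss)) (stiefel_space :: (real^'m^'n) measure)"
proof (rule measurable_stiefel_spaceI)
  have [measurable]: "(\<lambda>x. x i) \<in> borel_measurable (Pi\<^sub>M UNIV (\<lambda>_::'m. gauss :: (real^'n) measure))" for i
    using measurable_glue[of UNIV undefined i] by simp
  show "orthonormalize \<in> borel_measurable (Pi\<^sub>M UNIV (\<lambda>_::'m. gauss :: (real^'n) measure))"
    by measurable
qed (rule orthonormalize_stiefel[OF assms])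

lemma AE_gauss_gram_nonzero:
  assumes "CARD('m) \<le> CARD('n)"
  shows "AE x in Pi\<^sub>M (UNIV :: 'm::finite set) (\<lambda>_. gauss :: (real^'n) measure). det (gram x) \<noteq> 0"
  using AE_gram_nonzero[where J="UNIV :: 'm set" and z="\<lambda>_. 0 :: real^'n"] assms by (simp add: orthonormal_on_def)

definition is_stiefel_measure :: "(real^'m^'n) measure \<Rightarrow> bool" where
  "is_stiefel_measure M \<longleftrightarrow> prob_space M \<and> space M = stiefel \<and> sets M = sets stiefel_space \<and>
     (\<forall>g :: real^'n^'n. orthogonal_matrix g \<longrightarrow> distr M M (\<lambda>v. g ** v) = M)"

lemma measurable_stiefel_space_mult:
  fixes b :: "real^'d^'n"
  assumes "b \<in> stiefel"
  shows "(\<lambda>v :: real^'m^'d. b ** v) \<in> measurable stiefel_space stiefel_space"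
proof (rule measurable_stiefel_spaceI)
  have "(\<lambda>v :: real^'m^'d. b ** v) \<in> borel_measurable borel" by measurable
  then show "(\<lambda>v :: real^'m^'d. b ** v) \<in> borel_measurable stiefel_space"
    by (rule measurable_restrict_space1)
qed (use stiefel_mult_stiefel[OF assms] in \<open>simp add: space_restrict_space\<close>)

lemma measurable_mult_left:
  "orthogonal_matrix (g :: real^'n^'n) \<Longrightarrow>
    (\<lambda>v :: real^'m^'n. g ** v) \<in> measurable stiefel_space stiefel_space"
  by (simp add: orthogonal_matrix_stiefel measurable_stiefel_space_mult)

lemma is_stiefel_measure_law:
  assumes "CARD('m) \<le> CARD('n)"
  shows "is_stiefel_measure (stiefel_law :: (real^'m^'n) measure)"
  unfolding is_stiefel_measure_def
proof (intro conjI allI impI)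
  let ?P = "Pi\<^sub>M UNIV (\<lambda>_::'m. gauss :: (real^'n) measure)"
  let ?V = "stiefel_space :: (real^'m^'n) measure"
  note [measurable] = measurable_orthonormalize[OF assms]
  show "prob_space (stiefel_law :: (real^'m^'n) measure)"
    unfolding stiefel_law_def
    by (intro prob_space.prob_space_distr prob_space_PiM prob_space_gauss) measurable
  show "space (stiefel_law :: (real^'m^'n) measure) = stiefel"
    and s: "sets (stiefel_law :: (real^'m^'n) measure) = sets ?V"
    by (simp_all add: stiefel_law_def space_restrict_space)
  fix g :: "real^'n^'n" assume g: "orthogonal_matrix g"
  note [measurable] = measurable_mult_left[OF g]
  let ?h = "\<lambda>x::real^'n. g *v x"
  have h: "linear ?h" "\<And>v w. ?h v \<bullet> ?h w = v \<bullet> w"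
    using g by (simp_all add: orthogonal_matrix_inner)
  have [measurable]: "?h \<in> borel_measurable borel" by (rule borel_measurable_linear) (rule h(1))
  have "(\<lambda>x. \<lambda>i\<in>UNIV. ?h (x i)) \<in> measurable ?P ?P" by measurable
  then have maph [measurable]: "(\<lambda>x i. ?h (x i)) \<in> measurable ?P ?P" by (simp only: restrict_UNIV)
  have inv: "distr ?P ?P (\<lambda>x i. ?h (x i)) = ?P"
    using h by (intro distr_PiM_gauss_map gauss_orthogonal_transformation)
      (simp_all add: orthogonal_transformation_def)
  have "distr stiefel_law stiefel_law (\<lambda>v :: real^'m^'n. g ** v) = distr (distr ?P ?V orthonormalize) ?V (\<lambda>v. g ** v)"
    by (intro distr_cong s) (simp_all add: stiefel_law_def)
  also have "\<dots> = distr ?P ?V (\<lambda>x. g ** orthonormalize x)"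
    by (subst distr_distr) (simp_all add: o_def)
  also have "\<dots> = distr ?P ?V (\<lambda>x. orthonormalize (\<lambda>i. ?h (x i)))"
  proof (rule distr_cong_AE)
    show "AE x in ?P. g ** orthonormalize x = orthonormalize (\<lambda>i. ?h (x i))"
      using AE_gauss_gram_nonzero[OF assms]
    proof eventually_elim
      case (elim x)
      show ?case unfolding orthonormalize_isometry[OF h elim] by (metis matrix_mult_of_columns of_columns_column)
    qed
    show "(\<lambda>x. g ** orthonormalize x) \<in> measurable ?P ?V" by measurable
    show "(\<lambda>x. orthonormalize (\<lambda>i. ?h (x i))) \<in> measurable ?P ?V"
      by (rule measurable_compose[OF maph]) (rule measurable_orthonormalize[OF assms])
  qed simp_all
  also have "\<dots> = distr (distr ?P ?P (\<lambda>x i. ?h (x i))) ?V orthonormalize"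
    by (subst distr_distr) (simp_all add: o_def)
  also have "\<dots> = stiefel_law" by (simp only: inv stiefel_law_def)
  finally show "distr stiefel_law stiefel_law (\<lambda>v :: real^'m^'n. g ** v) = stiefel_law" .
qed

lemma is_stiefel_measure_nn_integral:
  fixes M :: "(real^'m^'n) measure"
  assumes M: "is_stiefel_measure M" and g: "orthogonal_matrix g"
    and f: "f \<in> borel_measurable stiefel_space"
  shows "(\<integral>\<^sup>+v. f (g ** v) \<partial>M) = (\<integral>\<^sup>+v. f v \<partial>M)"
proof -
  have s: "sets M = sets stiefel_space" and d: "distr M M (\<lambda>v. g ** v) = M"
    using M g by (auto simp: is_stiefel_measure_def)
  have "(\<integral>\<^sup>+v. f v \<partial>M) = (\<integral>\<^sup>+v. f v \<partial>distr M M (\<lambda>v. g ** v))" by (simp only: d)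
  also have "\<dots> = (\<integral>\<^sup>+v. f (g ** v) \<partial>M)"
    using f measurable_mult_left[OF g, where 'm='m] by (intro nn_integral_distr) (simp_all cong: measurable_cong_sets add: s)
  finally show ?thesis ..
qed

lemma orbit_measurable:
  fixes v :: "real^'m^'n"
  assumes "v \<in> stiefel"
  shows "(\<lambda>g. g ** v) \<in> measurable (stiefel_space :: (real^'n^'n) measure) stiefel_space"
proof (rule measurable_stiefel_spaceI)
  have "(\<lambda>g :: real^'n^'n. g ** v) \<in> borel_measurable borel" by measurable
  then show "(\<lambda>g :: real^'n^'n. g ** v) \<in> borel_measurable stiefel_space"
    by (rule measurable_restrict_space1)
qed (use assms in \<open>simp add: space_restrict_space stiefel_mult_stiefel\<close>)

text \<open>
  The integral of \<open>indicator A (g' v)\<close> over \<open>v\<close> does not depend on \<open>g\<close>, and its integral over \<open>g\<close> does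
  not depend on \<open>v\<close>, because the manifold is one orbit.  Transposing \<open>g\<close> makes the left invariance of \<open>H\<close>
  applicable.
\<close>
lemma is_stiefel_measure_unique:
  fixes M :: "(real^'m^'n) measure" and H :: "(real^'n^'n) measure"
  assumes M: "is_stiefel_measure M" and H: "is_stiefel_measure H"
    and v0: "v0 \<in> stiefel" and A: "A \<in> sets stiefel_space"
  shows "emeasure M A = (\<integral>\<^sup>+g. indicator A (transpose g ** v0) \<partial>H)"
proof -
  interpret M: prob_space M using M by (simp add: is_stiefel_measure_def)
  interpret H: prob_space H using H by (simp add: is_stiefel_measure_def)
  interpret HM: pair_sigma_finite H M ..
  have sM [measurable_cong]: "sets M = sets stiefel_space" "space M = stiefel"
    and sH [measurable_cong]: "sets H = sets stiefel_space" "space H = stiefel"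
    using M H by (auto simp: is_stiefel_measure_def)
  have fst [measurable]: "fst \<in> borel_measurable (H \<Otimes>\<^sub>M M)"
    by (rule measurable_compose[OF measurable_fst]) (simp add: measurable_restrict_space1 sH cong: measurable_cong_sets)
  have snd [measurable]: "snd \<in> borel_measurable (H \<Otimes>\<^sub>M M)"
    by (rule measurable_compose[OF measurable_snd]) (simp add: measurable_restrict_space1 sM cong: measurable_cong_sets)
  have act: "(\<lambda>z. transpose (fst z) ** snd z) \<in> measurable (H \<Otimes>\<^sub>M M) stiefel_space"
  proof (rule measurable_stiefel_spaceI)
    show "(\<lambda>z. transpose (fst z) ** snd z) \<in> borel_measurable (H \<Otimes>\<^sub>M M)" by measurable
    fix z assume "z \<in> space (H \<Otimes>\<^sub>M M)"
    then have "orthogonal_matrix (fst z)" "snd z \<in> stiefel"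
      by (auto simp: space_pair_measure sM sH orthogonal_matrix_stiefel)
    then show "transpose (fst z) ** snd z \<in> stiefel"
      by (intro stiefel_mult) simp_all
  qed
  have ind: "(indicator A :: _ \<Rightarrow> ennreal) \<in> borel_measurable stiefel_space" using A by measurable
  have "emeasure M A = (\<integral>\<^sup>+g. \<integral>\<^sup>+v. indicator A v \<partial>M \<partial>H)"
    using A by (simp add: sM H.emeasure_space_1)
  also have "\<dots> = (\<integral>\<^sup>+g. \<integral>\<^sup>+v. indicator A (transpose g ** v) \<partial>M \<partial>H)"
  proof (rule nn_integral_cong)
    fix g assume "g \<in> space H"
    then have "orthogonal_matrix (transpose g)" by (simp add: sH orthogonal_matrix_stiefel[symmetric])
    from is_stiefel_measure_nn_integral[OF M this ind]
    show "(\<integral>\<^sup>+v. indicator A v \<partial>M) = (\<integral>\<^sup>+v. indicator A (transpose g ** v) \<partial>M)" ..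
  qed
  also have "\<dots> = (\<integral>\<^sup>+v. \<integral>\<^sup>+g. indicator A (transpose g ** v) \<partial>H \<partial>M)"
    using measurable_compose[OF act ind] by (intro HM.Fubini'[symmetric]) (simp add: split_def)
  also have "\<dots> = (\<integral>\<^sup>+v. \<integral>\<^sup>+g. indicator A (transpose g ** v0) \<partial>H \<partial>M)"
  proof (rule nn_integral_cong)
    fix v assume "v \<in> space M"
    then obtain h where h: "orthogonal_matrix h" "h ** v0 = v"
      using stiefel_transitive v0 sM by blast
    have eq: "transpose g ** v = transpose (transpose h ** g) ** v0" for g
      by (simp add: matrix_transpose_mul h(2)[symmetric] matrix_mul_assoc)
    have m: "(\<lambda>g. indicator A (transpose g ** v0) :: ennreal) \<in> borel_measurable stiefel_space"
    proof -
      have "(\<lambda>g. (g, v0)) \<in> measurable H (H \<Otimes>\<^sub>M M)" using v0 sM by simp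
      from measurable_compose[OF this measurable_compose[OF act ind]] show ?thesis
        by (simp cong: measurable_cong_sets add: sH)
    qed
    show "(\<integral>\<^sup>+g. indicator A (transpose g ** v) \<partial>H) = (\<integral>\<^sup>+g. indicator A (transpose g ** v0) \<partial>H)"
      unfolding eq
      by (rule is_stiefel_measure_nn_integral[OF H _ m, of "transpose h"]) (simp add: h(1))
  qed
  also have "\<dots> = (\<integral>\<^sup>+g. indicator A (transpose g ** v0) \<partial>H)"
    by (simp add: M.emeasure_space_1)
  finally show ?thesis .
qed

lemma is_stiefel_measure_eq:
  fixes M M' :: "(real^'m^'n) measure"
  assumes "is_stiefel_measure M" "is_stiefel_measure M'"
  shows "M = M'"
proof -
  interpret M: prob_space M using assms by (simp add: is_stiefel_measure_def)
  obtain v0 :: "real^'m^'n" where v0: "v0 \<in> stiefel"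
    using M.not_empty assms by (auto simp: is_stiefel_measure_def)
  have H: "is_stiefel_measure (stiefel_law :: (real^'n^'n) measure)"
    by (rule is_stiefel_measure_law) simp
  show ?thesis
    using is_stiefel_measure_unique[OF assms(1) H v0] is_stiefel_measure_unique[OF assms(2) H v0] assms
    by (intro measure_eqI) (simp_all add: is_stiefel_measure_def)
qed

lemma is_stiefel_measure_stiefel_measure:
  assumes "CARD('m) \<le> CARD('n)"
  shows "is_stiefel_measure (stiefel_measure :: (real^'m^'n) measure)"
  using theI[of is_stiefel_measure, OF is_stiefel_measure_law[OF assms] is_stiefel_measure_eq[OF _ is_stiefel_measure_law[OF assms]]]
  unfolding stiefel_measure_def is_stiefel_measure_def .

lemma stiefel_measure_eq:
  assumes "is_stiefel_measure (M :: (real^'m^'n) measure)" "CARD('m) \<le> CARD('n)"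
  shows "stiefel_measure = M"
  using is_stiefel_measure_eq[OF is_stiefel_measure_stiefel_measure] assms by blast

lemma stiefel_card:
  "v \<in> stiefel \<Longrightarrow> CARD('m) \<le> CARD('n)" for v :: "real^'m^'n"
  using card_orthonormal_on_le_DIM[of UNIV "\<lambda>j. column j v"] by (simp add: stiefel_column)

lemma
  assumes "CARD('m) \<le> CARD('n)"
  shows prob_space_stiefel_measure: "prob_space (stiefel_measure :: (real^'m^'n) measure)"
    and space_stiefel_measure: "space (stiefel_measure :: (real^'m^'n) measure) = stiefel"
    and sets_stiefel_measure: "sets (stiefel_measure :: (real^'m^'n) measure) = sets stiefel_space"
  using is_stiefel_measure_stiefel_measure[OF assms] by (simp_all add: is_stiefel_measure_def)

lemma distr_stiefel_measure_mult:
  assumes "CARD('m) \<le> CARD('n)" "orthogonal_matrix (g :: real^'n^'n)"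
  shows "distr stiefel_measure stiefel_space (\<lambda>v :: real^'m^'n. g ** v) = stiefel_measure"
proof -
  have "distr stiefel_measure stiefel_space (\<lambda>v :: real^'m^'n. g ** v)
      = distr stiefel_measure stiefel_measure (\<lambda>v :: real^'m^'n. g ** v)"
    by (intro distr_cong) (simp_all add: sets_stiefel_measure[OF assms(1)])
  then show ?thesis
    using is_stiefel_measure_stiefel_measure[OF assms(1)] assms(2) by (simp add: is_stiefel_measure_def)
qed

text \<open>
  The image is again an invariant probability measure, so uniqueness applies.  For square \<open>v\<close> this is the right invariance of
  the measure on the orthogonal group.
\<close>
lemma distr_orbit:
  fixes v :: "real^'m^'n"
  assumes v: "v \<in> stiefel"
  shows "distr (stiefel_measure :: (real^'n^'n) measure) stiefel_space (\<lambda>g. g ** v) = stiefel_measure"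
proof -
  let ?H = "stiefel_measure :: (real^'n^'n) measure"
  let ?V = "stiefel_space :: (real^'m^'n) measure"
  have H: "is_stiefel_measure ?H" by (rule is_stiefel_measure_stiefel_measure) simp
  have sH: "sets ?H = sets stiefel_space" and pH: "prob_space ?H"
    using H by (simp_all add: is_stiefel_measure_def)
  have orb: "(\<lambda>g. g ** v) \<in> measurable ?H ?V"
    using orbit_measurable[OF v] by (simp cong: measurable_cong_sets add: sH)
  have "is_stiefel_measure (distr ?H ?V (\<lambda>g. g ** v))"
    unfolding is_stiefel_measure_def
  proof (intro conjI allI impI)
    show "prob_space (distr ?H ?V (\<lambda>g. g ** v))" using pH orb by (rule prob_space.prob_space_distr)
    fix h :: "real^'n^'n" assume h: "orthogonal_matrix h"
    have hm: "(\<lambda>w :: real^'m^'n. h ** w) \<in> measurable ?V ?V" by (rule measurable_mult_left[OF h])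
    have hH: "(\<lambda>w. h ** w) \<in> measurable ?H stiefel_space"
      using measurable_mult_left[OF h] by (simp cong: measurable_cong_sets add: sH)
    have "distr (distr ?H ?V (\<lambda>g. g ** v)) (distr ?H ?V (\<lambda>g. g ** v)) (\<lambda>w. h ** w)
        = distr (distr ?H ?V (\<lambda>g. g ** v)) ?V (\<lambda>w. h ** w)"
      by (intro distr_cong) simp_all
    also have "\<dots> = distr ?H ?V (\<lambda>g. h ** (g ** v))"
      using hm orb by (simp add: distr_distr o_def)
    also have "\<dots> = distr (distr ?H stiefel_space (\<lambda>g. h ** g)) ?V (\<lambda>g. g ** v)"
      using hH orbit_measurable[OF v] by (simp add: distr_distr o_def matrix_mul_assoc)
    also have "\<dots> = distr ?H ?V (\<lambda>g. g ** v)"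
      by (simp add: distr_stiefel_measure_mult[OF _ h])
    finally show "distr (distr ?H ?V (\<lambda>g. g ** v)) (distr ?H ?V (\<lambda>g. g ** v)) (\<lambda>w. h ** w)
      = distr ?H ?V (\<lambda>g. g ** v)" .
  qed (simp_all add: space_restrict_space)
  from stiefel_measure_eq[OF this stiefel_card[OF v]] show ?thesis ..
qed

section \<open>The mean of a power of the cosine kernel\<close>

text \<open>
  The product of the squared cosines of the principal angles, when \<open>v\<close> and \<open>w\<close> are orthonormal frames.
\<close>
definition cos_kernel :: "real^'m^'n \<Rightarrow> real^'m^'n \<Rightarrow> real" where
  "cos_kernel v w = det (transpose v ** w ** transpose w ** v)"

lemma cos_kernel_eq: "cos_kernel v w = (det (transpose v ** w))\<^sup>2"
proof -
  have "transpose v ** w ** transpose w ** v = (transpose v ** w) ** transpose (transpose v ** w)"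
    by (simp add: matrix_transpose_mul matrix_mul_assoc)
  then show ?thesis by (simp add: cos_kernel_def det_mul power2_eq_square)
qed

lemma cos_kernel_commute: "cos_kernel v w = cos_kernel w v"
proof -
  have "det (transpose w ** v) = det (transpose (transpose w ** v))" by simp
  also have "\<dots> = det (transpose v ** w)" by (simp add: matrix_transpose_mul del: det_transpose)
  finally show ?thesis by (simp add: cos_kernel_eq)
qed

lemma borel_measurable_cos_kernel [measurable (raw)]:
  "v \<in> borel_measurable M \<Longrightarrow> w \<in> borel_measurable M \<Longrightarrow> (\<lambda>x. cos_kernel (v x) (w x)) \<in> borel_measurable M"
  unfolding cos_kernel_eq by measurable

lemma cos_kernel_mult: "cos_kernel (a ** b) w = cos_kernel b (transpose a ** w)"
  by (simp add: cos_kernel_eq matrix_transpose_mul matrix_mul_assoc)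

lemma inner_transpose_mult: "(transpose a *v x) \<bullet> y = x \<bullet> (a *v y)" for a :: "real^'m^'n"
  unfolding transpose_matrix_vector by (rule dot_lmul_matrix)

lemma inner_mult_mult: "(a *v x) \<bullet> (b *v y) = x \<bullet> ((transpose a ** b) *v y)" for a b :: "real^'m^'n"
  using inner_transpose_mult[of a "b *v y" x] by (simp only: matrix_vector_mul_assoc inner_commute)

lemma gram_schmidt_factor:
  fixes x :: "'m::finite \<Rightarrow> real^'n"
  shows "\<exists>t. of_columns x = of_columns (gram_schmidt x) ** t"
proof -
  define t :: "real^'m^'m" where "t = (\<chi> i j. if i = j then norm (residual {i. idx i < idx j} (gram_schmidt x) (x j))
    else if idx i < idx j then x j \<bullet> gram_schmidt x i else 0)"
  have exp: "x j = (\<Sum>i\<in>UNIV. t $ i $ j *\<^sub>R gram_schmidt x i)" for j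
  proof -
    have "(\<Sum>i\<in>UNIV. t $ i $ j *\<^sub>R gram_schmidt x i) = t $ j $ j *\<^sub>R gram_schmidt x j + (\<Sum>i\<in>UNIV - {j}. t $ i $ j *\<^sub>R gram_schmidt x i)"
      by (rule sum.remove) simp_all
    also have "(\<Sum>i\<in>UNIV - {j}. t $ i $ j *\<^sub>R gram_schmidt x i) = (\<Sum>i\<in>{i. idx i < idx j}. (x j \<bullet> gram_schmidt x i) *\<^sub>R gram_schmidt x i)"
      by (intro sum.mono_neutral_cong_right) (auto simp: t_def)
    also have "t $ j $ j *\<^sub>R gram_schmidt x j + \<dots> = x j"
      using gram_schmidt_expansion[of x j] by (simp add: t_def)
    finally show ?thesis ..
  qed
  have "x j $ i = (\<Sum>k\<in>UNIV. gram_schmidt x k $ i * t $ k $ j)" for i j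
  proof -
    have "x j $ i = (\<Sum>k\<in>UNIV. t $ k $ j *\<^sub>R gram_schmidt x k) $ i" using exp[of j] by (rule arg_cong)
    then show ?thesis by (simp add: mult.commute)
  qed
  then have "of_columns x = of_columns (gram_schmidt x) ** t"
    by (simp add: vec_eq_iff of_columns_def matrix_matrix_mult_def)
  then show ?thesis ..
qed

lemma det_eq_0_iff_kernel: "det A = 0 \<longleftrightarrow> (\<exists>c. c \<noteq> 0 \<and> A *v c = 0)" for A :: "real^'m^'m"
  using invertible_det_nz[of A] invertible_left_inverse[of A] matrix_left_invertible_ker[of A] by auto

text \<open>
  If \<open>a\<close> has full rank, then \<open>a = h q t\<close> with a rotation \<open>h\<close>, and \<open>t\<close> contributes \<open>(det t)\<^sup>2\<close>.  Otherwise
  both sides vanish.  Being a pointwise identity, it serves both the real and the complex integrals.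
\<close>
lemma cos_kernel_factor:
  fixes a q :: "real^'m^'n"
  assumes q: "q \<in> stiefel"
  shows "\<exists>h. orthogonal_matrix h \<and> (\<forall>w. cos_kernel a w = det (transpose a ** a) * cos_kernel q (h ** w))"
proof (cases "det (transpose a ** a) = 0")
  case True
  then obtain c where c: "c \<noteq> 0" "(transpose a ** a) *v c = 0"
    using det_eq_0_iff_kernel by blast
  have "(a *v c) \<bullet> (a *v c) = 0"
    unfolding inner_mult_mult c(2) by simp
  then have ac: "a *v c = 0" by simp
  have "cos_kernel a w = 0" for w
  proof -
    have "(transpose w ** a) *v c = 0" unfolding matrix_vector_mul_assoc[symmetric] ac by simp
    then have "det (transpose w ** a) = 0" using c(1) det_eq_0_iff_kernel by blast
    then show ?thesis by (subst cos_kernel_commute) (simp add: cos_kernel_eq)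
  qed
  then show ?thesis using True orthogonal_matrix_id by auto
next
  case False
  let ?x = "\<lambda>j. column j a"
  obtain t where t: "a = of_columns (gram_schmidt ?x) ** t"
    using gram_schmidt_factor[of ?x] by auto
  have "of_columns (gram_schmidt ?x) \<in> stiefel"
    using False by (simp add: of_columns_stiefel orthonormal_on_gram_schmidt gram_column)
  then obtain h where h: "orthogonal_matrix h" "h ** q = of_columns (gram_schmidt ?x)"
    using stiefel_transitive[OF q] by blast
  then have a: "a = h ** (q ** t)" using t by (simp add: matrix_mul_assoc)
  have "transpose a ** a = transpose t ** ((transpose q ** (transpose h ** h)) ** q) ** t"
    by (simp add: a matrix_transpose_mul matrix_mul_assoc)
  also have "\<dots> = transpose t ** t"
    using h(1) q by (simp add: orthogonal_matrix stiefel_def)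
  finally have det: "det (transpose a ** a) = (det t)\<^sup>2" by (simp add: det_mul power2_eq_square)
  have "cos_kernel a w = (det t)\<^sup>2 * cos_kernel q (transpose h ** w)" for w
    by (simp add: cos_kernel_eq a matrix_transpose_mul det_mul power_mult_distrib flip: matrix_mul_assoc)
  then show ?thesis using h(1) det by (metis orthogonal_matrix_transpose)
qed

lemma measurable_stiefel_space_borel [measurable]: "(\<lambda>v. v) \<in> borel_measurable stiefel_space"
  by (rule measurable_restrict_space1) simp

lemma measurable_stiefel_measure_borel:
  assumes "CARD('m) \<le> CARD('n)" "f \<in> borel_measurable borel"
  shows "f \<in> borel_measurable (stiefel_measure :: (real^'m^'n) measure)"
  using measurable_restrict_space1[OF assms(2), of stiefel]
  by (simp cong: measurable_cong_sets add: sets_stiefel_measure[OF assms(1)])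

definition gauss_family :: "('m::finite \<Rightarrow> real^'n) measure" where
  "gauss_family = Pi\<^sub>M UNIV (\<lambda>_. gauss)"

lemma prob_space_gauss_family: "prob_space gauss_family"
  unfolding gauss_family_def by (intro prob_space_PiM prob_space_gauss)

lemma space_gauss_family [simp]: "space gauss_family = UNIV"
  by (simp add: gauss_family_def space_PiM)

lemma measurable_gauss_family [measurable]: "(\<lambda>x. x i) \<in> borel_measurable gauss_family"
  using measurable_glue[of UNIV undefined i] by (simp add: gauss_family_def)

lemma borel_measurable_of_columns [measurable (raw)]:
  fixes x :: "'w \<Rightarrow> 'm::finite \<Rightarrow> real^'n"
  assumes [measurable]: "\<And>i. (\<lambda>w. x w i) \<in> borel_measurable M"
  shows "(\<lambda>w. of_columns (x w)) \<in> borel_measurable M"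
  by (rule borel_measurable_matrixI) (simp add: of_columns_def)

lemma measurable_gauss_familyI:
  fixes f :: "'x \<Rightarrow> 'm::finite \<Rightarrow> real^'n"
  assumes "\<And>i. (\<lambda>x. f x i) \<in> borel_measurable M"
  shows "f \<in> measurable M gauss_family"
proof -
  have "(\<lambda>x. \<lambda>i\<in>UNIV. f x i) \<in> measurable M (Pi\<^sub>M UNIV (\<lambda>_. gauss))"
    using assms by (intro measurable_restrict) (simp cong: measurable_cong_sets)
  then show ?thesis by (simp only: gauss_family_def restrict_UNIV)
qed

lemma measurable_gauss_family_mult:
  "(\<lambda>(x :: 'm::finite \<Rightarrow> real^'n) i. (a :: real^'n^'k) *v x i) \<in> measurable gauss_family gauss_family"
  by (rule measurable_gauss_familyI, rule measurable_compose[OF measurable_gauss_family])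
     (intro borel_measurable_linear matrix_vector_mul_linear)

lemma gram_moment:
  assumes "CARD('m) \<le> CARD('n)" "p > - 1 / 2"
  shows "(\<integral>\<^sup>+x. ennreal (\<bar>det (gram x)\<bar> powr p) \<partial>(gauss_family :: ('m::finite \<Rightarrow> real^'n) measure))
    = ennreal (\<Prod>l<CARD('m). chi_moment (CARD('n) - CARD('m) + 1 + l) p)"
  using gram_moment_glue[of p UNIV "\<lambda>_::'m. 0 :: real^'n"] assms
  by (simp add: gauss_family_def orthonormal_on_def)

lemma gram_moment_complex:
  assumes "CARD('m) \<le> CARD('n)" "Re p > - 1 / 2"
  shows "(\<integral>x. complex_of_real \<bar>det (gram x)\<bar> powr p \<partial>(gauss_family :: ('m::finite \<Rightarrow> real^'n) measure))
    = (\<Prod>l<CARD('m). chi_moment_complex (CARD('n) - CARD('m) + 1 + l) p)"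
  using gram_moment_complex_glue[of p UNIV "\<lambda>_::'m. 0 :: real^'n"] assms
  by (simp add: gauss_family_def orthonormal_on_def)

lemma distr_gauss_family_coisometry:
  fixes v :: "real^'k^'n"
  assumes "v \<in> stiefel"
  shows "distr gauss_family gauss_family (\<lambda>(x :: 'm::finite \<Rightarrow> real^'n) i. transpose v *v x i)
    = gauss_family"
proof -
  have E: "(v *v x) \<bullet> (v *v y) = x \<bullet> y" for x y :: "real^'k"
    using assms unfolding inner_mult_mult stiefel_def by simp
  have "distr gauss gauss ((*v) (transpose v)) = gauss"
    by (rule gauss_coisometry[OF E inner_transpose_mult])
  then show ?thesis unfolding gauss_family_def
    by (rule distr_PiM_gauss_map) (intro borel_measurable_linear matrix_vector_mul_linear)
qed

lemma cos_kernel_of_columns: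
  "cos_kernel (of_columns x) w = det (gram (\<lambda>j. transpose w *v x j))"
  unfolding transpose_of_columns_mult[symmetric] matrix_mult_of_columns[symmetric] cos_kernel_def
  by (simp add: matrix_transpose_mul matrix_mul_assoc)

text \<open>
  The mean of the cosine kernel to the power \<open>p\<close>: the moment for square Gaussian matrices divided by the
  moment for \<open>n\<close>-by-\<open>m\<close> Gaussian matrices.
\<close>
definition cos_mean :: "nat \<Rightarrow> nat \<Rightarrow> real \<Rightarrow> real" where
  "cos_mean n m p = (\<Prod>l<m. chi_moment (1 + l) p) / (\<Prod>l<m. chi_moment (n - m + 1 + l) p)"

definition cos_mean_complex :: "nat \<Rightarrow> nat \<Rightarrow> complex \<Rightarrow> complex" where
  "cos_mean_complex n m p =
     (\<Prod>l<m. chi_moment_complex (1 + l) p) / (\<Prod>l<m. chi_moment_complex (n - m + 1 + l) p)"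

lemma prod_chi_moment_pos: "p > - 1 / 2 \<Longrightarrow> (\<Prod>l<m. chi_moment (n + 1 + l) p) > 0"
  by (intro prod_pos ballI chi_moment_pos) auto

lemma cos_mean_pos: "p > - 1 / 2 \<Longrightarrow> cos_mean n m p > 0"
  using prod_chi_moment_pos[where p=p and m=m and n=0] prod_chi_moment_pos[where p=p and m=m and n="n - m"]
  by (simp add: cos_mean_def)

lemma chi_moment_complex_nonzero:
  assumes "n \<ge> 1" "Re p > - 1 / 2"
  shows "chi_moment_complex n p \<noteq> 0"
proof -
  have "Gamma z \<noteq> 0" if "Re z > 0" for z :: complex
    using that by (auto simp: Gamma_eq_zero_iff elim!: nonpos_Ints_cases)
  from this[of "of_nat n / 2 + p"] this[of "of_nat n / 2"] show ?thesis
    using assms by (auto simp: chi_moment_complex_def)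
qed

lemma measurable_cos_kernel_columns [measurable]:
  assumes "CARD('m) \<le> CARD('n)"
  shows "(\<lambda>z. cos_kernel (of_columns (fst z)) (snd z)) \<in> borel_measurable
     ((gauss_family :: ('m::finite \<Rightarrow> real^'n) measure) \<Otimes>\<^sub>M stiefel_measure)"
proof -
  have [measurable]: "(\<lambda>z. fst z i) \<in> borel_measurable
     ((gauss_family :: ('m::finite \<Rightarrow> real^'n) measure) \<Otimes>\<^sub>M (stiefel_measure :: (real^'m^'n) measure))" for i
    by (rule measurable_compose[OF measurable_fst measurable_gauss_family])
  have [measurable]: "snd \<in> borel_measurable
     ((gauss_family :: ('m::finite \<Rightarrow> real^'n) measure) \<Otimes>\<^sub>M (stiefel_measure :: (real^'m^'n) measure))"
    by (rule measurable_compose[OF measurable_snd])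
       (use measurable_stiefel_measure_borel[OF assms, of "\<lambda>x. x"] in simp)
  show ?thesis by measurable
qed

text \<open>
  The matrix \<open>w' x\<close> is a square Gaussian matrix by \<open>gauss_coisometry\<close>.
\<close>
lemma nn_integral_gauss_cos_kernel:
  fixes w :: "real^'m^'n"
  assumes w: "w \<in> stiefel" and p: "p > - 1 / 2"
  shows "(\<integral>\<^sup>+x. ennreal (\<bar>cos_kernel (of_columns x) w\<bar> powr p) \<partial>gauss_family)
    = ennreal (\<Prod>l<CARD('m). chi_moment (1 + l) p)"
proof -
  note m = measurable_gauss_family_mult[of "transpose w", where 'm='m]
  have "(\<integral>\<^sup>+x. ennreal (\<bar>cos_kernel (of_columns x) w\<bar> powr p) \<partial>gauss_family)
      = (\<integral>\<^sup>+x. ennreal (\<bar>det (gram x)\<bar> powr p) \<partial>distr gauss_family (gauss_family :: ('m \<Rightarrow> real^'m) measure) (\<lambda>(x :: 'm \<Rightarrow> real^'n) i. transpose w *v x i))"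
    unfolding cos_kernel_of_columns by (rule nn_integral_distr[symmetric, OF m]) measurable
  then show ?thesis
    unfolding distr_gauss_family_coisometry[OF w] using gram_moment[where 'm='m and 'n='m, OF _ p] by simp
qed

lemma integral_gauss_cos_kernel:
  fixes w :: "real^'m^'n"
  assumes w: "w \<in> stiefel" and p: "Re p > - 1 / 2"
  shows "(\<integral>x. complex_of_real \<bar>cos_kernel (of_columns x) w\<bar> powr p \<partial>gauss_family)
    = (\<Prod>l<CARD('m). chi_moment_complex (1 + l) p)"
proof -
  note m = measurable_gauss_family_mult[of "transpose w", where 'm='m]
  have "(\<integral>x. complex_of_real \<bar>cos_kernel (of_columns x) w\<bar> powr p \<partial>gauss_family)
      = (\<integral>x. complex_of_real \<bar>det (gram x)\<bar> powr p \<partial>distr gauss_family (gauss_family :: ('m \<Rightarrow> real^'m) measure) (\<lambda>(x :: 'm \<Rightarrow> real^'n) i. transpose w *v x i))"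
    unfolding cos_kernel_of_columns by (rule integral_distr[symmetric, OF m]) measurable
  then show ?thesis
    unfolding distr_gauss_family_coisometry[OF w] using gram_moment_complex[where 'm='m and 'n='m, OF _ p] by simp
qed

text \<open>
  The mean over \<open>w\<close> is the stated power of \<open>det (a' a)\<close> times a constant \<open>C\<close>.  Averaging over a Gaussian \<open>a\<close>, in both orders,
  determines \<open>C\<close>.
\<close>
lemma nn_integral_cos_kernel:
  fixes a :: "real^'m^'n"
  assumes mn: "CARD('m) \<le> CARD('n)" and p: "p > - 1 / 2"
  shows "(\<integral>\<^sup>+w. ennreal (\<bar>cos_kernel a w\<bar> powr p) \<partial>stiefel_measure)
     = ennreal (\<bar>det (transpose a ** a)\<bar> powr p * cos_mean CARD('n) CARD('m) p)"
proof -
  let ?S = "stiefel_measure :: (real^'m^'n) measure"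
  let ?G = "gauss_family :: ('m \<Rightarrow> real^'n) measure"
  interpret S: prob_space ?S by (rule prob_space_stiefel_measure[OF mn])
  interpret G: prob_space ?G by (rule prob_space_gauss_family)
  interpret GS: pair_sigma_finite ?G ?S ..
  obtain q :: "real^'m^'n" where q: "q \<in> stiefel" using stiefel_nonempty[OF mn] by blast
  define C where "C = (\<integral>\<^sup>+w. ennreal (\<bar>cos_kernel q w\<bar> powr p) \<partial>?S)"
  have C: "(\<integral>\<^sup>+w. ennreal (\<bar>cos_kernel b w\<bar> powr p) \<partial>?S) = ennreal (\<bar>det (transpose b ** b)\<bar> powr p) * C" for b
  proof -
    obtain h where h: "orthogonal_matrix h"
      and k: "\<And>w. cos_kernel b w = det (transpose b ** b) * cos_kernel q (h ** w)"
      using cos_kernel_factor[OF q, of b] by blast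
    have "(\<integral>\<^sup>+w. ennreal (\<bar>cos_kernel b w\<bar> powr p) \<partial>?S)
        = (\<integral>\<^sup>+w. ennreal (\<bar>det (transpose b ** b)\<bar> powr p) * ennreal (\<bar>cos_kernel q (h ** w)\<bar> powr p) \<partial>?S)"
      by (simp add: k abs_mult powr_mult ennreal_mult)
    also have "\<dots> = ennreal (\<bar>det (transpose b ** b)\<bar> powr p) * (\<integral>\<^sup>+w. ennreal (\<bar>cos_kernel q (h ** w)\<bar> powr p) \<partial>?S)"
      by (intro nn_integral_cmult measurable_stiefel_measure_borel[OF mn]) measurable
    also have "(\<integral>\<^sup>+w. ennreal (\<bar>cos_kernel q (h ** w)\<bar> powr p) \<partial>?S) = C"
      unfolding C_def
      by (rule is_stiefel_measure_nn_integral[OF is_stiefel_measure_stiefel_measure[OF mn] h])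
         (rule measurable_restrict_space1, measurable)
    finally show ?thesis .
  qed
  have "ennreal (\<Prod>l<CARD('m). chi_moment (1 + l) p)
      = (\<integral>\<^sup>+w. \<integral>\<^sup>+x. ennreal (\<bar>cos_kernel (of_columns x) w\<bar> powr p) \<partial>?G \<partial>?S)"
    by (simp add: nn_integral_gauss_cos_kernel[OF _ p] space_stiefel_measure[OF mn]
        S.emeasure_space_1[unfolded space_stiefel_measure[OF mn]]
        cong: nn_integral_cong_simp)
  also have "\<dots> = (\<integral>\<^sup>+x. \<integral>\<^sup>+w. ennreal (\<bar>cos_kernel (of_columns x) w\<bar> powr p) \<partial>?S \<partial>?G)"
    using measurable_cos_kernel_columns[OF mn] by (intro GS.Fubini') (simp add: split_def)
  also have "\<dots> = (\<integral>\<^sup>+x. ennreal (\<bar>det (gram x)\<bar> powr p) * C \<partial>?G)"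
    unfolding C transpose_of_columns_mult ..
  also have "\<dots> = ennreal (\<Prod>l<CARD('m). chi_moment (CARD('n) - CARD('m) + 1 + l) p) * C"
    by (subst nn_integral_multc) (simp_all add: gram_moment[OF mn p])
  finally have eq: "ennreal (\<Prod>l<CARD('m). chi_moment (1 + l) p)
    = ennreal (\<Prod>l<CARD('m). chi_moment (CARD('n) - CARD('m) + 1 + l) p) * C" .
  have "C = ennreal (cos_mean CARD('n) CARD('m) p)"
  proof -
    define B where "B = (\<Prod>l<CARD('m). chi_moment (CARD('n) - CARD('m) + 1 + l) p)"
    have B: "B > 0" unfolding B_def by (rule prod_chi_moment_pos[OF p])
    have "C = ennreal (1 / B) * (ennreal B * C)"
      using B by (simp add: mult.assoc[symmetric] flip: ennreal_mult'')
    also have "\<dots> = ennreal (1 / B) * ennreal (\<Prod>l<CARD('m). chi_moment (1 + l) p)"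
      by (simp only: eq[folded B_def])
    also have "\<dots> = ennreal (cos_mean CARD('n) CARD('m) p)"
      using B by (simp add: cos_mean_def B_def[symmetric, simplified] flip: ennreal_mult')
    finally show ?thesis .
  qed
  with C[of a] show ?thesis by (simp add: ennreal_mult')
qed

text \<open>
  The argument of \<open>nn_integral_cos_kernel\<close>; Fubini's theorem applies because the real moments in
  \<open>nn_integral_gauss_cos_kernel\<close> are finite.
\<close>
lemma integral_cos_kernel:
  fixes a :: "real^'m^'n"
  assumes mn: "CARD('m) \<le> CARD('n)" and p: "Re p > - 1 / 2"
  shows "(\<integral>w. complex_of_real \<bar>cos_kernel a w\<bar> powr p \<partial>stiefel_measure)
     = complex_of_real \<bar>det (transpose a ** a)\<bar> powr p * cos_mean_complex CARD('n) CARD('m) p"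
proof -
  let ?S = "stiefel_measure :: (real^'m^'n) measure"
  let ?G = "gauss_family :: ('m \<Rightarrow> real^'n) measure"
  interpret S: prob_space ?S by (rule prob_space_stiefel_measure[OF mn])
  interpret G: prob_space ?G by (rule prob_space_gauss_family)
  interpret GS: pair_sigma_finite ?G ?S ..
  obtain q :: "real^'m^'n" where q: "q \<in> stiefel" using stiefel_nonempty[OF mn] by blast
  define C where "C = (\<integral>w. complex_of_real \<bar>cos_kernel q w\<bar> powr p \<partial>?S)"
  have C: "(\<integral>w. complex_of_real \<bar>cos_kernel b w\<bar> powr p \<partial>?S) = complex_of_real \<bar>det (transpose b ** b)\<bar> powr p * C" for b
  proof -
    obtain h where h: "orthogonal_matrix h"
      and k: "\<And>w. cos_kernel b w = det (transpose b ** b) * cos_kernel q (h ** w)"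
      using cos_kernel_factor[OF q, of b] by blast
    have hm: "(\<lambda>w. h ** w) \<in> measurable ?S stiefel_space"
      using measurable_mult_left[OF h] by (simp cong: measurable_cong_sets add: sets_stiefel_measure[OF mn])
    have "(\<integral>w. complex_of_real \<bar>cos_kernel q (h ** w)\<bar> powr p \<partial>?S)
        = (\<integral>w. complex_of_real \<bar>cos_kernel q w\<bar> powr p \<partial>distr ?S stiefel_space (\<lambda>w. h ** w))"
      by (rule integral_distr[symmetric, OF hm]) (rule measurable_restrict_space1, measurable)
    then show ?thesis
      by (simp add: k of_real_abs_powr_mult C_def distr_stiefel_measure_mult[OF mn h])
  qed
  have meas: "(\<lambda>(x, w). complex_of_real \<bar>cos_kernel (of_columns x) w\<bar> powr p) \<in> borel_measurable (?G \<Otimes>\<^sub>M ?S)"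
    using measurable_of_real_abs_powr[OF measurable_cos_kernel_columns[OF mn]] by (simp add: split_def)
  have int: "integrable (?G \<Otimes>\<^sub>M ?S) (\<lambda>(x, w). complex_of_real \<bar>cos_kernel (of_columns x) w\<bar> powr p)"
  proof (rule integrableI_bounded[OF meas])
    let ?I = "(\<integral>\<^sup>+z. ennreal (norm (case z of (x, w) \<Rightarrow> complex_of_real \<bar>cos_kernel (of_columns x) w\<bar> powr p)) \<partial>(?G \<Otimes>\<^sub>M ?S))"
    have "?I
       = (\<integral>\<^sup>+w. \<integral>\<^sup>+x. ennreal (norm (complex_of_real \<bar>cos_kernel (of_columns x) w\<bar> powr p)) \<partial>?G \<partial>?S)"
      using meas by (subst GS.nn_integral_snd[symmetric]) (simp_all add: split_def)
    also have "\<dots> = ennreal (\<Prod>l<CARD('m). chi_moment (1 + l) (Re p))"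
      unfolding norm_of_real_abs_powr
      by (simp add: nn_integral_gauss_cos_kernel[OF _ p] space_stiefel_measure[OF mn]
        S.emeasure_space_1[unfolded space_stiefel_measure[OF mn]]
          cong: nn_integral_cong_simp)
    finally show "?I < \<infinity>"
      by simp
  qed
  have "(\<Prod>l<CARD('m). chi_moment_complex (1 + l) p)
      = (\<integral>w. \<integral>x. complex_of_real \<bar>cos_kernel (of_columns x) w\<bar> powr p \<partial>?G \<partial>?S)"
  proof -
    have "(\<integral>w. \<integral>x. complex_of_real \<bar>cos_kernel (of_columns x) w\<bar> powr p \<partial>?G \<partial>?S)
        = (\<integral>w. (\<Prod>l<CARD('m). chi_moment_complex (1 + l) p) \<partial>?S)"
      by (rule Bochner_Integration.integral_cong[OF refl], rule integral_gauss_cos_kernel[OF _ p])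
         (simp add: space_stiefel_measure[OF mn])
    then show ?thesis using S.prob_space by simp
  qed
  also have "\<dots> = (\<integral>x. \<integral>w. complex_of_real \<bar>cos_kernel (of_columns x) w\<bar> powr p \<partial>?S \<partial>?G)"
    by (rule GS.Fubini_integral[OF int])
  also have "\<dots> = (\<integral>x. complex_of_real \<bar>det (gram x)\<bar> powr p * C \<partial>?G)"
    unfolding C transpose_of_columns_mult ..
  also have "\<dots> = (\<Prod>l<CARD('m). chi_moment_complex (CARD('n) - CARD('m) + 1 + l) p) * C"
    by (simp add: gram_moment_complex[OF mn p])
  finally have eq: "(\<Prod>l<CARD('m). chi_moment_complex (1 + l) p)
    = (\<Prod>l<CARD('m). chi_moment_complex (CARD('n) - CARD('m) + 1 + l) p) * C" .
  have "(\<Prod>l<CARD('m). chi_moment_complex (CARD('n) - CARD('m) + 1 + l) p) \<noteq> 0"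
    using chi_moment_complex_nonzero[OF _ p] by simp
  then have "C = cos_mean_complex CARD('n) CARD('m) p"
    unfolding cos_mean_complex_def eq by (rule nonzero_mult_div_cancel_left[symmetric])
  with C[of a] show ?thesis by simp
qed

text \<open>
  The index is reversed, \<open>l = m - 1 - j\<close>, to match the order of the factors in \<open>Gamma_m\<close>; the powers of \<open>pi\<close>
  cancel.
\<close>
lemma prod_chi_moment_complex:
  assumes mn: "m \<le> n" and p: "Re p > - 1 / 2"
  shows "(\<Prod>l<m. chi_moment_complex (n - m + 1 + l) p)
     = (2 powr p) ^ m * (Gamma_m m (of_nat n / 2 + p) / Gamma_m m (of_nat n / 2))"
proof -
  have "(\<Prod>l<m. chi_moment_complex (n - m + 1 + l) p) = (\<Prod>j<m. chi_moment_complex (n - j) p)"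
    using mn by (subst prod.nat_diff_reindex[symmetric]) (auto intro!: prod.cong arg_cong2[where f=chi_moment_complex])
  also have "\<dots> = (\<Prod>j<m. 2 powr p * (Gamma (of_nat n / 2 + p - of_nat j / 2) / Gamma (of_nat n / 2 - of_nat j / 2)))"
    using mn by (intro prod.cong refl) (auto simp: chi_moment_complex_def of_nat_diff diff_divide_distrib algebra_simps)
  also have "\<dots> = (2 powr p) ^ m * ((\<Prod>j<m. Gamma (of_nat n / 2 + p - of_nat j / 2)) / (\<Prod>j<m. Gamma (of_nat n / 2 - of_nat j / 2)))"
    by (simp add: prod.distrib prod_dividef)
  finally show ?thesis by (simp add: Gamma_m_def)
qed

lemma cos_mean_complex_Gamma_m:
  assumes mn: "m \<le> n" and p: "Re p > - 1 / 2"
  shows "cos_mean_complex n m p = (Gamma_m m (of_nat n / 2) * Gamma_m m (of_nat m / 2 + p))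
      / (Gamma_m m (of_nat m / 2) * Gamma_m m (of_nat n / 2 + p))"
  using prod_chi_moment_complex[OF mn p] prod_chi_moment_complex[OF le_refl p, of m]
  by (simp add: cos_mean_complex_def)

section \<open>The Funk transform as an integral over the orthogonal complement\<close>

definition complement_frame :: "real^'k^'n \<Rightarrow> real^'d^'n \<Rightarrow> bool" where
  "complement_frame u b \<longleftrightarrow> b \<in> stiefel \<and> b ** transpose b = mat 1 - u ** transpose u"

lemma matrix_sub_ldistrib: "a ** (b - c) = a ** b - a ** c" for a :: "real^'m^'n"
  by (simp add: vec_eq_iff matrix_matrix_mult_def right_diff_distrib sum_subtractf)

lemma matrix_sub_rdistrib: "(b - c) ** a = b ** a - c ** a" for a :: "real^'m^'n"
  by (simp add: vec_eq_iff matrix_matrix_mult_def left_diff_distrib sum_subtractf)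

lemma complement_frame_mult:
  assumes g: "orthogonal_matrix g" and b: "complement_frame u b"
  shows "complement_frame (g ** u) (g ** b)"
proof -
  have "(g ** b) ** transpose (g ** b) = g ** (b ** transpose b) ** transpose g"
    by (simp add: matrix_transpose_mul matrix_mul_assoc)
  also have "\<dots> = g ** transpose g - (g ** u) ** transpose (g ** u)"
    using b by (simp add: complement_frame_def matrix_sub_ldistrib matrix_sub_rdistrib
        matrix_transpose_mul matrix_mul_assoc)
  also have "g ** transpose g = mat 1" using g by (simp add: orthogonal_matrix_def)
  finally show ?thesis using stiefel_mult[OF g, of b] b by (simp add: complement_frame_def)
qed

lemma complement_frame_orthogonal:
  assumes b: "complement_frame u b" and u: "u \<in> stiefel"
  shows "transpose b ** u = 0"
proof -
  have "transpose b ** u = (transpose b ** b) ** (transpose b ** u)"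
    using b by (simp add: complement_frame_def stiefel_def)
  also have "\<dots> = transpose b ** ((b ** transpose b) ** u)"
    by (simp add: matrix_mul_assoc)
  also have "(b ** transpose b) ** u = u - u ** (transpose u ** u)"
    using b by (simp add: complement_frame_def matrix_sub_rdistrib matrix_mul_assoc)
  also have "\<dots> = 0" using u by (simp add: stiefel_def)
  finally show ?thesis by simp
qed

lemma stack_Inl [simp]: "bij e \<Longrightarrow> stack e a b $ e (Inl p) = a $ p"
  and stack_Inr [simp]: "bij e \<Longrightarrow> stack e a b $ e (Inr q) = b $ q"
  by (simp_all add: stack_def bij_is_inj)

lemma vec_eq_iff_stack:
  assumes "bij (e :: 'd::finite + 'k::finite \<Rightarrow> 'n::finite)"
  shows "v = w \<longleftrightarrow> (\<forall>p. v $ e (Inl p) = w $ e (Inl p)) \<and> (\<forall>q. v $ e (Inr q) = w $ e (Inr q))"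
proof -
  have "\<exists>x. i = e x" for i using assms by (metis bij_pointE)
  then show ?thesis by (metis sum.exhaust vec_eq_iff)
qed

lemma sum_stack:
  assumes "bij (e :: 'd::finite + 'k::finite \<Rightarrow> 'n::finite)"
  shows "(\<Sum>i\<in>UNIV. f i) = (\<Sum>p\<in>UNIV. f (e (Inl p))) + (\<Sum>q\<in>UNIV. f (e (Inr q)) :: real)"
proof -
  have "(\<Sum>i\<in>UNIV. f i) = (\<Sum>x\<in>UNIV. f (e x))"
    using assms by (intro sum.reindex_bij_betw[symmetric])
  also have "\<dots> = (\<Sum>x\<in>UNIV <+> UNIV. f (e x))" by simp
  also have "\<dots> = (\<Sum>p\<in>UNIV. f (e (Inl p))) + (\<Sum>q\<in>UNIV. f (e (Inr q)))"
    by (subst sum.Plus) simp_all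
  finally show ?thesis .
qed

lemma stack_stiefel:
  assumes e: "bij (e :: 'd::finite + 'k::finite \<Rightarrow> 'n::finite)"
  shows "stack e 0 (mat 1) \<in> stiefel" and "stack e (mat 1) 0 \<in> stiefel"
  by (simp_all add: stiefel_def vec_eq_iff matrix_matrix_mult_def transpose_def sum_stack[OF e] e mat_def
      if_distrib[where f="\<lambda>x. x * _"] cong: if_cong)

lemma stack_mult:
  assumes e: "bij (e :: 'd::finite + 'k::finite \<Rightarrow> 'n::finite)"
  shows "stack e \<omega> 0 = stack e (mat 1) 0 ** \<omega>"
  by (simp add: vec_eq_iff_stack[OF e] e) (simp add: vec_eq_iff matrix_matrix_mult_def e mat_def
      if_distrib[where f="\<lambda>x. x * _"] cong: if_cong)

lemma complement_frame_stack:
  assumes e: "bij (e :: 'd::finite + 'k::finite \<Rightarrow> 'n::finite)"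
  shows "complement_frame (stack e 0 (mat 1)) (stack e (mat 1) 0)"
proof -
  have ne: "e (Inl p) \<noteq> e (Inr q)" "e (Inr q) \<noteq> e (Inl p)"
    "e (Inl p) = e (Inl p') \<longleftrightarrow> p = p'" "e (Inr q) = e (Inr q') \<longleftrightarrow> q = q'" for p p' q q'
    using e by (auto dest!: bij_is_inj injD)
  have "stack e (mat 1) 0 ** transpose (stack e (mat 1) 0)
      = mat 1 - stack e 0 (mat 1) ** transpose (stack e 0 (mat 1))"
    unfolding vec_eq_iff_stack[OF e]
    by (simp add: vec_eq_iff_stack[OF e] e matrix_matrix_mult_def transpose_def mat_def ne
        if_distrib[where f="\<lambda>x. x * _"] if_distrib[where f="\<lambda>x. _ * x"] cong: if_cong)
  then show ?thesis by (simp add: complement_frame_def stack_stiefel[OF e])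
qed

text \<open>
  The bijection \<open>e\<close> and the chosen matrix \<open>g\<close> enter the Funk transform only through the frame \<open>b\<close> spanned by the first
  columns of \<open>g\<close>.
\<close>
lemma funk_complement_frame:
  fixes e :: "'d::finite + 'k::finite \<Rightarrow> 'n::finite" and u :: "real^'k^'n"
  assumes e: "bij e" and u: "u \<in> stiefel"
  shows "\<exists>b :: real^'d^'n. complement_frame u b \<and>
    (\<forall>f :: real^'m^'n \<Rightarrow> complex. funk e f u = (\<integral>\<omega>. f (b ** \<omega>) \<partial>(stiefel_measure :: (real^'m^'d) measure)))"
proof -
  define g where "g = (SOME g :: real^'n^'n. orthogonal_matrix g \<and> g ** stack e 0 (mat 1) = u)"
  have g: "orthogonal_matrix g \<and> g ** stack e 0 (mat 1) = u"
    unfolding g_def by (rule someI_ex) (rule stiefel_transitive[OF stack_stiefel(1)[OF e] u])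
  have "complement_frame u (g ** stack e (mat 1) 0)"
    using complement_frame_mult[OF _ complement_frame_stack[OF e]] g by auto
  moreover have "funk e f u = (\<integral>\<omega>. f ((g ** stack e (mat 1) 0) ** \<omega>) \<partial>(stiefel_measure :: (real^'m^'d) measure))"
    for f :: "real^'m^'n \<Rightarrow> complex"
    by (simp add: funk_def g_def[symmetric] stack_mult[OF e, of "_ :: real^'m^'d"] matrix_mul_assoc)
  ultimately show ?thesis by blast
qed

text \<open>
  For Gaussian \<open>x\<close> and an orthonormal \<open>u\<close> whose complement has dimension at least \<open>m\<close>, this is a
  uniformly distributed frame orthogonal to \<open>u\<close>.
\<close>
definition complement_sample :: "real^'k^'n \<Rightarrow> ('m::finite \<Rightarrow> real^'n) \<Rightarrow> real^'m^'n" where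
  "complement_sample u x = orthonormalize (\<lambda>j. (mat 1 - u ** transpose u) *v x j)"

lemma complement_sample_stiefel:
  "CARD('m::finite) \<le> CARD('n) \<Longrightarrow> complement_sample u (x :: 'm \<Rightarrow> real^'n) \<in> stiefel"
  by (simp add: complement_sample_def orthonormalize_stiefel)

lemma borel_measurable_complement_sample:
  fixes u :: "'w \<Rightarrow> real^'k^'n" and x :: "'w \<Rightarrow> 'm::finite \<Rightarrow> real^'n"
  assumes [measurable]: "u \<in> borel_measurable M" "\<And>i. (\<lambda>w. x w i) \<in> borel_measurable M"
  shows "(\<lambda>w. complement_sample (u w) (x w)) \<in> borel_measurable M"
proof -
  have "(\<lambda>w. (mat 1 - u w ** transpose (u w)) *v x w j) \<in> borel_measurable M" for j
    unfolding matrix_vector_mult_def by (rule borel_measurable_vecI) simp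
  then show ?thesis unfolding complement_sample_def by measurable
qed

text \<open>
  The uniform \<open>\<omega>\<close> is an orthonormalized Gaussian matrix \<open>y\<close>, and \<open>y\<close> has the law of \<open>b' x\<close>.  Since \<open>b\<close> is an isometry, it can be
  moved inside the orthonormalization, which leads to \<open>b b' x\<close>.
\<close>
lemma distr_complement_frame:
  fixes b :: "real^'d^'n" and u :: "real^'k^'n"
  assumes b: "complement_frame u b" and md: "CARD('m) \<le> CARD('d)"
  shows "distr (stiefel_measure :: (real^'m^'d) measure) stiefel_space (\<lambda>\<omega>. b ** \<omega>)
    = distr gauss_family (stiefel_space :: (real^'m^'n) measure) (complement_sample u)"
proof -
  let ?Gd = "gauss_family :: ('m \<Rightarrow> real^'d) measure"
  let ?Gn = "gauss_family :: ('m \<Rightarrow> real^'n) measure"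
  let ?Vd = "stiefel_space :: (real^'m^'d) measure"
  let ?Vn = "stiefel_space :: (real^'m^'n) measure"
  have bs: "b \<in> stiefel" using b by (simp add: complement_frame_def)
  have mn: "CARD('m) \<le> CARD('n)" using md stiefel_card[OF bs] by simp
  have law: "stiefel_measure = distr ?Gd ?Vd orthonormalize"
    using stiefel_measure_eq[OF is_stiefel_measure_law[OF md] md] by (simp add: stiefel_law_def gauss_family_def)
  have n [measurable]: "orthonormalize \<in> measurable ?Gd ?Vd" "orthonormalize \<in> measurable ?Gn ?Vn"
    using measurable_orthonormalize[OF md] measurable_orthonormalize[OF mn] by (simp_all add: gauss_family_def)
  note bm = measurable_stiefel_space_mult[OF bs, where 'm='m]
  have h: "linear ((*v) b)" "\<And>v w. (b *v v) \<bullet> (b *v w) = v \<bullet> w"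
    using bs unfolding inner_mult_mult stiefel_def by (simp_all add: matrix_vector_mul_linear)
  have bG: "(\<lambda>x i. b *v x i) \<in> measurable ?Gd ?Gn"
    by (rule measurable_gauss_family_mult)
  have tG: "(\<lambda>x i. transpose b *v x i) \<in> measurable ?Gn ?Gd"
    by (rule measurable_gauss_family_mult)
  have nb: "(\<lambda>x. orthonormalize (\<lambda>j. b *v x j)) \<in> measurable ?Gd ?Vn"
    by (rule measurable_compose[OF bG n(2)])
  have "distr (stiefel_measure :: (real^'m^'d) measure) ?Vn (\<lambda>\<omega>. b ** \<omega>) = distr ?Gd ?Vn (\<lambda>x. b ** orthonormalize x)"
    unfolding law using bm by (subst distr_distr) (simp_all add: o_def)
  also have "\<dots> = distr ?Gd ?Vn (\<lambda>x. orthonormalize (\<lambda>j. b *v x j))"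
  proof (rule distr_cong_AE)
    show "AE x in ?Gd. b ** orthonormalize x = orthonormalize (\<lambda>j. b *v x j)"
      using AE_gauss_gram_nonzero[OF md] unfolding gauss_family_def
    proof eventually_elim
      case (elim x)
      show ?case unfolding orthonormalize_isometry[OF h elim] by (metis matrix_mult_of_columns of_columns_column)
    qed
    show "(\<lambda>x. b ** orthonormalize x) \<in> measurable ?Gd ?Vn" by (rule measurable_compose[OF n(1) bm])
  qed (use nb in simp_all)
  also have "\<dots> = distr (distr ?Gn ?Gd (\<lambda>x i. transpose b *v x i)) ?Vn (\<lambda>x. orthonormalize (\<lambda>j. b *v x j))"
    by (simp only: distr_gauss_family_coisometry[OF bs])
  also have "\<dots> = distr ?Gn ?Vn (\<lambda>x. orthonormalize (\<lambda>j. b *v (transpose b *v x j)))"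
    by (simp only: distr_distr[OF nb tG] o_def)
  also have "\<dots> = distr ?Gn ?Vn (complement_sample u)"
    using b by (simp only: matrix_vector_mul_assoc complement_frame_def complement_sample_def[abs_def])
  finally show ?thesis .
qed

lemma measurable_complement_sample_pair:
  assumes kn: "CARD('k) \<le> CARD('n)" and mn: "CARD('m) \<le> CARD('n)"
  shows "(\<lambda>z. complement_sample (fst z) (snd z)) \<in> measurable
    ((stiefel_measure :: (real^'k^'n) measure) \<Otimes>\<^sub>M (gauss_family :: ('m::finite \<Rightarrow> real^'n) measure)) stiefel_space"
proof (rule measurable_stiefel_spaceI)
  show "(\<lambda>z. complement_sample (fst z) (snd z)) \<in> borel_measurable
    ((stiefel_measure :: (real^'k^'n) measure) \<Otimes>\<^sub>M (gauss_family :: ('m \<Rightarrow> real^'n) measure))"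
  proof (rule borel_measurable_complement_sample)
    show "fst \<in> borel_measurable
     ((stiefel_measure :: (real^'k^'n) measure) \<Otimes>\<^sub>M (gauss_family :: ('m \<Rightarrow> real^'n) measure))"
      by (rule measurable_compose[OF measurable_fst])
         (use measurable_stiefel_measure_borel[OF kn, of "\<lambda>x. x"] in simp)
  qed (rule measurable_compose[OF measurable_snd measurable_gauss_family])
qed (rule complement_sample_stiefel[OF mn])

lemma measurable_complement_sample:
  assumes mn: "CARD('m) \<le> CARD('n)"
  shows "complement_sample (u :: real^'k^'n) \<in> measurable (gauss_family :: ('m::finite \<Rightarrow> real^'n) measure) stiefel_space"
  by (rule measurable_stiefel_spaceI[OF borel_measurable_complement_sample])
     (simp_all add: complement_sample_stiefel[OF mn])

lemma nn_integral_distr_measurable: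
  "T \<in> measurable M M' \<Longrightarrow> f \<in> borel_measurable M' \<Longrightarrow> integral\<^sup>N (distr M M' T) f = (\<integral>\<^sup>+x. f (T x) \<partial>M)"
  by (rule nn_integral_distr) simp_all

lemma measurable_stiefel_mult:
  fixes b :: "real^'d^'n"
  assumes b: "b \<in> stiefel" and md: "CARD('m) \<le> CARD('d)"
  shows "(\<lambda>\<omega>. b ** \<omega>) \<in> measurable (stiefel_measure :: (real^'m^'d) measure) stiefel_space"
  using measurable_stiefel_space_mult[OF b]
  by (simp cong: measurable_cong_sets add: sets_stiefel_measure[OF md])

lemma nn_integral_complement_frame:
  fixes b :: "real^'d^'n" and u :: "real^'k^'n"
  assumes b: "complement_frame u b" and md: "CARD('m) \<le> CARD('d)"
    and f: "f \<in> borel_measurable (stiefel_space :: (real^'m^'n) measure)"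
  shows "(\<integral>\<^sup>+x. f (complement_sample u x) \<partial>gauss_family)
    = (\<integral>\<^sup>+\<omega>. f (b ** \<omega>) \<partial>(stiefel_measure :: (real^'m^'d) measure))"
proof -
  have bs: "b \<in> stiefel" using b by (simp add: complement_frame_def)
  have mn: "CARD('m) \<le> CARD('n)" using md stiefel_card[OF bs] by simp
  note bm = measurable_stiefel_mult[OF bs md]
  show ?thesis
    unfolding nn_integral_distr_measurable[OF bm f, symmetric] distr_complement_frame[OF b md]
    by (rule nn_integral_distr_measurable[OF measurable_complement_sample[OF mn] f, symmetric])
qed

lemma integral_complement_frame:
  fixes b :: "real^'d^'n" and u :: "real^'k^'n" and f :: "_ \<Rightarrow> complex"
  assumes b: "complement_frame u b" and md: "CARD('m) \<le> CARD('d)"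
    and f: "f \<in> borel_measurable (stiefel_space :: (real^'m^'n) measure)"
  shows "(\<integral>x. f (complement_sample u x) \<partial>gauss_family)
    = (\<integral>\<omega>. f (b ** \<omega>) \<partial>(stiefel_measure :: (real^'m^'d) measure))"
proof -
  have bs: "b \<in> stiefel" using b by (simp add: complement_frame_def)
  have mn: "CARD('m) \<le> CARD('n)" using md stiefel_card[OF bs] by simp
  note bm = measurable_stiefel_mult[OF bs md]
  show ?thesis
    unfolding integral_distr[OF bm f, symmetric] distr_complement_frame[OF b md]
    by (rule integral_distr[OF measurable_complement_sample[OF mn] f, symmetric])
qed

lemma funk_eq_complement_sample:
  fixes e :: "'d::finite + 'k::finite \<Rightarrow> 'n::finite" and u :: "real^'k^'n"
    and f :: "real^'m^'n \<Rightarrow> complex"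
  assumes e: "bij e" and u: "u \<in> stiefel" and md: "CARD('m) \<le> CARD('d)"
    and f: "f \<in> borel_measurable stiefel_space"
  shows "funk e f u = (\<integral>x. f (complement_sample u x) \<partial>gauss_family)"
proof -
  obtain b :: "real^'d^'n" where b: "complement_frame u b"
    and fb: "funk e f u = (\<integral>\<omega>. f (b ** \<omega>) \<partial>(stiefel_measure :: (real^'m^'d) measure))"
    using funk_complement_frame[OF e u, where 'm='m] by blast
  show ?thesis unfolding fb by (rule integral_complement_frame[OF b md f, symmetric])
qed

lemma nn_integral_orbit:
  fixes v :: "real^'m^'n"
  assumes v: "v \<in> stiefel" and f: "f \<in> borel_measurable stiefel_space"
  shows "(\<integral>\<^sup>+g. f (g ** v) \<partial>(stiefel_measure :: (real^'n^'n) measure)) = (\<integral>\<^sup>+w. f w \<partial>stiefel_measure)"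
proof -
  have "(\<lambda>g. g ** v) \<in> measurable (stiefel_measure :: (real^'n^'n) measure) stiefel_space"
    using orbit_measurable[OF v] by (simp cong: measurable_cong_sets add: sets_stiefel_measure)
  from nn_integral_distr_measurable[OF this f] show ?thesis by (simp add: distr_orbit[OF v])
qed

text \<open>
  Both sides integrate over a uniform pair of orthogonal frames: first \<open>u\<close> and then a frame orthogonal to it, or a uniform rotation
  applied to a fixed pair.
\<close>
lemma nn_integral_complement_pair:
  fixes u0 :: "real^'k^'n" and b0 :: "real^'d^'n" and F :: "(real^'k^'n) \<times> (real^'m^'n) \<Rightarrow> ennreal"
  assumes u0: "u0 \<in> stiefel" and b0: "complement_frame u0 b0" and md: "CARD('m) \<le> CARD('d)"
    and F: "F \<in> borel_measurable (stiefel_space \<Otimes>\<^sub>M stiefel_space)"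
  shows "(\<integral>\<^sup>+u. \<integral>\<^sup>+x. F (u, complement_sample u x) \<partial>gauss_family \<partial>stiefel_measure)
    = (\<integral>\<^sup>+\<omega>. \<integral>\<^sup>+g. F (g ** u0, g ** (b0 ** \<omega>)) \<partial>(stiefel_measure :: (real^'n^'n) measure)
         \<partial>(stiefel_measure :: (real^'m^'d) measure))"
proof -
  let ?H = "stiefel_measure :: (real^'n^'n) measure"
  let ?Sd = "stiefel_measure :: (real^'m^'d) measure"
  let ?Sk = "stiefel_measure :: (real^'k^'n) measure"
  let ?G = "gauss_family :: ('m \<Rightarrow> real^'n) measure"
  have bs: "b0 \<in> stiefel" using b0 by (simp add: complement_frame_def)
  have mn: "CARD('m) \<le> CARD('n)" using md stiefel_card[OF bs] by simp
  have kn: "CARD('k) \<le> CARD('n)" by (rule stiefel_card[OF u0])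
  interpret H: prob_space ?H by (rule prob_space_stiefel_measure) simp
  interpret Sd: prob_space ?Sd by (rule prob_space_stiefel_measure[OF md])
  interpret G: prob_space ?G by (rule prob_space_gauss_family)
  interpret HSd: pair_sigma_finite ?H ?Sd ..
  have "(\<lambda>z. F (fst z, complement_sample (fst z) (snd z))) \<in> borel_measurable (?Sk \<Otimes>\<^sub>M ?G)"
  proof (rule measurable_compose[OF measurable_Pair F])
    show "fst \<in> measurable (?Sk \<Otimes>\<^sub>M ?G) stiefel_space"
      using measurable_fst[of ?Sk ?G] by (simp cong: measurable_cong_sets add: sets_stiefel_measure[OF kn])
  qed (rule measurable_complement_sample_pair[OF kn mn])
  then have "(\<lambda>u. \<integral>\<^sup>+x. F (u, complement_sample u x) \<partial>?G) \<in> borel_measurable ?Sk"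
    by (intro G.borel_measurable_nn_integral) (simp add: split_def)
  then have meas: "(\<lambda>u. \<integral>\<^sup>+x. F (u, complement_sample u x) \<partial>?G) \<in> borel_measurable stiefel_space"
    by (simp cong: measurable_cong_sets add: sets_stiefel_measure[OF kn])
  have "(\<integral>\<^sup>+u. \<integral>\<^sup>+x. F (u, complement_sample u x) \<partial>?G \<partial>?Sk)
      = (\<integral>\<^sup>+g. \<integral>\<^sup>+x. F (g ** u0, complement_sample (g ** u0) x) \<partial>?G \<partial>?H)"
    by (rule nn_integral_orbit[OF u0 meas, symmetric])
  also have "\<dots> = (\<integral>\<^sup>+g. \<integral>\<^sup>+\<omega>. F (g ** u0, g ** (b0 ** \<omega>)) \<partial>?Sd \<partial>?H)"
  proof (rule nn_integral_cong)
    fix g assume "g \<in> space ?H"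
    then have g: "orthogonal_matrix g" by (simp add: space_stiefel_measure orthogonal_matrix_stiefel)
    have "(\<lambda>w. F (g ** u0, w)) \<in> borel_measurable stiefel_space"
      by (rule measurable_compose[OF _ F]) (simp add: space_restrict_space stiefel_mult[OF g u0])
    from nn_integral_complement_frame[OF complement_frame_mult[OF g b0] md this]
    show "(\<integral>\<^sup>+x. F (g ** u0, complement_sample (g ** u0) x) \<partial>?G) = (\<integral>\<^sup>+\<omega>. F (g ** u0, g ** (b0 ** \<omega>)) \<partial>?Sd)"
      by (simp add: matrix_mul_assoc)
  qed
  also have "\<dots> = (\<integral>\<^sup>+\<omega>. \<integral>\<^sup>+g. F (g ** u0, g ** (b0 ** \<omega>)) \<partial>?H \<partial>?Sd)"
  proof (rule HSd.Fubini'[symmetric])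
    have fst: "fst \<in> measurable (?H \<Otimes>\<^sub>M ?Sd) stiefel_space"
      using measurable_fst[of ?H ?Sd] by (simp cong: measurable_cong_sets add: sets_stiefel_measure)
    have [measurable]: "fst \<in> borel_measurable (?H \<Otimes>\<^sub>M ?Sd)" "snd \<in> borel_measurable (?H \<Otimes>\<^sub>M ?Sd)"
      by (rule measurable_compose[OF measurable_fst], use measurable_stiefel_measure_borel[OF order_refl, of "\<lambda>x. x"] in simp,
          rule measurable_compose[OF measurable_snd], use measurable_stiefel_measure_borel[OF md, of "\<lambda>x. x"] in simp)
    have "(\<lambda>z. fst z ** u0) \<in> measurable (?H \<Otimes>\<^sub>M ?Sd) stiefel_space"
      by (rule measurable_compose[OF fst orbit_measurable[OF u0]])
    moreover have "(\<lambda>z. fst z ** (b0 ** snd z)) \<in> measurable (?H \<Otimes>\<^sub>M ?Sd) stiefel_space"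
    proof (rule measurable_stiefel_spaceI)
      show "(\<lambda>z. fst z ** (b0 ** snd z)) \<in> borel_measurable (?H \<Otimes>\<^sub>M ?Sd)" by measurable
    qed (auto simp: space_pair_measure space_stiefel_measure space_stiefel_measure[OF md] intro!: stiefel_mult_stiefel bs)
    ultimately show "(\<lambda>(g, \<omega>). F (g ** u0, g ** (b0 ** \<omega>))) \<in> borel_measurable (?H \<Otimes>\<^sub>M ?Sd)"
      using measurable_compose[OF measurable_Pair F] by (simp add: split_def)
  qed
  finally show ?thesis .
qed

lemma nn_integral_complement_marginal:
  fixes F :: "real^'m^'n \<Rightarrow> ennreal" and e :: "'d::finite + 'k::finite \<Rightarrow> 'n::finite"
  assumes e: "bij e" and md: "CARD('m) \<le> CARD('d)"
    and F: "F \<in> borel_measurable stiefel_space"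
  shows "(\<integral>\<^sup>+u. \<integral>\<^sup>+x. F (complement_sample u x) \<partial>gauss_family \<partial>(stiefel_measure :: (real^'k^'n) measure))
    = (\<integral>\<^sup>+w. F w \<partial>stiefel_measure)"
proof -
  let ?u0 = "stack e 0 (mat 1) :: real^'k^'n"
  let ?b0 = "stack e (mat 1) 0 :: real^'d^'n"
  let ?Sd = "stiefel_measure :: (real^'m^'d) measure"
  interpret Sd: prob_space ?Sd by (rule prob_space_stiefel_measure[OF md])
  have "(\<integral>\<^sup>+u. \<integral>\<^sup>+x. F (complement_sample u x) \<partial>gauss_family \<partial>(stiefel_measure :: (real^'k^'n) measure))
    = (\<integral>\<^sup>+\<omega>. \<integral>\<^sup>+g. F (g ** (?b0 ** \<omega>)) \<partial>stiefel_measure \<partial>?Sd)"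
    using nn_integral_complement_pair[OF stack_stiefel(1)[OF e] complement_frame_stack[OF e] md
        measurable_compose[OF measurable_snd F]] by simp
  also have "\<dots> = (\<integral>\<^sup>+\<omega>. (\<integral>\<^sup>+w. F w \<partial>stiefel_measure) \<partial>?Sd)"
    by (rule nn_integral_cong, rule nn_integral_orbit[OF stiefel_mult_stiefel[OF stack_stiefel(2)[OF e]] F])
       (simp add: space_stiefel_measure[OF md])
  finally show ?thesis by (simp add: Sd.emeasure_space_1)
qed

text \<open>
  The concatenations of the two frames in either order are orthonormal families, indexed by a sum type.
\<close>
lemma orthogonal_pair_swap:
  fixes u w :: "real^'m^'n"
  assumes u: "u \<in> stiefel" and w: "w \<in> stiefel" and uw: "transpose w ** u = 0"
  shows "\<exists>h. orthogonal_matrix h \<and> h ** u = w \<and> h ** w = u"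
proof -
  have "column i w \<bullet> column j u = (transpose w ** u) $ i $ j" for i j
    by (simp add: matrix_matrix_mult_def transpose_def column_def inner_vec_def)
  then have orth: "column i w \<bullet> column j u = 0" "column j u \<bullet> column i w = 0" for i j
    by (simp_all add: uw inner_commute)
  have on: "orthonormal_on UNIV (case_sum (\<lambda>j. column j u) (\<lambda>j. column j w))"
    "orthonormal_on UNIV (case_sum (\<lambda>j. column j w) (\<lambda>j. column j u))"
    using u w unfolding stiefel_column by (auto simp: orthonormal_on_def orth split: sum.splits)
  obtain h where h: "orthogonal_transformation h"
    and hx: "\<forall>i\<in>UNIV. h (case_sum (\<lambda>j. column j u) (\<lambda>j. column j w) i)
      = case_sum (\<lambda>j. column j w) (\<lambda>j. column j u) i"
    using orthogonal_transformation_orthonormal_on[OF _ on] by auto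
  have hm: "matrix h *v x = h x" for x
    using h by (simp add: matrix_works orthogonal_transformation_def linear_linear)
  have "matrix h *v column j u = column j w" "matrix h *v column j w = column j u" for j
    using hx[rule_format, of "Inl j"] hx[rule_format, of "Inr j"] by (simp_all add: hm)
  then have "matrix h ** u = w" "matrix h ** w = u"
    by (metis (no_types, lifting) matrix_mult_of_columns of_columns_column ext)+
  then show ?thesis using h by (auto simp: orthogonal_transformation_matrix)
qed

text \<open>
  On the side of \<open>nn_integral_complement_pair\<close> that uses rotations, the matrix that exchanges the fixed frames is absorbed by right invariance.
\<close>
lemma nn_integral_complement_swap:
  fixes F :: "(real^'m^'n) \<times> (real^'m^'n) \<Rightarrow> ennreal" and e :: "'d::finite + 'm \<Rightarrow> 'n::finite"
  assumes e: "bij e" and md: "CARD('m) \<le> CARD('d)"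
    and F: "F \<in> borel_measurable (stiefel_space \<Otimes>\<^sub>M stiefel_space)"
  shows "(\<integral>\<^sup>+u. \<integral>\<^sup>+x. F (u, complement_sample u x) \<partial>gauss_family \<partial>stiefel_measure)
    = (\<integral>\<^sup>+u. \<integral>\<^sup>+x. F (complement_sample u x, u) \<partial>gauss_family \<partial>stiefel_measure)"
proof -
  let ?u0 = "stack e 0 (mat 1) :: real^'m^'n"
  let ?b0 = "stack e (mat 1) 0 :: real^'d^'n"
  let ?Sd = "stiefel_measure :: (real^'m^'d) measure"
  let ?H = "stiefel_measure :: (real^'n^'n) measure"
  let ?F' = "\<lambda>z. F (snd z, fst z)"
  have F': "?F' \<in> borel_measurable (stiefel_space \<Otimes>\<^sub>M stiefel_space)"
    using F by (intro measurable_compose[OF measurable_Pair F]) measurable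
  note u0 = stack_stiefel(1)[OF e] and b0 = complement_frame_stack[OF e]
  have "(\<integral>\<^sup>+u. \<integral>\<^sup>+x. F (u, complement_sample u x) \<partial>gauss_family \<partial>stiefel_measure)
     = (\<integral>\<^sup>+\<omega>. \<integral>\<^sup>+g. F (g ** ?u0, g ** (?b0 ** \<omega>)) \<partial>?H \<partial>?Sd)"
    by (rule nn_integral_complement_pair[OF u0 b0 md F])
  also have "\<dots> = (\<integral>\<^sup>+\<omega>. \<integral>\<^sup>+g. F (g ** (?b0 ** \<omega>), g ** ?u0) \<partial>?H \<partial>?Sd)"
  proof (rule nn_integral_cong)
    fix \<omega> assume "\<omega> \<in> space ?Sd"
    then have \<omega>: "\<omega> \<in> stiefel" by (simp add: space_stiefel_measure[OF md])
    have w: "?b0 ** \<omega> \<in> stiefel" by (rule stiefel_mult_stiefel[OF stack_stiefel(2)[OF e] \<omega>])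
    have "transpose (?b0 ** \<omega>) ** ?u0 = transpose \<omega> ** (transpose ?b0 ** ?u0)"
      by (simp add: matrix_transpose_mul matrix_mul_assoc)
    also have "\<dots> = 0" by (simp add: complement_frame_orthogonal[OF b0 u0])
    finally obtain h where h: "orthogonal_matrix h" "h ** ?u0 = ?b0 ** \<omega>" "h ** (?b0 ** \<omega>) = ?u0"
      using orthogonal_pair_swap[OF u0 w] by blast
    have hs: "h \<in> stiefel" using h(1) by (simp add: orthogonal_matrix_stiefel)
    have m: "(\<lambda>g. F (g ** ?u0, g ** (?b0 ** \<omega>))) \<in> borel_measurable (stiefel_space :: (real^'n^'n) measure)"
      by (intro measurable_compose[OF measurable_Pair F] orbit_measurable u0 w)
    have "(\<integral>\<^sup>+g. F (g ** ?u0, g ** (?b0 ** \<omega>)) \<partial>?H)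
        = (\<integral>\<^sup>+g. F ((g ** h) ** ?u0, (g ** h) ** (?b0 ** \<omega>)) \<partial>?H)"
      by (rule nn_integral_orbit[OF hs m, symmetric])
    also have "\<dots> = (\<integral>\<^sup>+g. F (g ** (?b0 ** \<omega>), g ** ?u0) \<partial>?H)"
      by (simp only: matrix_mul_assoc[symmetric] h(2)) (simp only: h(2,3))
    finally show "(\<integral>\<^sup>+g. F (g ** ?u0, g ** (?b0 ** \<omega>)) \<partial>?H) = (\<integral>\<^sup>+g. F (g ** (?b0 ** \<omega>), g ** ?u0) \<partial>?H)" .
  qed
  also have "\<dots> = (\<integral>\<^sup>+u. \<integral>\<^sup>+x. F (complement_sample u x, u) \<partial>gauss_family \<partial>stiefel_measure)"
    using nn_integral_complement_pair[OF u0 b0 md F'] by simp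
  finally show ?thesis .
qed

section \<open>The composition formulas\<close>

text \<open>
  For orthonormal \<open>u\<close> and \<open>v\<close> this is the Gram determinant of the projections of the columns of \<open>v\<close>
  to the orthogonal complement of \<open>u\<close>.
\<close>
definition sin_kernel :: "real^'k^'n \<Rightarrow> real^'m^'n \<Rightarrow> real" where
  "sin_kernel u v = det (mat 1 - transpose v ** u ** transpose u ** v)"

lemma complement_frame_sin_kernel:
  assumes b: "complement_frame u b" and v: "v \<in> stiefel"
  shows "det (transpose (transpose b ** v) ** (transpose b ** v)) = sin_kernel u v"
proof -
  have "transpose (transpose b ** v) ** (transpose b ** v) = transpose v ** (b ** transpose b) ** v"
    by (simp add: matrix_transpose_mul matrix_mul_assoc)
  also have "\<dots> = transpose v ** v - transpose v ** u ** transpose u ** v"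
    using b by (simp add: complement_frame_def matrix_sub_ldistrib matrix_sub_rdistrib matrix_mul_assoc)
  finally show ?thesis using v by (simp add: sin_kernel_def stiefel_def)
qed

lemma cos_kernel_frame: "cos_kernel v (b ** \<omega>) = cos_kernel (transpose b ** v) \<omega>"
  by (metis cos_kernel_commute cos_kernel_mult)

lemma nn_integral_complement_cos_kernel:
  fixes u :: "real^'k^'n" and v :: "real^'m^'n" and b :: "real^'d^'n"
  assumes b: "complement_frame u b" and md: "CARD('m) \<le> CARD('d)" and v: "v \<in> stiefel" and p: "p > - 1 / 2"
  shows "(\<integral>\<^sup>+x. ennreal (\<bar>cos_kernel v (complement_sample u x)\<bar> powr p) \<partial>gauss_family)
    = ennreal (\<bar>sin_kernel u v\<bar> powr p * cos_mean CARD('d) CARD('m) p)"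
proof -
  have "(\<integral>\<^sup>+x. ennreal (\<bar>cos_kernel v (complement_sample u x)\<bar> powr p) \<partial>gauss_family)
    = (\<integral>\<^sup>+\<omega>. ennreal (\<bar>cos_kernel v (b ** \<omega>)\<bar> powr p) \<partial>(stiefel_measure :: (real^'m^'d) measure))"
    by (rule nn_integral_complement_frame[OF b md]) measurable
  then show ?thesis
    unfolding cos_kernel_frame nn_integral_cos_kernel[OF md p] complement_frame_sin_kernel[OF b v] .
qed

lemma integral_complement_cos_kernel:
  fixes u :: "real^'k^'n" and v :: "real^'m^'n" and b :: "real^'d^'n"
  assumes b: "complement_frame u b" and md: "CARD('m) \<le> CARD('d)" and v: "v \<in> stiefel" and p: "Re p > - 1 / 2"
  shows "(\<integral>x. complex_of_real \<bar>cos_kernel v (complement_sample u x)\<bar> powr p \<partial>gauss_family)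
    = complex_of_real \<bar>sin_kernel u v\<bar> powr p * cos_mean_complex CARD('d) CARD('m) p"
proof -
  have "(\<integral>x. complex_of_real \<bar>cos_kernel v (complement_sample u x)\<bar> powr p \<partial>gauss_family)
    = (\<integral>\<omega>. complex_of_real \<bar>cos_kernel v (b ** \<omega>)\<bar> powr p \<partial>(stiefel_measure :: (real^'m^'d) measure))"
    by (rule integral_complement_frame[OF b md]) measurable
  then show ?thesis
    unfolding cos_kernel_frame integral_cos_kernel[OF md p] complement_frame_sin_kernel[OF b v] .
qed

lemma complement_frame_exists:
  fixes e :: "'d::finite + 'k::finite \<Rightarrow> 'n::finite" and u :: "real^'k^'n"
  assumes "bij e" "u \<in> stiefel"
  shows "\<exists>b :: real^'d^'n. complement_frame u b"
  using funk_complement_frame[OF assms, where 'm='k] by blast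

text \<open>
  The mean of the power \<open>0\<close> is the probability that the kernel does not vanish.
\<close>
lemma AE_cos_kernel_nonzero:
  fixes u :: "real^'m^'n"
  assumes u: "u \<in> stiefel"
  shows "AE w in stiefel_measure. cos_kernel u w \<noteq> 0"
proof -
  note mn = stiefel_card[OF u]
  let ?S = "stiefel_measure :: (real^'m^'n) measure"
  interpret S: prob_space ?S by (rule prob_space_stiefel_measure[OF mn])
  have [measurable]: "(\<lambda>w. cos_kernel u w) \<in> borel_measurable ?S"
    by (rule measurable_stiefel_measure_borel[OF mn]) measurable
  have "(\<Prod>l<CARD('m). chi_moment (n + 1 + l) 0) = 1" for n
    by (intro prod.neutral) (simp add: chi_moment_0)
  then have "cos_mean CARD('n) CARD('m) 0 = 1"
    by (simp only: cos_mean_def) (metis add.commute add_0 div_by_1)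
  moreover have "det (transpose u ** u) = 1" using u by (simp add: stiefel_def)
  ultimately have "(\<integral>\<^sup>+w. ennreal (\<bar>cos_kernel u w\<bar> powr 0) \<partial>?S) = 1"
    by (subst nn_integral_cos_kernel[OF mn]) simp_all
  also have "(\<integral>\<^sup>+w. ennreal (\<bar>cos_kernel u w\<bar> powr 0) \<partial>?S)
      = (\<integral>\<^sup>+w. indicator {w \<in> space ?S. cos_kernel u w \<noteq> 0} w \<partial>?S)"
    by (intro nn_integral_cong) (auto simp: indicator_def)
  finally have "S.prob {w \<in> space ?S. cos_kernel u w \<noteq> 0} = 1"
    by (simp add: S.emeasure_eq_measure)
  then show ?thesis
    by (subst (asm) S.prob_Collect_eq_1) simp_all
qed

text \<open>
  With \<open>a = u' w\<close> the two matrices are \<open>1 - a a'\<close> and \<open>1 - a' a\<close>, and \<open>a\<close> conjugates one to the other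
  when it is invertible.
\<close>
lemma sin_kernel_commute:
  fixes u w :: "real^'m^'n"
  assumes "cos_kernel u w \<noteq> 0"
  shows "sin_kernel w u = sin_kernel u w"
proof -
  define a where "a = transpose u ** w"
  have "a ** (mat 1 - transpose a ** a) = (mat 1 - a ** transpose a) ** a"
    by (simp add: matrix_sub_ldistrib matrix_sub_rdistrib matrix_mul_assoc)
  then have "det a * det (mat 1 - transpose a ** a) = det (mat 1 - a ** transpose a) * det a"
    by (metis det_mul)
  moreover have "det a \<noteq> 0" using assms by (simp add: cos_kernel_eq a_def)
  ultimately have "det (mat 1 - transpose a ** a) = det (mat 1 - a ** transpose a)" by simp
  then show ?thesis
    by (simp add: sin_kernel_def a_def matrix_transpose_mul matrix_mul_assoc)
qed

lemma
  assumes "sets M = sets stiefel_space"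
  shows measurable_fst_stiefel: "fst \<in> borel_measurable (M \<Otimes>\<^sub>M N)"
    and measurable_snd_stiefel: "snd \<in> borel_measurable (N \<Otimes>\<^sub>M M)"
proof -
  have "(\<lambda>x. x) \<in> borel_measurable M"
    using measurable_stiefel_space_borel assms by (simp cong: measurable_cong_sets)
  then show "fst \<in> borel_measurable (M \<Otimes>\<^sub>M N)" "snd \<in> borel_measurable (N \<Otimes>\<^sub>M M)"
    by (auto intro: measurable_compose[OF measurable_fst] measurable_compose[OF measurable_snd])
qed

lemma borel_measurable_sin_kernel [measurable (raw)]:
  fixes u :: "'w \<Rightarrow> real^'k^'n" and v :: "'w \<Rightarrow> real^'m^'n"
  assumes [measurable]: "u \<in> borel_measurable M" "v \<in> borel_measurable M"
  shows "(\<lambda>x. sin_kernel (u x) (v x)) \<in> borel_measurable M"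
proof -
  have [measurable]: "(\<lambda>x. mat 1 - transpose (v x) ** u x ** transpose (u x) ** v x) \<in> borel_measurable M"
    by (intro borel_measurable_diff) measurable
  show ?thesis unfolding sin_kernel_def by measurable
qed

lemma cosine_transform_eq:
  fixes f :: "real^'m^'n \<Rightarrow> complex"
  assumes "p = (\<alpha> - of_nat CARD('m)) / 2"
  shows "cosine_transform \<alpha> f u = (\<integral>v. f v * of_real \<bar>cos_kernel v u\<bar> powr p \<partial>stiefel_measure)"
  by (simp add: cosine_transform_def cos_kernel_def assms)

text \<open>
  A uniform frame orthogonal to a uniform frame is itself uniform.
\<close>
lemma integrable_funk:
  fixes f :: "real^'m^'n \<Rightarrow> complex" and e :: "'d::finite + 'k::finite \<Rightarrow> 'n::finite"
  assumes e: "bij e" and md: "CARD('m) \<le> CARD('d)" and f: "integrable stiefel_measure f"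
  shows "integrable (stiefel_measure :: (real^'k^'n) measure) (funk e f)"
proof -
  let ?S = "stiefel_measure :: (real^'k^'n) measure"
  let ?G = "gauss_family :: ('m \<Rightarrow> real^'n) measure"
  have kn: "CARD('k) \<le> CARD('n)" by (rule stiefel_card[OF stack_stiefel(1)[OF e]])
  have mn: "CARD('m) \<le> CARD('n)" using md stiefel_card[OF stack_stiefel(2)[OF e]] by simp
  interpret S: prob_space ?S by (rule prob_space_stiefel_measure[OF kn])
  interpret G: prob_space ?G by (rule prob_space_gauss_family)
  interpret pair_sigma_finite ?S ?G ..
  have fm: "f \<in> borel_measurable stiefel_space"
    using borel_measurable_integrable[OF f] by (simp cong: measurable_cong_sets add: sets_stiefel_measure[OF mn])
  have "integrable (?S \<Otimes>\<^sub>M ?G) (\<lambda>z. f (complement_sample (fst z) (snd z)))"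
  proof (rule integrableI_bounded)
    have m: "(\<lambda>z. f (complement_sample (fst z) (snd z))) \<in> borel_measurable (?S \<Otimes>\<^sub>M ?G)"
      by (rule measurable_compose[OF measurable_complement_sample_pair[OF kn mn] fm])
    then show "(\<lambda>z. f (complement_sample (fst z) (snd z))) \<in> borel_measurable (?S \<Otimes>\<^sub>M ?G)" .
    let ?I = "(\<integral>\<^sup>+z. ennreal (norm (f (complement_sample (fst z) (snd z)))) \<partial>(?S \<Otimes>\<^sub>M ?G))"
    have "?I
        = (\<integral>\<^sup>+u. \<integral>\<^sup>+x. ennreal (norm (f (complement_sample u x))) \<partial>?G \<partial>?S)"
      using m by (subst G.nn_integral_fst[symmetric]) simp_all
    also have "\<dots> = (\<integral>\<^sup>+w. ennreal (norm (f w)) \<partial>stiefel_measure)"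
      by (rule nn_integral_complement_marginal[OF e md]) (use fm in measurable)
    also have "\<dots> < \<infinity>" using f by (simp add: integrable_iff_bounded)
    finally show "?I < \<infinity>" .
  qed
  then have "integrable ?S (\<lambda>u. \<integral>x. f (complement_sample u x) \<partial>?G)"
    using integrable_fst'[of "\<lambda>z. f (complement_sample (fst z) (snd z))"] by simp
  then show ?thesis
    by (rule Bochner_Integration.integrable_cong[THEN iffD1, OF refl, rotated])
       (simp add: space_stiefel_measure[OF kn] funk_eq_complement_sample[OF e _ md fm])
qed

lemma integrable_cosine_transform:
  fixes f :: "real^'m^'n \<Rightarrow> complex"
  assumes mn: "CARD('m) \<le> CARD('n)" and f: "integrable stiefel_measure f"
    and \<alpha>: "Re \<alpha> > real CARD('m) - 1"
  shows "integrable stiefel_measure (cosine_transform \<alpha> f)"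
proof -
  let ?S = "stiefel_measure :: (real^'m^'n) measure"
  define p where "p = (\<alpha> - of_nat CARD('m)) / 2"
  have p: "Re p > - 1 / 2" using \<alpha> by (simp add: p_def)
  interpret S: prob_space ?S by (rule prob_space_stiefel_measure[OF mn])
  interpret pair_sigma_finite ?S ?S ..
  note [measurable] = measurable_fst_stiefel[OF sets_stiefel_measure[OF mn]]
    measurable_snd_stiefel[OF sets_stiefel_measure[OF mn]]
  note fm [measurable] = borel_measurable_integrable[OF f]
  have m [measurable]: "(\<lambda>(u, v). f v * of_real \<bar>cos_kernel v u\<bar> powr p) \<in> borel_measurable (?S \<Otimes>\<^sub>M ?S)"
    unfolding split_def by measurable
  have "integrable (?S \<Otimes>\<^sub>M ?S) (\<lambda>(u, v). f v * of_real \<bar>cos_kernel v u\<bar> powr p)"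
  proof (rule integrableI_bounded[OF m])
    let ?I = "(\<integral>\<^sup>+z. ennreal (norm (case z of (u, v) \<Rightarrow> f v * of_real \<bar>cos_kernel v u\<bar> powr p)) \<partial>(?S \<Otimes>\<^sub>M ?S))"
    have "?I
       = (\<integral>\<^sup>+v. \<integral>\<^sup>+u. ennreal (norm (f v * of_real \<bar>cos_kernel v u\<bar> powr p)) \<partial>?S \<partial>?S)"
      by (subst nn_integral_snd[symmetric]) (use m in \<open>simp_all add: split_def\<close>)
    also have "\<dots> = (\<integral>\<^sup>+v. ennreal (norm (f v)) * ennreal (cos_mean CARD('n) CARD('m) (Re p)) \<partial>?S)"
    proof (rule nn_integral_cong)
      fix v assume "v \<in> space ?S"
      then have "transpose v ** v = mat 1" by (simp add: space_stiefel_measure[OF mn] stiefel_def)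
      moreover have "(\<lambda>u. ennreal (\<bar>cos_kernel v u\<bar> powr Re p)) \<in> borel_measurable ?S"
        by (rule measurable_stiefel_measure_borel[OF mn]) measurable
      ultimately show "(\<integral>\<^sup>+u. ennreal (norm (f v * of_real \<bar>cos_kernel v u\<bar> powr p)) \<partial>?S)
          = ennreal (norm (f v)) * ennreal (cos_mean CARD('n) CARD('m) (Re p))"
        by (simp add: norm_mult norm_of_real_abs_powr ennreal_mult' nn_integral_cmult
            nn_integral_cos_kernel[OF mn p])
    qed
    also have "\<dots> < \<infinity>"
      using f by (simp add: nn_integral_multc integrable_iff_bounded ennreal_mult_less_top)
    finally show "?I < \<infinity>" .
  qed
  from integrable_fst'[OF this] show ?thesis
    unfolding cosine_transform_eq[OF p_def, abs_def] by simp
qed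

text \<open>
  The power of the sine kernel is, up to a constant, the conditional mean of the power of the cosine kernel given
  \<open>u\<close>, and the unconditional mean is known.
\<close>
lemma nn_integral_sin_kernel:
  fixes v :: "real^'m^'n" and e :: "'d::finite + 'k::finite \<Rightarrow> 'n::finite"
  assumes e: "bij e" and md: "CARD('m) \<le> CARD('d)" and v: "v \<in> stiefel" and p: "p > - 1 / 2"
  shows "(\<integral>\<^sup>+u. ennreal (\<bar>sin_kernel u v\<bar> powr p) \<partial>(stiefel_measure :: (real^'k^'n) measure))
    * ennreal (cos_mean CARD('d) CARD('m) p) = ennreal (cos_mean CARD('n) CARD('m) p)"
proof -
  let ?S = "stiefel_measure :: (real^'k^'n) measure"
  have kn: "CARD('k) \<le> CARD('n)" by (rule stiefel_card[OF stack_stiefel(1)[OF e]])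
  have mn: "CARD('m) \<le> CARD('n)" by (rule stiefel_card[OF v])
  have m: "(\<lambda>u. ennreal (\<bar>sin_kernel u v\<bar> powr p)) \<in> borel_measurable ?S"
    by (rule measurable_stiefel_measure_borel[OF kn]) measurable
  have "(\<integral>\<^sup>+u. ennreal (\<bar>sin_kernel u v\<bar> powr p) \<partial>?S) * ennreal (cos_mean CARD('d) CARD('m) p)
    = (\<integral>\<^sup>+u. \<integral>\<^sup>+x. ennreal (\<bar>cos_kernel v (complement_sample u x)\<bar> powr p) \<partial>gauss_family \<partial>?S)"
    unfolding nn_integral_multc[OF m, symmetric]
  proof (rule nn_integral_cong)
    fix u assume "u \<in> space ?S"
    then obtain b :: "real^'d^'n" where "complement_frame u b"
      using complement_frame_exists[OF e] by (auto simp: space_stiefel_measure[OF kn])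
    from nn_integral_complement_cos_kernel[OF this md v p]
    show "ennreal (\<bar>sin_kernel u v\<bar> powr p) * ennreal (cos_mean CARD('d) CARD('m) p)
      = (\<integral>\<^sup>+x. ennreal (\<bar>cos_kernel v (complement_sample u x)\<bar> powr p) \<partial>gauss_family)"
      by (simp add: ennreal_mult')
  qed
  also have "\<dots> = (\<integral>\<^sup>+w. ennreal (\<bar>cos_kernel v w\<bar> powr p) \<partial>stiefel_measure)"
    by (rule nn_integral_complement_marginal[OF e md]) measurable
  also have "\<dots> = ennreal (cos_mean CARD('n) CARD('m) p)"
    using v by (simp add: nn_integral_cos_kernel[OF mn p] stiefel_def)
  finally show ?thesis .
qed

text \<open>
  This gives the absolute convergence of the sine transform for almost every \<open>u\<close>, also for negative exponents.
\<close>
lemma integrable_sin_kernel_pair: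
  fixes f :: "real^'m^'n \<Rightarrow> complex" and e :: "'d::finite + 'k::finite \<Rightarrow> 'n::finite"
  assumes e: "bij e" and md: "CARD('m) \<le> CARD('d)" and f: "integrable stiefel_measure f" and p: "Re p > - 1 / 2"
  shows "integrable ((stiefel_measure :: (real^'k^'n) measure) \<Otimes>\<^sub>M stiefel_measure)
    (\<lambda>(u, v). f v * of_real \<bar>sin_kernel u v\<bar> powr p)"
proof -
  let ?K = "stiefel_measure :: (real^'k^'n) measure"
  let ?S = "stiefel_measure :: (real^'m^'n) measure"
  have kn: "CARD('k) \<le> CARD('n)" by (rule stiefel_card[OF stack_stiefel(1)[OF e]])
  have mn: "CARD('m) \<le> CARD('n)" using md stiefel_card[OF stack_stiefel(2)[OF e]] by simp
  interpret S: prob_space ?S by (rule prob_space_stiefel_measure[OF mn])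
  interpret K: prob_space ?K by (rule prob_space_stiefel_measure[OF kn])
  interpret pair_sigma_finite ?K ?S ..
  note [measurable] = measurable_fst_stiefel[OF sets_stiefel_measure[OF kn]]
    measurable_snd_stiefel[OF sets_stiefel_measure[OF mn]]
  note fm [measurable] = borel_measurable_integrable[OF f]
  let ?c = "cos_mean CARD('d) CARD('m) (Re p)"
  \<comment> \<open>the value of the mean over \<open>u\<close> in \<open>nn_integral_sin_kernel\<close>\<close>
  define C where "C = ennreal (cos_mean CARD('n) CARD('m) (Re p) / ?c)"
  have c: "?c > 0" by (rule cos_mean_pos[OF p])
  have m [measurable]: "(\<lambda>(u, v). f v * of_real \<bar>sin_kernel u v\<bar> powr p) \<in> borel_measurable (?K \<Otimes>\<^sub>M ?S)"
    unfolding split_def by measurable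
  show ?thesis
  proof (rule integrableI_bounded[OF m])
    let ?I = "(\<integral>\<^sup>+z. ennreal (norm (case z of (u, v) \<Rightarrow> f v * of_real \<bar>sin_kernel u v\<bar> powr p)) \<partial>(?K \<Otimes>\<^sub>M ?S))"
    have "?I
       = (\<integral>\<^sup>+v. \<integral>\<^sup>+u. ennreal (norm (f v * of_real \<bar>sin_kernel u v\<bar> powr p)) \<partial>?K \<partial>?S)"
      by (subst nn_integral_snd[symmetric]) (use m in \<open>simp_all add: split_def\<close>)
    also have "\<dots> = (\<integral>\<^sup>+v. ennreal (norm (f v)) * C \<partial>?S)"
    proof (rule nn_integral_cong)
      fix v assume "v \<in> space ?S"
      then have v: "v \<in> stiefel" by (simp add: space_stiefel_measure[OF mn])
      define I where "I = (\<integral>\<^sup>+u. ennreal (\<bar>sin_kernel u v\<bar> powr Re p) \<partial>?K)"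
      have "I = I * ennreal ?c * ennreal (1 / ?c)"
        using c by (simp add: mult.assoc flip: ennreal_mult'')
      also have "\<dots> = C"
        unfolding I_def nn_integral_sin_kernel[OF e md v p] C_def using c by (simp flip: ennreal_mult'')
      finally have "I = C" .
      moreover have "(\<lambda>u. ennreal (\<bar>sin_kernel u v\<bar> powr Re p)) \<in> borel_measurable ?K"
        by (rule measurable_stiefel_measure_borel[OF kn]) measurable
      ultimately show "(\<integral>\<^sup>+u. ennreal (norm (f v * of_real \<bar>sin_kernel u v\<bar> powr p)) \<partial>?K)
          = ennreal (norm (f v)) * C"
        by (simp add: norm_mult norm_of_real_abs_powr ennreal_mult' nn_integral_cmult I_def)
    qed
    also have "\<dots> < \<infinity>"
      using f by (simp add: nn_integral_multc integrable_iff_bounded ennreal_mult_less_top C_def)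
    finally show "?I < \<infinity>" .
  qed
qed

lemma funk_cosine_transform:
  fixes f :: "real^'m^'n \<Rightarrow> complex" and e :: "'d::finite + 'k::finite \<Rightarrow> 'n::finite" and u :: "real^'k^'n"
  assumes e: "bij e" and md: "CARD('m) \<le> CARD('d)" and f: "integrable stiefel_measure f"
    and \<alpha>: "Re \<alpha> > real CARD('m) - 1" and p_def: "p = (\<alpha> - of_nat CARD('m)) / 2"
    and u: "u \<in> stiefel"
    and int: "integrable stiefel_measure (\<lambda>v. f v * of_real \<bar>sin_kernel u v\<bar> powr p)"
  shows "funk e (cosine_transform \<alpha> f) u
    = cos_mean_complex CARD('d) CARD('m) p * (\<integral>v. f v * of_real \<bar>sin_kernel u v\<bar> powr p \<partial>stiefel_measure)"
proof -
  let ?S = "stiefel_measure :: (real^'m^'n) measure"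
  let ?C = "ennreal (cos_mean CARD('d) CARD('m) (Re p))"
  let ?G = "gauss_family :: ('m \<Rightarrow> real^'n) measure"
  have mn: "CARD('m) \<le> CARD('n)" using md stiefel_card[OF stack_stiefel(2)[OF e]] by simp
  have p: "Re p > - 1 / 2" using \<alpha> by (simp add: p_def)
  interpret S: prob_space ?S by (rule prob_space_stiefel_measure[OF mn])
  interpret G: prob_space ?G by (rule prob_space_gauss_family)
  interpret pair_sigma_finite ?G ?S ..
  obtain b :: "real^'d^'n" where b: "complement_frame u b"
    using complement_frame_exists[OF e u] by blast
  have cm: "cosine_transform \<alpha> f \<in> borel_measurable stiefel_space"
    using borel_measurable_integrable[OF integrable_cosine_transform[OF mn f \<alpha>]]
    by (simp cong: measurable_cong_sets add: sets_stiefel_measure[OF mn])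
  note [measurable] = measurable_snd_stiefel[OF sets_stiefel_measure[OF mn]]
  note fm [measurable] = borel_measurable_integrable[OF f]
  have [measurable]: "(\<lambda>z. complement_sample u (fst z)) \<in> borel_measurable (?G \<Otimes>\<^sub>M ?S)"
    by (rule borel_measurable_complement_sample)
       (auto intro: measurable_compose[OF measurable_fst measurable_gauss_family])
  let ?F = "\<lambda>x v. f v * of_real \<bar>cos_kernel v (complement_sample u x)\<bar> powr p"
  have Gm: "(\<lambda>x. cos_kernel v (complement_sample u x)) \<in> borel_measurable ?G" for v
    by (intro borel_measurable_cos_kernel borel_measurable_complement_sample) measurable
  have m [measurable]: "(\<lambda>(x, v). ?F x v) \<in> borel_measurable (?G \<Otimes>\<^sub>M ?S)"
    unfolding split_def by measurable
  have intF: "integrable (?G \<Otimes>\<^sub>M ?S) (\<lambda>(x, v). ?F x v)"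
  proof (rule integrableI_bounded[OF m])
    let ?I = "(\<integral>\<^sup>+z. ennreal (norm (case z of (x, v) \<Rightarrow> ?F x v)) \<partial>(?G \<Otimes>\<^sub>M ?S))"
    have "?I
       = (\<integral>\<^sup>+v. \<integral>\<^sup>+x. ennreal (norm (?F x v)) \<partial>?G \<partial>?S)"
      by (subst nn_integral_snd[symmetric]) (use m in \<open>simp_all add: split_def\<close>)
    also have "\<dots> = (\<integral>\<^sup>+v. ennreal (norm (f v * of_real \<bar>sin_kernel u v\<bar> powr p)) * ?C \<partial>?S)"
    proof (rule nn_integral_cong)
      fix v assume "v \<in> space ?S"
      then have v: "v \<in> stiefel" by (simp add: space_stiefel_measure[OF mn])
      have "(\<lambda>x. ennreal (\<bar>cos_kernel v (complement_sample u x)\<bar> powr Re p)) \<in> borel_measurable ?G"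
        using Gm[of v] by measurable
      then show "(\<integral>\<^sup>+x. ennreal (norm (?F x v)) \<partial>?G)
        = ennreal (norm (f v * of_real \<bar>sin_kernel u v\<bar> powr p)) * ?C"
        by (simp add: norm_mult norm_of_real_abs_powr ennreal_mult' nn_integral_cmult mult.assoc
            nn_integral_complement_cos_kernel[OF b md v p])
    qed
    also have "\<dots> < \<infinity>"
    proof -
      have "(\<lambda>v. ennreal (norm (f v * of_real \<bar>sin_kernel u v\<bar> powr p))) \<in> borel_measurable ?S"
        using borel_measurable_integrable[OF int] by measurable
      from nn_integral_multc[OF this] show ?thesis
        using int by (simp add: integrable_iff_bounded ennreal_mult_less_top)
    qed
    finally show "?I < \<infinity>" .
  qed
  have "funk e (cosine_transform \<alpha> f) u = (\<integral>x. \<integral>v. ?F x v \<partial>?S \<partial>?G)"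
    by (simp add: funk_eq_complement_sample[OF e u md cm] cosine_transform_eq[OF p_def])
  also have "\<dots> = (\<integral>v. \<integral>x. ?F x v \<partial>?G \<partial>?S)"
    by (rule Fubini_integral[OF intF, symmetric])
  also have "\<dots> = (\<integral>v. cos_mean_complex CARD('d) CARD('m) p * (f v * of_real \<bar>sin_kernel u v\<bar> powr p) \<partial>?S)"
    by (rule Bochner_Integration.integral_cong[OF refl])
       (simp add: space_stiefel_measure[OF mn] integral_complement_cos_kernel[OF b md _ p])
  finally show ?thesis by simp
qed

lemma distr_complement_pair_swap:
  fixes e :: "'d::finite + 'm::finite \<Rightarrow> 'n::finite"
  assumes e: "bij e" and md: "CARD('m) \<le> CARD('d)"
  defines "P \<equiv> (stiefel_measure :: (real^'m^'n) measure) \<Otimes>\<^sub>M (gauss_family :: ('m \<Rightarrow> real^'n) measure)"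
  shows "distr P (stiefel_space \<Otimes>\<^sub>M stiefel_space) (\<lambda>z. (fst z, complement_sample (fst z) (snd z)))
    = distr P (stiefel_space \<Otimes>\<^sub>M stiefel_space) (\<lambda>z. (complement_sample (fst z) (snd z), fst z))"
    (is "distr P ?V ?X = distr P ?V ?Y")
proof (rule measure_eqI)
  let ?S = "stiefel_measure :: (real^'m^'n) measure"
  let ?G = "gauss_family :: ('m \<Rightarrow> real^'n) measure"
  have mn: "CARD('m) \<le> CARD('n)" by (rule stiefel_card[OF stack_stiefel(1)[OF e]])
  interpret G: prob_space ?G by (rule prob_space_gauss_family)
  have f: "fst \<in> measurable P stiefel_space"
    unfolding P_def using measurable_fst[of ?S ?G] by (simp cong: measurable_cong_sets add: sets_stiefel_measure[OF mn])
  have c: "(\<lambda>z. complement_sample (fst z) (snd z)) \<in> measurable P stiefel_space"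
    unfolding P_def by (rule measurable_complement_sample_pair[OF mn mn])
  have X: "?X \<in> measurable P ?V" and Y: "?Y \<in> measurable P ?V"
    using f c by (auto intro: measurable_Pair)
  fix A assume "A \<in> sets (distr P ?V ?X)"
  then have A: "A \<in> sets ?V" by simp
  then have iA: "(indicator A :: _ \<Rightarrow> ennreal) \<in> borel_measurable ?V" by measurable
  have "emeasure (distr P ?V ?X) A = (\<integral>\<^sup>+z. indicator A (?X z) \<partial>P)"
    using nn_integral_distr_measurable[OF X iA] A by simp
  also have "\<dots> = (\<integral>\<^sup>+u. \<integral>\<^sup>+x. indicator A (u, complement_sample u x) \<partial>?G \<partial>?S)"
    using measurable_compose[OF X iA] unfolding P_def by (subst G.nn_integral_fst[symmetric]) simp_all
  also have "\<dots> = (\<integral>\<^sup>+u. \<integral>\<^sup>+x. indicator A (complement_sample u x, u) \<partial>?G \<partial>?S)"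
    by (rule nn_integral_complement_swap[OF e md iA])
  also have "\<dots> = (\<integral>\<^sup>+z. indicator A (?Y z) \<partial>P)"
    using measurable_compose[OF Y iA] unfolding P_def by (subst G.nn_integral_fst[symmetric]) simp_all
  also have "\<dots> = emeasure (distr P ?V ?Y) A"
    using nn_integral_distr_measurable[OF Y iA] A by simp
  finally show "emeasure (distr P ?V ?X) A = emeasure (distr P ?V ?Y) A" .
qed simp

text \<open>
  The symmetric law of orthogonal pairs moves the cosine kernel to the frame that is averaged.  This produces the
  sine kernel with its arguments exchanged, which agrees with the original one almost everywhere.
\<close>
lemma cosine_transform_funk:
  fixes f :: "real^'m^'n \<Rightarrow> complex" and e :: "'d::finite + 'm::finite \<Rightarrow> 'n::finite" and u :: "real^'m^'n"
  assumes e: "bij e" and md: "CARD('m) \<le> CARD('d)" and f: "integrable stiefel_measure f"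
    and \<alpha>: "Re \<alpha> > real CARD('m) - 1" and p_def: "p = (\<alpha> - of_nat CARD('m)) / 2"
    and u: "u \<in> stiefel"
    and int: "integrable stiefel_measure (\<lambda>v. f v * of_real \<bar>sin_kernel u v\<bar> powr p)"
  shows "cosine_transform \<alpha> (funk e f) u
    = cos_mean_complex CARD('d) CARD('m) p * (\<integral>v. f v * of_real \<bar>sin_kernel u v\<bar> powr p \<partial>stiefel_measure)"
proof -
  let ?S = "stiefel_measure :: (real^'m^'n) measure"
  let ?C = "ennreal (cos_mean CARD('d) CARD('m) (Re p))"
  let ?G = "gauss_family :: ('m \<Rightarrow> real^'n) measure"
  let ?V = "(stiefel_space :: (real^'m^'n) measure) \<Otimes>\<^sub>M (stiefel_space :: (real^'m^'n) measure)"
  have mn: "CARD('m) \<le> CARD('n)" by (rule stiefel_card[OF u])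
  have p: "Re p > - 1 / 2" using \<alpha> by (simp add: p_def)
  interpret S: prob_space ?S by (rule prob_space_stiefel_measure[OF mn])
  interpret G: prob_space ?G by (rule prob_space_gauss_family)
  interpret pair_sigma_finite ?S ?G ..
  have fm: "f \<in> borel_measurable stiefel_space"
    using borel_measurable_integrable[OF f] by (simp cong: measurable_cong_sets add: sets_stiefel_measure[OF mn])
  let ?X = "\<lambda>z. (fst z, complement_sample (fst z) (snd z)) :: (real^'m^'n) \<times> (real^'m^'n)"
  let ?Y = "\<lambda>z. (complement_sample (fst z) (snd z), fst z) :: (real^'m^'n) \<times> (real^'m^'n)"
  have fst: "fst \<in> measurable (?S \<Otimes>\<^sub>M ?G) stiefel_space"
    using measurable_fst[of ?S ?G] by (simp cong: measurable_cong_sets add: sets_stiefel_measure[OF mn])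
  have X: "?X \<in> measurable (?S \<Otimes>\<^sub>M ?G) ?V" and Y: "?Y \<in> measurable (?S \<Otimes>\<^sub>M ?G) ?V"
    using fst measurable_complement_sample_pair[where 'm='m and 'k='m and 'n='n, OF mn mn] by (auto intro: measurable_Pair)
  note swap = distr_complement_pair_swap[OF e md]
  let ?\<phi> = "\<lambda>z. f (snd z) * of_real \<bar>cos_kernel (fst z) u\<bar> powr p"
  have \<phi>: "?\<phi> \<in> borel_measurable ?V"
  proof -
    have [measurable]: "fst \<in> borel_measurable ?V" by (rule measurable_fst_stiefel) simp
    have [measurable]: "(\<lambda>z. f (snd z)) \<in> borel_measurable ?V" by (rule measurable_compose[OF measurable_snd fm])
    show ?thesis by measurable
  qed
  let ?c = "cos_mean_complex CARD('d) CARD('m) p"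
  have sc: "AE w in ?S. sin_kernel w u = sin_kernel u w"
    using AE_cos_kernel_nonzero[OF u] by eventually_elim (rule sin_kernel_commute)
  have frame: "\<exists>b :: real^'d^'n. complement_frame w b" if "w \<in> stiefel" for w :: "real^'m^'n"
    using complement_frame_exists[OF e that] .
  have Gm: "(\<lambda>x. cos_kernel (complement_sample w x) u) \<in> borel_measurable ?G" for w :: "real^'m^'n"
    by (intro borel_measurable_cos_kernel borel_measurable_complement_sample) measurable
  have intY: "integrable (?S \<Otimes>\<^sub>M ?G) (\<lambda>z. ?\<phi> (?Y z))"
  proof (rule integrableI_bounded[OF measurable_compose[OF Y \<phi>]])
    let ?I = "(\<integral>\<^sup>+z. ennreal (norm (?\<phi> (?Y z))) \<partial>(?S \<Otimes>\<^sub>M ?G))"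
    have "?I
       = (\<integral>\<^sup>+w. \<integral>\<^sup>+x. ennreal (norm (f w * of_real \<bar>cos_kernel (complement_sample w x) u\<bar> powr p)) \<partial>?G \<partial>?S)"
      using measurable_compose[OF Y \<phi>] by (subst G.nn_integral_fst[symmetric]) simp_all
    also have "\<dots> = (\<integral>\<^sup>+w. ennreal (norm (f w * of_real \<bar>sin_kernel w u\<bar> powr p)) * ?C \<partial>?S)"
    proof (rule nn_integral_cong)
      fix w assume "w \<in> space ?S"
      then obtain b :: "real^'d^'n" where b: "complement_frame w b"
        using frame by (auto simp: space_stiefel_measure[OF mn])
      have "(\<lambda>x. ennreal (\<bar>cos_kernel (complement_sample w x) u\<bar> powr Re p)) \<in> borel_measurable ?G"
        using Gm[of w] by measurable
      then show "(\<integral>\<^sup>+x. ennreal (norm (f w * of_real \<bar>cos_kernel (complement_sample w x) u\<bar> powr p)) \<partial>?G)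
        = ennreal (norm (f w * of_real \<bar>sin_kernel w u\<bar> powr p)) * ?C"
        using nn_integral_complement_cos_kernel[OF b md u p]
        by (simp add: norm_mult norm_of_real_abs_powr ennreal_mult' nn_integral_cmult mult.assoc
            cos_kernel_commute[of _ u])
    qed
    \<comment> \<open>the hypothesis concerns the sine kernel with its arguments in the other order\<close>
    also have "\<dots> = (\<integral>\<^sup>+w. ennreal (norm (f w * of_real \<bar>sin_kernel u w\<bar> powr p)) * ?C \<partial>?S)"
      using sc by (intro nn_integral_cong_AE) (auto elim!: eventually_mono)
    also have "\<dots> < \<infinity>"
    proof -
      have "(\<lambda>v. ennreal (norm (f v * of_real \<bar>sin_kernel u v\<bar> powr p))) \<in> borel_measurable ?S"
        using borel_measurable_integrable[OF int] by measurable
      from nn_integral_multc[OF this] show ?thesis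
        using int by (simp add: integrable_iff_bounded ennreal_mult_less_top)
    qed
    finally show "?I < \<infinity>" .
  qed
  then have "integrable (distr (?S \<Otimes>\<^sub>M ?G) ?V ?Y) ?\<phi>"
    using integrable_distr_eq[OF Y \<phi>] by simp
  then have intX: "integrable (?S \<Otimes>\<^sub>M ?G) (\<lambda>z. ?\<phi> (?X z))"
    unfolding swap[symmetric] by (rule integrable_distr[OF X])
  have "cosine_transform \<alpha> (funk e f) u = (\<integral>v. \<integral>x. f (complement_sample v x) * of_real \<bar>cos_kernel v u\<bar> powr p \<partial>?G \<partial>?S)"
    unfolding cosine_transform_eq[OF p_def]
    by (rule Bochner_Integration.integral_cong[OF refl])
       (simp add: space_stiefel_measure[OF mn] funk_eq_complement_sample[OF e _ md fm])
  also have "\<dots> = (\<integral>z. ?\<phi> (?X z) \<partial>(?S \<Otimes>\<^sub>M ?G))"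
    using integral_fst'[OF intX] by simp
  also have "\<dots> = (\<integral>z. ?\<phi> z \<partial>distr (?S \<Otimes>\<^sub>M ?G) ?V ?X)"
    by (rule integral_distr[OF X \<phi>, symmetric])
  also have "\<dots> = (\<integral>z. ?\<phi> (?Y z) \<partial>(?S \<Otimes>\<^sub>M ?G))"
    unfolding swap by (rule integral_distr[OF Y \<phi>])
  also have "\<dots> = (\<integral>w. \<integral>x. f w * of_real \<bar>cos_kernel (complement_sample w x) u\<bar> powr p \<partial>?G \<partial>?S)"
    using integral_fst'[OF intY] by simp
  also have "\<dots> = (\<integral>w. ?c * (f w * of_real \<bar>sin_kernel w u\<bar> powr p) \<partial>?S)"
  proof (rule Bochner_Integration.integral_cong[OF refl])
    fix w assume "w \<in> space ?S"
    then obtain b :: "real^'d^'n" where b: "complement_frame w b"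
      using frame by (auto simp: space_stiefel_measure[OF mn])
    show "(\<integral>x. f w * of_real \<bar>cos_kernel (complement_sample w x) u\<bar> powr p \<partial>?G) = ?c * (f w * of_real \<bar>sin_kernel w u\<bar> powr p)"
      using integral_complement_cos_kernel[OF b md u p] by (simp add: cos_kernel_commute[of _ u])
  qed
  also have "\<dots> = (\<integral>w. ?c * (f w * of_real \<bar>sin_kernel u w\<bar> powr p) \<partial>?S)"
  proof (rule integral_cong_AE)
    have fS [measurable]: "f \<in> borel_measurable ?S" using f by simp
    have [measurable]: "(\<lambda>w. sin_kernel u w) \<in> borel_measurable ?S"
      by (rule measurable_stiefel_measure_borel[OF mn]) measurable
    have [measurable]: "(\<lambda>w. sin_kernel w u) \<in> borel_measurable ?S"
      by (rule measurable_stiefel_measure_borel[OF mn]) measurable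
    show "(\<lambda>w. ?c * (f w * of_real \<bar>sin_kernel w u\<bar> powr p)) \<in> borel_measurable ?S" 
      "(\<lambda>w. ?c * (f w * of_real \<bar>sin_kernel u w\<bar> powr p)) \<in> borel_measurable ?S" by measurable
    show "AE w in ?S. ?c * (f w * of_real \<bar>sin_kernel w u\<bar> powr p) = ?c * (f w * of_real \<bar>sin_kernel u w\<bar> powr p)"
      using sc by eventually_elim simp
  qed
  finally show ?thesis by simp
qed

theorem theorem4p4:
  fixes f :: "real ^ 'm ^ 'n \<Rightarrow> complex"
    and \<alpha> :: complex
    and e\<^sub>k :: "'d::finite + 'k::finite \<Rightarrow> 'n"
    and e\<^sub>m :: "'d'::finite + 'm \<Rightarrow> 'n"
  assumes "CARD('m) \<le> CARD('n) - 1" and "CARD('k) \<le> CARD('n) - 1"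
    and "bij e\<^sub>k" and "bij e\<^sub>m"
    and "integrable stiefel_measure f"
    and "Re \<alpha> > real CARD('m) - 1"
  shows "(CARD('k) \<le> CARD('n) - CARD('m) \<longrightarrow>
           eq_L1 (stiefel_measure :: (real ^ 'k ^ 'n) measure)
             (funk e\<^sub>k (cosine_transform \<alpha> f))
             (\<lambda>u. c_nkm CARD('n) CARD('k) CARD('m) \<alpha> *
                  sine_transform_gen (\<alpha> + of_nat CARD('n) - of_nat CARD('k) - of_nat CARD('m)) f u))
       \<and> (2 * CARD('m) \<le> CARD('n) \<longrightarrow>
           eq_L1 stiefel_measure
             (funk e\<^sub>m (cosine_transform \<alpha> f)) (cosine_transform \<alpha> (funk e\<^sub>m f))
         \<and> eq_L1 stiefel_measure
             (cosine_transform \<alpha> (funk e\<^sub>m f))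
             (\<lambda>u. c_nm CARD('n) CARD('m) \<alpha> *
                  sine_transform (\<alpha> + of_nat CARD('n) - 2 * of_nat CARD('m)) f u))"
proof -
  define p where "p = (\<alpha> - of_nat CARD('m)) / 2"
  have p: "Re p > - 1 / 2" using assms(6) by (simp add: p_def)
  have mn: "CARD('m) \<le> CARD('n)" using assms(1) by simp
  have kn: "CARD('k) \<le> CARD('n)" using assms(2) by simp
  have dk: "CARD('d) + CARD('k) = CARD('n)" and dm: "CARD('d') + CARD('m) = CARD('n)"
    using bij_betw_same_card[OF assms(3)] bij_betw_same_card[OF assms(4)] by simp_all
  have c: "c_nkm CARD('n) k CARD('m) \<alpha> = cos_mean_complex d CARD('m) p"
    if "CARD('m) \<le> d" "d + k = CARD('n)" for d k
  proof -
    have "(of_nat CARD('n) - of_nat k) / 2 = (of_nat d / 2 :: complex)"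
      and "\<alpha> / 2 = of_nat CARD('m) / 2 + p"
      and "(\<alpha> + of_nat CARD('n) - of_nat k - of_nat CARD('m)) / 2 = of_nat d / 2 + p"
      using that(2)[symmetric] by (simp_all add: p_def field_simps)
    then show ?thesis
      by (simp only: c_nkm_def cos_mean_complex_Gamma_m[OF that(1) p])
  qed
  show ?thesis
  proof (intro conjI impI)
    assume "CARD('k) \<le> CARD('n) - CARD('m)"
    then have md: "CARD('m) \<le> CARD('d)" using dk mn by simp
    let ?K = "stiefel_measure :: (real^'k^'n) measure"
    let ?S = "\<lambda>u. \<integral>v. f v * of_real \<bar>sin_kernel u v\<bar> powr p \<partial>stiefel_measure"
    interpret S: prob_space "stiefel_measure :: (real^'m^'n) measure" by (rule prob_space_stiefel_measure[OF mn])
    interpret K: prob_space ?K by (rule prob_space_stiefel_measure[OF kn])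
    interpret pair_sigma_finite ?K "stiefel_measure :: (real^'m^'n) measure" ..
    note pair = integrable_sin_kernel_pair[OF assms(3) md assms(5) p]
    have sine: "sine_transform_gen (\<alpha> + of_nat CARD('n) - of_nat CARD('k) - of_nat CARD('m)) f u = ?S u"
      for u :: "real^'k^'n"
      by (simp add: sine_transform_gen_def sin_kernel_def p_def)
    have const: "c_nkm CARD('n) CARD('k) CARD('m) \<alpha> = cos_mean_complex CARD('d) CARD('m) p"
      using c[OF md dk] .
    show "eq_L1 ?K (funk e\<^sub>k (cosine_transform \<alpha> f))
       (\<lambda>u. c_nkm CARD('n) CARD('k) CARD('m) \<alpha> *
          sine_transform_gen (\<alpha> + of_nat CARD('n) - of_nat CARD('k) - of_nat CARD('m)) f u)"
      unfolding eq_L1_def sine const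
    proof (intro conjI)
      show "integrable ?K (funk e\<^sub>k (cosine_transform \<alpha> f))"
        by (intro integrable_funk assms md integrable_cosine_transform mn)
      show "integrable ?K (\<lambda>u. cos_mean_complex CARD('d) CARD('m) p * ?S u)"
        using integrable_fst'[OF pair] by simp
      show "AE u in ?K. funk e\<^sub>k (cosine_transform \<alpha> f) u = cos_mean_complex CARD('d) CARD('m) p * ?S u"
        using AE_integrable_fst'[OF pair] AE_space
      proof eventually_elim
        case (elim u)
        then show ?case
          using funk_cosine_transform[OF assms(3) md assms(5,6) p_def, of u]
          by (simp add: space_stiefel_measure[OF kn])
      qed
    qed
  next
    assume mn2: "2 * CARD('m) \<le> CARD('n)"
    then have md: "CARD('m) \<le> CARD('d')" using dm by simp
    let ?K = "stiefel_measure :: (real^'m^'n) measure"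
    let ?S = "\<lambda>u. \<integral>v. f v * of_real \<bar>sin_kernel u v\<bar> powr p \<partial>stiefel_measure"
    let ?c = "cos_mean_complex CARD('d') CARD('m) p"
    interpret K: prob_space ?K by (rule prob_space_stiefel_measure[OF mn])
    interpret pair_sigma_finite ?K ?K ..
    note pair = integrable_sin_kernel_pair[OF assms(4) md assms(5) p]
    have sine: "sine_transform (\<alpha> + of_nat CARD('n) - 2 * of_nat CARD('m)) f u = ?S u" for u
      by (simp add: sine_transform_def sin_kernel_def p_def)
    have "c_nm CARD('n) CARD('m) \<alpha> = c_nkm CARD('n) CARD('m) CARD('m) \<alpha>"
      by (simp add: c_nm_def c_nkm_def)
    then have const: "c_nm CARD('n) CARD('m) \<alpha> = ?c"
      using c[OF md dm] by simp
    have intFM: "integrable ?K (funk e\<^sub>m (cosine_transform \<alpha> f))"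
      by (intro integrable_funk assms md integrable_cosine_transform mn)
    have intMF: "integrable ?K (cosine_transform \<alpha> (funk e\<^sub>m f))"
      by (intro integrable_funk assms md integrable_cosine_transform mn)
    have intS: "integrable ?K (\<lambda>u. ?c * ?S u)"
      using integrable_fst'[OF pair] by simp
    have FM: "AE u in ?K. funk e\<^sub>m (cosine_transform \<alpha> f) u = ?c * ?S u"
      using AE_integrable_fst'[OF pair] AE_space
    proof eventually_elim
      case (elim u)
      then show ?case
        using funk_cosine_transform[OF assms(4) md assms(5,6) p_def, of u]
        by (simp add: space_stiefel_measure[OF mn])
    qed
    have MF: "AE u in ?K. cosine_transform \<alpha> (funk e\<^sub>m f) u = ?c * ?S u"
      using AE_integrable_fst'[OF pair] AE_space
    proof eventually_elim
      case (elim u)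
      then show ?case
        using cosine_transform_funk[OF assms(4) md assms(5,6) p_def, of u]
        by (simp add: space_stiefel_measure[OF mn])
    qed
    show "eq_L1 ?K (funk e\<^sub>m (cosine_transform \<alpha> f)) (cosine_transform \<alpha> (funk e\<^sub>m f))"
      unfolding eq_L1_def using intFM intMF FM MF by (auto elim!: eventually_elim2)
    show "eq_L1 ?K (cosine_transform \<alpha> (funk e\<^sub>m f))
       (\<lambda>u. c_nm CARD('n) CARD('m) \<alpha> * sine_transform (\<alpha> + of_nat CARD('n) - 2 * of_nat CARD('m)) f u)"
      unfolding eq_L1_def sine const using intMF intS MF by simp
  qed
qed

end
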